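(* Let $n\ge2$ and let $U:\mathbb{R}\to(-\infty,\infty]$ be measurable, symmetric, with $\inf U>-\infty$, $0<\int e^{-U}<\infty$, such that $U$ restricted to $[-1,1]$ is twice continuously differentiable and, for some $0<\varepsilon\le1/2$, $U$ has $(1/8,1-\varepsilon)$-controlled gradients on $\mathbb{T}_n^2$. Let $\varphi\sim\mu_{\mathbb{T}_n^2,\mathbf 0,U}$. Then there is a constant $c>0$ depending only on $U$ and $\varepsilon$ (not on $n$) such that $$\mathbb{P}\Big(\max_{v\in V(\mathbb{T}_n^2)}|\varphi_v|\ge c\log n\Big)\ge\frac12.$$
   Context: For $n\ge1$, $\mathbb{T}_n^2$ is the discrete torus with vertex set $\{-n+1,\dots,n\}^2$, where $(a,b),(c,d)$ are adjacent if they agree in one coordinate and differ by $1$ mod $2n$ in the other; $\mathbf 0=(0,0)$. $\mu_{\mathbb{T}_n^2,\mathbf 0,U}$ is the probability measure with density $Z^{-1}\exp(-\sum_{(v,w)\in E(\mathbb{T}_n^2)}U(\varphi_v-\varphi_w))$ with respect to $\delta_0(d\varphi_{\mathbf 0})\prod_{v\ne\mathbf 0}d\varphi_v$. For $0<L<\infty$, $0<\delta<1$, $U$ has $(\delta,L)$-controlled gradients on $\mathbb{T}_n^2$ if (1) there is $K>L$ with $U(x)<\infty$ for $|x|<K$, and (2) for $\varphi\sim\mu_{\mathbb{T}_n^2,\mathbf 0,U}$ and all $k\ge1$ and distinct edges $e_1,\dots,e_k$, $\mathbb{P}(|\varphi_v-\varphi_w|\ge L \text{ for every } e_i=(v,w))\le\delta^k$.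 *)

theory Defs
  imports "HOL-Probability.Probability"
begin

definition torus_V :: "nat \<Rightarrow> (int \<times> int) set" where
  "torus_V n = {-int n + 1 .. int n} \<times> {-int n + 1 .. int n}"

definition cyc_succ :: "nat \<Rightarrow> int \<Rightarrow> int" where
  "cyc_succ n a = (if a = int n then - int n + 1 else a + 1)"

text \<open>Edge set of T_n^2, each edge listed once as an oriented pair (v, v + e_i),
  i = 1,2 (for n >= 2 this lists every nearest-neighbour edge exactly once).\<close>
definition torus_E :: "nat \<Rightarrow> ((int \<times> int) \<times> (int \<times> int)) set" where
  "torus_E n = (\<lambda>(a,b). ((a,b), (cyc_succ n a, b))) ` torus_V n
             \<union> (\<lambda>(a,b). ((a,b), (a, cyc_succ n b))) ` torus_V n"

definition expneg :: "(real \<Rightarrow> ereal) \<Rightarrow> real \<Rightarrow> ennreal" where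
  "expneg U x = (if U x = \<infinity> then 0 else ennreal (exp (- real_of_ereal (U x))))"

definition ref_measure :: "nat \<Rightarrow> ((int \<times> int) \<Rightarrow> real) measure" where
  "ref_measure n = PiM (torus_V n) (\<lambda>v. if v = (0,0) then return lborel 0 else lborel)"

definition gibbs_weight :: "nat \<Rightarrow> (real \<Rightarrow> ereal) \<Rightarrow> ((int \<times> int) \<Rightarrow> real) \<Rightarrow> ennreal" where
  "gibbs_weight n U \<phi> = (\<Prod>e\<in>torus_E n. expneg U (\<phi> (fst e) - \<phi> (snd e)))"

definition partition_fn :: "nat \<Rightarrow> (real \<Rightarrow> ereal) \<Rightarrow> ennreal" where
  "partition_fn n U = (\<integral>\<^sup>+ \<phi>. gibbs_weight n U \<phi> \<partial>ref_measure n)"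

definition gibbs_measure :: "nat \<Rightarrow> (real \<Rightarrow> ereal) \<Rightarrow> ((int \<times> int) \<Rightarrow> real) measure" where
  "gibbs_measure n U = density (ref_measure n) (\<lambda>\<phi>. gibbs_weight n U \<phi> / partition_fn n U)"

text \<open>(delta, L)-controlled gradients on T_n^2.  A collection of k distinct edges
  is a nonempty (finite) subset S of the edge set with card S = k.\<close>
definition controlled_gradients :: "real \<Rightarrow> real \<Rightarrow> nat \<Rightarrow> (real \<Rightarrow> ereal) \<Rightarrow> bool" where
  "controlled_gradients \<delta> L n U \<longleftrightarrow>
     (\<exists>K>L. \<forall>x. \<bar>x\<bar> < K \<longrightarrow> U x < \<infinity>) \<and>
     (\<forall>S. S \<subseteq> torus_E n \<longrightarrow> S \<noteq> {} \<longrightarrow>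
        measure (gibbs_measure n U)
          {\<phi> \<in> space (gibbs_measure n U). \<forall>e\<in>S. \<bar>\<phi> (fst e) - \<phi> (snd e)\<bar> \<ge> L}
        \<le> \<delta> ^ card S)"

end

theory Submission
  imports Defs "HOL-Library.Transitive_Closure_Table" "HOL-Library.Discrete_Functions"
begin

text \<open>
  On every edge split the weight as \<open>exp (- U) = exp (- U) * (1 - g\<^sup>3) + exp (- U) * g\<^sup>3\<close>, where the cutoff
  \<open>g\<close> is 1 on \<open>[-(1 - \<epsilon>), 1 - \<epsilon>]\<close> and vanishes outside \<open>(-1, 1)\<close>. Expanding the product adds to the
  surface a random set \<open>\<omega>\<close> of bad edges (those carrying the first summand), and controlled gradients
  say that \<open>\<omega>\<close> contains a given set of \<open>k\<close> edges with probability at most \<open>8\<^sup>-\<^sup>k\<close>. So the clusters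
  of \<open>\<omega>\<close> are small, and a logarithmic peak of height of order \<open>ln n\<close> can be made constant on them
  at a Dirichlet energy that stays of order \<open>ln n\<close>. For fixed \<open>\<omega>\<close> adding such a peak \<open>\<tau>\<close> is a
  translation, hence has no Jacobian; bad edges do not see it, and on the others the smoothness of \<open>U\<close>
  and of \<open>g\<close> bounds \<open>weight(\<phi>)\<^sup>2\<close> by \<open>exp (O(energy)) * weight(\<phi> + \<tau>) * weight(\<phi> - \<tau>)\<close>. The exponent
  3 makes the contribution of differences close to the zeros of \<open>g\<close> summable over the edges.

  Put such peaks around about \<open>\<surd>n\<close> well separated points. The image of the event \<open>max \<bar>\<phi>\<bar> < c ln n\<close>
  under the peak at one point forces \<open>\<phi>\<close> to be large there and small at all other points, so the images
  for different points are disjoint. Each of them has at least \<open>n\<close> to a small negative power times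
  the probability of the event, up to a small error, and since there are \<open>\<surd>n\<close> of them, this probability
  is at most 1/2. The finitely many remaining \<open>n\<close> follow from continuity of the measure.
\<close>

section \<open>One-edge estimates: the cutoff and its behaviour under opposite shifts\<close>

section \<open>The cutoff\<close>

text \<open>The parabola \<open>1 - z\<^sup>2\<close> leaves the value 1 without a kink and reaches
  0 with nonzero slope. Hence a shift that is small relative to
  \<open>\<epsilon> * cutoff \<epsilon> x\<close> stays in the support, and the loss in the product
  over both shifts is quadratic in the shift.\<close>

definition cutoff :: "real \<Rightarrow> real \<Rightarrow> real" where
  "cutoff \<epsilon> x = max 0 (1 - (max 0 ((\<bar>x\<bar> - (1 - \<epsilon>)) / \<epsilon>))\<^sup>2)"

lemma cutoff_nonneg: "0 \<le> cutoff \<epsilon> x"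
  and cutoff_le_1: "cutoff \<epsilon> x \<le> 1"
  by (auto simp: cutoff_def)

lemma cutoff_eq_1: "0 < \<epsilon> \<Longrightarrow> \<bar>x\<bar> \<le> 1 - \<epsilon> \<Longrightarrow> cutoff \<epsilon> x = 1"
  by (auto simp: cutoff_def max_def field_simps)

lemma borel_measurable_cutoff [measurable]: "cutoff \<epsilon> \<in> borel_measurable borel"
  unfolding cutoff_def by measurable

text \<open>The second part is an upper bound for the second difference of the negative logarithm of
  the cutoff. One of the points \<open>x + t\<close>, \<open>x - t\<close> moves outward by at most
  |t|; the other moves inward or ends where the cutoff is 1.\<close>

lemma cutoff_shift_bound:
  fixes x t :: real
  assumes e: "0 < \<epsilon>" "\<epsilon> \<le> 1/2" and g: "0 < cutoff \<epsilon> x" and t: "\<bar>t\<bar> \<le> \<epsilon> * cutoff \<epsilon> x / 4"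
  shows "\<bar>x\<bar> + \<bar>t\<bar> \<le> 1"
    and "(cutoff \<epsilon> x)\<^sup>2 * exp (- 12 * (t / (\<epsilon> * cutoff \<epsilon> x))\<^sup>2)
           \<le> cutoff \<epsilon> (x + t) * cutoff \<epsilon> (x - t)"
proof -
  define y where "y = (\<bar>x\<bar> - (1 - \<epsilon>)) / \<epsilon>"
  define s where "s = \<bar>t\<bar> / \<epsilon>"
  define z where "z = max 0 y"
  define G where "G = cutoff \<epsilon> x"
  have s0: "0 \<le> s" using e by (simp add: s_def)
  have z0: "0 \<le> z" by (simp add: z_def)
  have Gz: "G = 1 - z\<^sup>2" using g by (simp add: G_def cutoff_def y_def z_def max_def split: if_splits)
  have G01: "0 < G" "G \<le> 1" using g cutoff_le_1 by (auto simp: G_def)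
  have z1: "z < 1" using G01 z0 Gz by (metis abs_of_nonneg diff_gt_0_iff_gt power2_less_eq_zero_iff abs_square_less_1)
  have sG: "s \<le> G / 4" using t e by (simp add: s_def G_def field_simps)
  have "G = (1 - z) * (1 + z)" by (simp add: Gz algebra_simps power2_eq_square)
  \<comment> \<open>The linear decay \<open>G \<le> 2 * (1 - z)\<close> turns
    \<open>s \<le> G / 4\<close> into room of size \<open>2 * s\<close> below the end
    \<open>z = 1\<close> of the support.\<close>
  also have "\<dots> \<le> (1 - z) * 2" using z0 z1 by (intro mult_left_mono) auto
  finally have zs: "z + 2 * s \<le> 1" using sG by simp
  have yz: "y \<le> z" by (simp add: z_def)
  have "y + s \<le> 1" using yz zs s0 by simp
  then show a: "\<bar>x\<bar> + \<bar>t\<bar> \<le> 1" using e by (simp add: y_def s_def field_simps)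
  have ym: "(\<bar>u\<bar> - (1 - \<epsilon>)) / \<epsilon> \<le> b" if "\<bar>u\<bar> \<le> (1 - \<epsilon>) + \<epsilon> * b" for u b
    using that e by (simp add: field_simps)
  have lower: "1 - b\<^sup>2 \<le> cutoff \<epsilon> u" if "\<bar>u\<bar> \<le> (1 - \<epsilon>) + \<epsilon> * b" "0 \<le> b" for u b
  proof -
    have "max 0 ((\<bar>u\<bar> - (1 - \<epsilon>)) / \<epsilon>) \<le> b" using ym[OF that(1)] that(2) by simp
    then have "(max 0 ((\<bar>u\<bar> - (1 - \<epsilon>)) / \<epsilon>))\<^sup>2 \<le> b\<^sup>2" by (intro power_mono) auto
    then show ?thesis by (simp add: cutoff_def)
  qed
  have xb: "\<bar>x\<bar> \<le> (1 - \<epsilon>) + \<epsilon> * z"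
    using yz e by (simp add: y_def field_simps)
  have prod: "(1 - (z + s)\<^sup>2) * (1 - (max 0 (z - s))\<^sup>2) \<le> cutoff \<epsilon> (x + t) * cutoff \<epsilon> (x - t)"
  proof -
    have te: "\<bar>t\<bar> = \<epsilon> * s" using e by (simp add: s_def)
    have ts: "\<bar>t\<bar> \<le> 1 / 8"
    proof -
      have "\<epsilon> * G \<le> \<epsilon> * 1" using e G01 by (intro mult_left_mono) auto
      then show ?thesis using t e unfolding G_def by linarith
    qed
    have p: "1 - (z + s)\<^sup>2 \<le> cutoff \<epsilon> u" if "\<bar>u\<bar> \<le> \<bar>x\<bar> + \<bar>t\<bar>" for u
      using that xb te s0 z0 e by (intro lower) (auto simp: algebra_simps)
    \<comment> \<open>If |t| exceeds |x|, the inward point crosses 0. It then stays within 1/4 of 0,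
      where the cutoff is 1 because \<open>\<epsilon> \<le> 1/2\<close>.\<close>
    have q: "1 - (max 0 (z - s))\<^sup>2 \<le> cutoff \<epsilon> u" if "\<bar>u\<bar> \<le> max (\<bar>x\<bar> - \<bar>t\<bar>) (1/4)" for u
    proof (rule lower)
      have "\<epsilon> * (z - s) \<le> \<epsilon> * max 0 (z - s)" "0 \<le> \<epsilon> * max 0 (z - s)"
        using e by (auto intro!: mult_left_mono)
      then have "\<epsilon> * z - \<epsilon> * s \<le> \<epsilon> * max 0 (z - s)" "0 \<le> \<epsilon> * max 0 (z - s)"
        by (simp_all only: right_diff_distrib)
      then show "\<bar>u\<bar> \<le> (1 - \<epsilon>) + \<epsilon> * max 0 (z - s)"
        using that xb te e by linarith
    qed auto
    have pos1: "0 \<le> 1 - (z + s)\<^sup>2"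
      using zs s0 z0 by (simp add: power_le_one)
    have pos2: "0 \<le> 1 - (max 0 (z - s))\<^sup>2"
      using zs s0 z0 by (simp add: power_le_one)
    have "(\<bar>x + t\<bar> \<le> \<bar>x\<bar> + \<bar>t\<bar> \<and> \<bar>x - t\<bar> \<le> max (\<bar>x\<bar> - \<bar>t\<bar>) (1/4)) \<or>
          (\<bar>x - t\<bar> \<le> \<bar>x\<bar> + \<bar>t\<bar> \<and> \<bar>x + t\<bar> \<le> max (\<bar>x\<bar> - \<bar>t\<bar>) (1/4))"
      using ts by (auto simp: abs_if max_def)
    then show ?thesis
    proof
      assume "\<bar>x + t\<bar> \<le> \<bar>x\<bar> + \<bar>t\<bar> \<and> \<bar>x - t\<bar> \<le> max (\<bar>x\<bar> - \<bar>t\<bar>) (1/4)"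
      then show ?thesis using pos1 pos2 p q by (intro mult_mono cutoff_nonneg) auto
    next
      assume "\<bar>x - t\<bar> \<le> \<bar>x\<bar> + \<bar>t\<bar> \<and> \<bar>x + t\<bar> \<le> max (\<bar>x\<bar> - \<bar>t\<bar>) (1/4)"
      then have "(1 - (z + s)\<^sup>2) * (1 - (max 0 (z - s))\<^sup>2) \<le> cutoff \<epsilon> (x - t) * cutoff \<epsilon> (x + t)"
        using pos1 pos2 p q by (intro mult_mono cutoff_nonneg) auto
      then show ?thesis by (simp add: mult.commute)
    qed
  qed
  have "G\<^sup>2 - 6 * s\<^sup>2 \<le> (1 - (z + s)\<^sup>2) * (1 - (z - s)\<^sup>2)"
  proof -
    have "(1 - (z + s)\<^sup>2) * (1 - (z - s)\<^sup>2) = G\<^sup>2 - 2 * s\<^sup>2 * G - 4 * (z\<^sup>2 * s\<^sup>2) + (s\<^sup>2)\<^sup>2"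
      unfolding Gz by algebra
    moreover have "s\<^sup>2 * G \<le> s\<^sup>2 * 1" using G01 by (intro mult_left_mono) auto
    moreover have "z\<^sup>2 * s\<^sup>2 \<le> 1 * s\<^sup>2" using z0 z1 by (intro mult_right_mono) (auto simp: power_le_one)
    ultimately show ?thesis using zero_le_power2[of "s\<^sup>2"] by linarith
  qed
  also have "\<dots> \<le> (1 - (z + s)\<^sup>2) * (1 - (max 0 (z - s))\<^sup>2)"
  proof (intro mult_left_mono)
    show "0 \<le> 1 - (z + s)\<^sup>2" using zs s0 z0 by (simp add: power_le_one)
  qed (auto simp: max_def)
  also note prod
  finally have main: "G\<^sup>2 - 6 * s\<^sup>2 \<le> cutoff \<epsilon> (x + t) * cutoff \<epsilon> (x - t)" .
  define r where "r = (t / (\<epsilon> * G))\<^sup>2"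
  have sr: "s\<^sup>2 = r * G\<^sup>2" using e G01 by (simp add: r_def s_def power_divide power_mult_distrib)
  have "s\<^sup>2 \<le> (G/4)\<^sup>2" using sG s0 by (intro power_mono) auto
  then have "r * G\<^sup>2 \<le> (1/16) * G\<^sup>2" by (simp add: sr power_divide)
  then have r: "r \<le> 1/16" "0 \<le> r" using G01 by (auto simp: r_def)
  \<comment> \<open>With \<open>u = 6 * r\<close>, which is at most 3/8, use
    \<open>ln (1 - u) \<ge> - u - 2 * u\<^sup>2\<close>; the bound \<open>r \<le> 1/16\<close> makes
    the quadratic term at most another \<open>6 * r\<close>.\<close>
  have "exp (- 12 * r) \<le> 1 - 6 * r"
  proof -
    have "ln (1 - 6*r) \<ge> - (6 * r) - 2 * (6*r)\<^sup>2"
      using ln_one_minus_pos_lower_bound[of "6*r"] r by simp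
    moreover have "r * r \<le> (1/16) * r" using r by (intro mult_right_mono) auto
    then have "2 * (6*r)\<^sup>2 \<le> 6 * r" using r by (simp add: power2_eq_square)
    ultimately have "- 12 * r \<le> ln (1 - 6*r)" by simp
    then show ?thesis using r by (subst (asm) ln_ge_iff) auto
  qed
  then have "G\<^sup>2 * exp (- 12 * r) \<le> G\<^sup>2 * (1 - 6 * r)" by (intro mult_left_mono) auto
  also have "\<dots> = G\<^sup>2 - 6 * s\<^sup>2" by (simp add: sr algebra_simps)
  finally show "(cutoff \<epsilon> x)\<^sup>2 * exp (- 12 * (t / (\<epsilon> * cutoff \<epsilon> x))\<^sup>2)
           \<le> cutoff \<epsilon> (x + t) * cutoff \<epsilon> (x - t)" using main by (simp add: r_def G_def)
qed

text \<open>Two mean value steps: first for the symmetrised function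
  \<open>F (x + s) + F (x - s)\<close> on [0, t], then for \<open>F'\<close> between
  \<open>x - s\<close> and \<open>x + s\<close>. Estimating the intermediate s by t accounts for the
  factor 2. Derivatives are taken within [-1, 1], so the endpoints are included.\<close>

lemma second_difference_bound:
  fixes F F' F'' :: "real \<Rightarrow> real"
  assumes F: "\<And>x. x \<in> {-1..1} \<Longrightarrow> (F has_real_derivative F' x) (at x within {-1..1})"
    and F': "\<And>x. x \<in> {-1..1} \<Longrightarrow> (F' has_real_derivative F'' x) (at x within {-1..1})"
    and B: "\<And>x. x \<in> {-1..1} \<Longrightarrow> \<bar>F'' x\<bar> \<le> B"
    and t: "\<bar>x\<bar> + \<bar>t\<bar> \<le> 1"
  shows "F (x + t) + F (x - t) - 2 * F x \<le> 2 * B * t\<^sup>2"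
proof -
  have *: "F (x + t) + F (x - t) - 2 * F x \<le> 2 * B * t\<^sup>2" if t: "\<bar>x\<bar> + t \<le> 1" "0 \<le> t" for t
  proof -
    have B0: "0 \<le> B" using B[of 0] by simp
    define h where "h s = F (x + s) + F (x - s)" for s
    have "(h has_derivative (\<lambda>d. (F' (x + s) - F' (x - s)) * d)) (at s within {0..t})" if s: "s \<in> {0..t}" for s
    proof -
      have "((\<lambda>s. F (x + s)) has_real_derivative F' (x + s) * (0 + 1)) (at s within {0..t})"
        by (rule DERIV_image_chain[where f=F and g="\<lambda>s. x + s", unfolded comp_def, OF DERIV_subset[OF F]])
           (use s t in \<open>auto intro!: derivative_eq_intros\<close>)
      moreover have "((\<lambda>s. F (x - s)) has_real_derivative F' (x - s) * (0 - 1)) (at s within {0..t})"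
        by (rule DERIV_image_chain[where f=F and g="\<lambda>s. x - s", unfolded comp_def, OF DERIV_subset[OF F]])
           (use s t in \<open>auto intro!: derivative_eq_intros\<close>)
      ultimately have "(h has_real_derivative F' (x + s) * (0 + 1) + F' (x - s) * (0 - 1)) (at s within {0..t})"
        unfolding h_def by (rule DERIV_add)
      then show ?thesis by (simp add: has_field_derivative_def)
    qed
    then obtain s where s: "s \<in> {0..t}" and hs: "h t - h 0 = (F' (x + s) - F' (x - s)) * (t - 0)"
      using mvt_very_simple[of 0 t h "\<lambda>s d. (F' (x + s) - F' (x - s)) * d"] t by auto
    have "\<exists>u\<in>{x-s..x+s}. F' (x + s) - F' (x - s) = F'' u * ((x + s) - (x - s))"
    proof (rule mvt_very_simple)
      show "x - s \<le> x + s" using s by simp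
      show "(F' has_derivative (*) (F'' u)) (at u within {x - s..x + s})" if "x - s \<le> u" "u \<le> x + s" for u
        unfolding has_field_derivative_def[symmetric]
        by (rule DERIV_subset[OF F']) (use that s t in auto)
    qed
    then obtain u where u: "u \<in> {x-s..x+s}" and us: "F' (x + s) - F' (x - s) = F'' u * (2 * s)" by auto
    have "u \<in> {-1..1}" using u s t by auto
    then have "F'' u \<le> B" using B[of u] by linarith
    then have "F'' u * (2 * s) \<le> B * (2 * t)" using s B0
      by (intro mult_mono) auto
    then have "h t - h 0 \<le> B * (2 * t) * t" unfolding hs us using t by (simp add: mult_right_mono)
    then show ?thesis by (simp add: h_def power2_eq_square algebra_simps)
  qed
  show ?thesis
  proof (cases "0 \<le> t")
    case True then show ?thesis using * t by auto
  next
    case False then show ?thesis using *[of "-t"] t by (simp add: algebra_simps)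
  qed
qed

text \<open>The estimate for F is multiplied by the cube of the one for the cutoff, whence 36 = 3 *
  12. Since \<open>\<epsilon> * cutoff \<epsilon> x \<le> 1\<close>, the term
  \<open>2 * B * t\<^sup>2\<close> is absorbed into the relative shift.\<close>

lemma cutoff_weight_shift_bound:
  fixes F F' F'' :: "real \<Rightarrow> real"
  assumes F: "\<And>x. x \<in> {-1..1} \<Longrightarrow> (F has_real_derivative F' x) (at x within {-1..1})"
    and F': "\<And>x. x \<in> {-1..1} \<Longrightarrow> (F' has_real_derivative F'' x) (at x within {-1..1})"
    and B: "\<And>x. x \<in> {-1..1} \<Longrightarrow> \<bar>F'' x\<bar> \<le> B"
    and w: "\<And>x. x \<in> {-1..1} \<Longrightarrow> w x = exp (- F x)"
    and e: "0 < \<epsilon>" "\<epsilon> \<le> 1/2" and g: "0 < cutoff \<epsilon> x" and t: "\<bar>t\<bar> \<le> \<epsilon> * cutoff \<epsilon> x / 4"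
  shows "(w x * cutoff \<epsilon> x ^ 3)\<^sup>2 \<le> exp ((2 * B + 36) * (t / (\<epsilon> * cutoff \<epsilon> x))\<^sup>2) *
     ((w (x + t) * cutoff \<epsilon> (x + t) ^ 3) * (w (x - t) * cutoff \<epsilon> (x - t) ^ 3))"
proof -
  define r where "r = (t / (\<epsilon> * cutoff \<epsilon> x))\<^sup>2"
  note sb = cutoff_shift_bound[OF e g t]
  have B0: "0 \<le> B" using B[of 0] by simp
  have "\<epsilon> * cutoff \<epsilon> x \<le> 1 * 1" using e cutoff_le_1 cutoff_nonneg by (intro mult_mono) auto
  moreover have c0: "0 < \<epsilon> * cutoff \<epsilon> x" using e g by simp
  ultimately have "(\<epsilon> * cutoff \<epsilon> x)\<^sup>2 \<le> 1" by (simp add: power_le_one)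
  then have "r * (\<epsilon> * cutoff \<epsilon> x)\<^sup>2 \<le> r * 1" by (intro mult_left_mono) (auto simp: r_def)
  moreover have "t\<^sup>2 = r * (\<epsilon> * cutoff \<epsilon> x)\<^sup>2" using c0 by (auto simp: r_def power_divide)
  ultimately have "t\<^sup>2 \<le> r" by simp
  then have "2 * B * t\<^sup>2 \<le> 2 * B * r" using B0 by (intro mult_left_mono) auto
  then have Fb: "F (x + t) + F (x - t) - 2 * F x \<le> 2 * B * r"
    using second_difference_bound[OF F F' B sb(1)] by simp
  have ws: "w x = exp (- F x)" "w (x + t) = exp (- F (x + t))" "w (x - t) = exp (- F (x - t))"
    using sb(1) by (auto intro!: w)
  have 1: "(w x)\<^sup>2 \<le> exp (2 * B * r) * (w (x + t) * w (x - t))"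
    unfolding ws power2_eq_square mult_exp_exp using Fb by simp
  have "((cutoff \<epsilon> x)\<^sup>2 * exp (- 12 * r)) ^ 3 \<le> (cutoff \<epsilon> (x + t) * cutoff \<epsilon> (x - t)) ^ 3"
    using sb(2) unfolding r_def[symmetric] by (intro power_mono) auto
  then have "exp (36 * r) * ((cutoff \<epsilon> x)\<^sup>2 * exp (- 12 * r)) ^ 3
      \<le> exp (36 * r) * (cutoff \<epsilon> (x + t) * cutoff \<epsilon> (x - t)) ^ 3" by (intro mult_left_mono) auto
  moreover have "exp (36 * r) * ((cutoff \<epsilon> x)\<^sup>2 * exp (- 12 * r)) ^ 3
      = (exp (36 * r) * exp (- 12 * r) ^ 3) * ((cutoff \<epsilon> x) ^ 3)\<^sup>2"
    by (simp add: power_mult_distrib power_mult[symmetric])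
  moreover have "exp (36 * r) * exp (- 12 * r) ^ 3 = 1"
    by (simp add: exp_of_nat_mult[symmetric] mult_exp_exp)
  ultimately have 2: "((cutoff \<epsilon> x) ^ 3)\<^sup>2 \<le> exp (36 * r) * (cutoff \<epsilon> (x + t) ^ 3 * cutoff \<epsilon> (x - t) ^ 3)"
    by (simp only: power_mult_distrib mult_1_left)
  have "(w x)\<^sup>2 * ((cutoff \<epsilon> x) ^ 3)\<^sup>2 \<le> (exp (2 * B * r) * (w (x + t) * w (x - t))) *
     (exp (36 * r) * (cutoff \<epsilon> (x + t) ^ 3 * cutoff \<epsilon> (x - t) ^ 3))"
    using 1 2 by (intro mult_mono) (auto simp: ws cutoff_nonneg)
  also have "\<dots> = (exp (2 * B * r) * exp (36 * r)) * ((w (x + t) * cutoff \<epsilon> (x + t) ^ 3) * (w (x - t) * cutoff \<epsilon> (x - t) ^ 3))"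
    by (simp only: mult_ac)
  also have "exp (2 * B * r) * exp (36 * r) = exp ((2 * B + 36) * r)" by (simp add: mult_exp_exp algebra_simps)
  finally show ?thesis by (simp add: r_def power_mult_distrib)
qed

section \<open>Connected clusters of bad edges and their exponential tails\<close>

section \<open>Clusters of bad edges\<close>

definition linked :: "('v \<times> 'v) set \<Rightarrow> 'v \<Rightarrow> 'v \<Rightarrow> bool" where
  "linked \<omega> a b \<longleftrightarrow> (a, b) \<in> \<omega> \<or> (b, a) \<in> \<omega>"

definition cluster :: "('v \<times> 'v) set \<Rightarrow> 'v \<Rightarrow> 'v set" where
  "cluster \<omega> v = {u. (linked \<omega>)\<^sup>*\<^sup>* v u}"

text \<open>The starting vertex is not stored, so the length of the list is the number of
  steps.\<close>

fun walks :: "('v \<times> 'v) set \<Rightarrow> 'v \<Rightarrow> nat \<Rightarrow> 'v list set" where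
  "walks E v 0 = {[]}"
| "walks E v (Suc k) = (\<Union>u\<in>{u. linked E v u}. (#) u ` walks E u k)"

text \<open>A walk may traverse an edge against its orientation; the conditional records the
  orientation that occurs in E.\<close>

fun walk_edges :: "('v \<times> 'v) set \<Rightarrow> 'v \<Rightarrow> 'v list \<Rightarrow> ('v \<times> 'v) set" where
  "walk_edges E v [] = {}"
| "walk_edges E v (u # us) = insert (if (v, u) \<in> E then (v, u) else (u, v)) (walk_edges E u us)"

lemma cluster_refl: "v \<in> cluster \<omega> v"
  by (simp add: cluster_def)

lemma cluster_eqI:
  assumes "linked \<omega> a b" shows "cluster \<omega> a = cluster \<omega> b"
proof -
  have "linked \<omega> b a" using assms by (auto simp: linked_def)
  then show ?thesis
    using assms unfolding cluster_def by (auto intro: converse_rtranclp_into_rtranclp)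
qed

lemma cluster_mono: "\<omega> \<subseteq> \<omega>' \<Longrightarrow> cluster \<omega> v \<subseteq> cluster \<omega>' v"
  unfolding cluster_def linked_def by (auto elim!: rtranclp_mono[THEN predicate2D, rotated])

lemma cluster_subset: "cluster \<omega> v \<subseteq> insert v (fst ` \<omega> \<union> snd ` \<omega>)"
proof
  fix u assume "u \<in> cluster \<omega> v"
  then have "(linked \<omega>)\<^sup>*\<^sup>* v u" by (simp add: cluster_def)
  then show "u \<in> insert v (fst ` \<omega> \<union> snd ` \<omega>)"
    by (induction rule: rtranclp_induct) (force simp: linked_def)+
qed

lemma finite_cluster: "finite \<omega> \<Longrightarrow> finite (cluster \<omega> v)"
  by (rule finite_subset[OF cluster_subset]) auto

lemma walk_edges_vertices:
  "e \<in> walk_edges E v xs \<Longrightarrow> fst e \<in> set (v # xs) \<and> snd e \<in> set (v # xs)"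
  by (induction xs arbitrary: v) (auto split: if_splits)

lemma finite_walk_edges: "finite (walk_edges E v xs)"
  by (induction xs arbitrary: v) auto

text \<open>The first edge contains the starting vertex, which a self-avoiding walk never visits
  again, so no edge is repeated.\<close>

lemma card_walk_edges: "distinct (v # xs) \<Longrightarrow> card (walk_edges E v xs) = length xs"
proof (induction xs arbitrary: v)
  case (Cons u us)
  have "(if (v, u) \<in> E then (v, u) else (u, v)) \<notin> walk_edges E u us"
    using walk_edges_vertices[of "(v, u)" E u us] walk_edges_vertices[of "(u, v)" E u us] Cons.prems
    by (auto split: if_splits)
  then show ?case using Cons by (simp add: finite_walk_edges)
qed simp

lemma walk_edges_subset: "xs \<in> walks E v k \<Longrightarrow> walk_edges E v xs \<subseteq> E"
proof (induction k arbitrary: v xs)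
  case (Suc k)
  then obtain u us where "xs = u # us" "linked E v u" "us \<in> walks E u k" by auto
  then show ?case using Suc.IH[of us u] by (auto simp: linked_def)
qed simp

lemma length_walks: "xs \<in> walks E v k \<Longrightarrow> length xs = k"
  by (induction k arbitrary: v xs) auto

text \<open>The hypothesis \<open>anti\<close> ensures that the orientation selected by E is also
  the one that lies in \<open>\<omega>\<close>.\<close>

lemma path_in_walks:
  assumes "rtrancl_path (linked \<omega>) v xs y" "k \<le> length xs" "\<omega> \<subseteq> E"
    and anti: "\<And>a b. (a, b) \<in> E \<Longrightarrow> (b, a) \<notin> E"
  shows "take k xs \<in> walks E v k \<and> walk_edges E v (take k xs) \<subseteq> \<omega>"
  using assms(1,2)
proof (induction arbitrary: k)
  case (step x y ys z)
  show ?case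
  proof (cases k)
    case (Suc j)
    have "linked E x y" using step.hyps(1) \<open>\<omega> \<subseteq> E\<close> by (auto simp: linked_def)
    moreover have "(if (x, y) \<in> E then (x, y) else (y, x)) \<in> \<omega>"
      using step.hyps(1) \<open>\<omega> \<subseteq> E\<close> anti by (auto simp: linked_def)
    ultimately show ?thesis using step.IH[of j] step.prems Suc by auto
  qed simp
qed simp

text \<open>A union bound in which f plays the role of an unnormalised probability.\<close>

lemma sum_le_double_sum_of_bool:
  fixes f :: "'a \<Rightarrow> real"
  assumes "finite A" "finite B" "\<And>a. a \<in> A \<Longrightarrow> 0 \<le> f a"
    and "\<And>a. a \<in> A \<Longrightarrow> P a \<Longrightarrow> \<exists>b\<in>B. Q a b"
  shows "(\<Sum>a\<in>A. f a * of_bool (P a)) \<le> (\<Sum>b\<in>B. \<Sum>a\<in>A. f a * of_bool (Q a b))"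
proof -
  have "(\<Sum>a\<in>A. f a * of_bool (P a)) \<le> (\<Sum>a\<in>A. \<Sum>b\<in>B. f a * of_bool (Q a b))"
  proof (rule sum_mono)
    fix a assume a: "a \<in> A"
    show "f a * of_bool (P a) \<le> (\<Sum>b\<in>B. f a * of_bool (Q a b))"
    proof (cases "P a")
      case True
      then obtain b where b: "b \<in> B" "Q a b" using assms(4) a by blast
      have "f a * of_bool (Q a b) \<le> (\<Sum>b\<in>B. f a * of_bool (Q a b))"
        using b assms a by (intro member_le_sum) auto
      then show ?thesis using b True by simp
    qed (use assms a in \<open>auto intro!: sum_nonneg\<close>)
  qed
  also have "\<dots> = (\<Sum>b\<in>B. \<Sum>a\<in>A. f a * of_bool (Q a b))" by (rule sum.swap)
  finally show ?thesis .
qed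

text \<open>The partial sums have a closed form, and 18 is the value of the whole series. It becomes
  the bound for the third moment of a variable with tail \<open>(1/2) ^ k\<close>.\<close>

lemma sum_square_div_power2: "(\<Sum>k=1..N. 3 * (real k)\<^sup>2 * (1/2) ^ k) \<le> 18"
proof -
  have "(\<Sum>k=1..N. 3 * (real k)\<^sup>2 * (1/2) ^ k) = 18 - 3 * ((real N)\<^sup>2 + 4 * N + 6) * (1/2) ^ N"
    by (induction N) (auto simp: field_simps power2_eq_square)
  then show ?thesis by simp
qed

text \<open>Telescoping of \<open>k ^ 3 - (k - 1) ^ 3\<close>, which is at most
  \<open>3 * k\<^sup>2\<close> for k >= 1.\<close>

lemma cube_le_sum: "real x ^ 3 \<le> (\<Sum>k=1..x. 3 * (real k)\<^sup>2)"
  by (induction x) (auto simp: power3_eq_cube power2_eq_square algebra_simps)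

text \<open>The power mean inequality for a, b and 1. The mixed terms are handled by a rearrangement
  inequality and by the factorisation of \<open>a ^ 3 + b ^ 3 + 1 - 3 * (a * b)\<close>.\<close>

lemma cube_sum3_le:
  fixes a b :: real
  assumes "0 \<le> a" "0 \<le> b"
  shows "(a + b + 1) ^ 3 \<le> 9 * (a ^ 3 + b ^ 3 + 1)"
proof -
  have *: "x\<^sup>2 * y + x * y\<^sup>2 \<le> x ^ 3 + y ^ 3" if "0 \<le> x" "0 \<le> y" for x y :: real
  proof -
    have "x ^ 3 + y ^ 3 - (x\<^sup>2 * y + x * y\<^sup>2) = (x + y) * (x - y)\<^sup>2"
      by (simp add: power3_eq_cube power2_eq_square algebra_simps)
    moreover have "0 \<le> (x + y) * (x - y)\<^sup>2" using that by simp
    ultimately show ?thesis by linarith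
  qed
  have **: "6 * (a * b) \<le> 2 * (a ^ 3 + b ^ 3 + 1)"
  proof -
    have "a ^ 3 + b ^ 3 + 1 - 3 * (a * b) = (a + b + 1) * ((a - b)\<^sup>2 + (a - 1)\<^sup>2 + (b - 1)\<^sup>2) / 2"
      by (simp add: power3_eq_cube power2_eq_square algebra_simps)
    moreover have "0 \<le> (a + b + 1) * ((a - b)\<^sup>2 + (a - 1)\<^sup>2 + (b - 1)\<^sup>2) / 2" using assms by simp
    ultimately have "0 \<le> a ^ 3 + b ^ 3 + 1 - 3 * (a * b)" by (simp only:)
    then show ?thesis by simp
  qed
  have "(a + b + 1) ^ 3 = a ^ 3 + b ^ 3 + 1 + 3 * (a\<^sup>2 * b + a * b\<^sup>2) + 3 * (a\<^sup>2 * 1 + a * 1\<^sup>2)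
    + 3 * (b\<^sup>2 * 1 + b * 1\<^sup>2) + 6 * (a * b)"
    by (simp add: power3_eq_cube power2_eq_square algebra_simps)
  also have "\<dots> \<le> 9 * (a ^ 3 + b ^ 3 + 1)"
    using *[of a b] *[of a 1] *[of b 1] ** assms by simp
  finally show ?thesis .
qed

text \<open>Here p is a sub-probability on sets of bad edges, and \<open>\<rho>\<close> will be a
  truncated distance to the centre of a peak. The rate 1/8 beats the at most \<open>4 ^ k\<close>
  walks of length k by the factor \<open>(1/2) ^ k\<close>.\<close>

locale bond_percolation =
  fixes E :: "('v \<times> 'v) set" and p :: "('v \<times> 'v) set \<Rightarrow> real" and \<rho> :: "'v \<Rightarrow> nat"
  assumes finite_E: "finite E"
    and antisym_E: "(a, b) \<in> E \<Longrightarrow> (b, a) \<notin> E"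
    and degree_le_4: "card {b. linked E a b} \<le> 4"
    and p_nonneg: "0 \<le> p \<omega>"
    and p_superset: "S \<subseteq> E \<Longrightarrow> (\<Sum>\<omega>\<in>Pow E. p \<omega> * of_bool (S \<subseteq> \<omega>)) \<le> (1/8) ^ card S"
    and lipschitz: "(a, b) \<in> E \<Longrightarrow> \<rho> a \<le> \<rho> b + 1 \<and> \<rho> b \<le> \<rho> a + 1"
begin

text \<open>Replacing \<open>\<rho>\<close> by its maximum over the cluster makes it constant across
  every bad edge, and it can only grow when bad edges are added.\<close>

definition reach :: "('v \<times> 'v) set \<Rightarrow> 'v \<Rightarrow> nat" where
  "reach \<omega> v = Max (\<rho> ` cluster \<omega> v)"

definition excess :: "('v \<times> 'v) set \<Rightarrow> 'v \<Rightarrow> nat" where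
  "excess \<omega> v = reach \<omega> v - \<rho> v"

lemma finite_subset_E: "\<omega> \<subseteq> E \<Longrightarrow> finite \<omega>"
  using finite_E by (rule rev_finite_subset)

lemma reach_ge: "\<omega> \<subseteq> E \<Longrightarrow> \<rho> v \<le> reach \<omega> v"
  unfolding reach_def by (intro Max_ge finite_imageI finite_cluster finite_subset_E imageI cluster_refl)

lemma reach_eq_excess: "\<omega> \<subseteq> E \<Longrightarrow> reach \<omega> v = \<rho> v + excess \<omega> v"
  using reach_ge[of \<omega> v] by (simp add: excess_def)

lemma reach_le: "\<omega> \<subseteq> E \<Longrightarrow> (\<And>v. \<rho> v \<le> r) \<Longrightarrow> reach \<omega> v \<le> r"
  unfolding reach_def using cluster_refl[of v \<omega>]
  by (subst Max_le_iff) (auto intro: finite_cluster finite_subset_E)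

lemma reach_cong: "(a, b) \<in> \<omega> \<Longrightarrow> reach \<omega> a = reach \<omega> b"
  unfolding reach_def by (subst cluster_eqI[of \<omega> a b]) (auto simp: linked_def)

lemma reach_mono: "\<omega> \<subseteq> \<omega>' \<Longrightarrow> \<omega>' \<subseteq> E \<Longrightarrow> reach \<omega> v \<le> reach \<omega>' v"
  unfolding reach_def using cluster_refl[of v \<omega>]
  by (intro Max_mono image_mono cluster_mono finite_imageI finite_cluster finite_subset_E) auto

lemma excess_mono: "\<omega> \<subseteq> \<omega>' \<Longrightarrow> \<omega>' \<subseteq> E \<Longrightarrow> excess \<omega> v \<le> excess \<omega>' v"
  unfolding excess_def using reach_mono by (intro diff_le_mono)

lemma path_lipschitz:
  assumes "rtrancl_path (linked \<omega>) v xs y" "\<omega> \<subseteq> E"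
  shows "\<rho> y \<le> \<rho> v + length xs"
  using assms
proof (induction)
  case (step x y ys z)
  then have "\<rho> y \<le> \<rho> x + 1" using lipschitz by (auto simp: linked_def)
  then show ?case using step by auto
qed simp

text \<open>Since \<open>\<rho>\<close> changes by at most 1 per step, raising it by k inside a
  cluster takes at least k steps. Removing loops makes the path self-avoiding, and its first k steps
  are the witness.\<close>

lemma excess_imp_walk:
  assumes "\<omega> \<subseteq> E" "k \<le> excess \<omega> v"
  shows "\<exists>xs\<in>{xs\<in>walks E v k. distinct (v # xs)}. walk_edges E v xs \<subseteq> \<omega>"
proof -
  have "reach \<omega> v \<in> \<rho> ` cluster \<omega> v" unfolding reach_def
    using cluster_refl[of v \<omega>] assms by (intro Max_in finite_imageI finite_cluster finite_subset_E) auto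
  then obtain u where u: "u \<in> cluster \<omega> v" "\<rho> u = reach \<omega> v" by auto
  obtain xs' where "rtrancl_path (linked \<omega>) v xs' u"
    using u by (auto simp: cluster_def rtranclp_eq_rtrancl_path)
  then obtain xs where xs: "rtrancl_path (linked \<omega>) v xs u" "distinct (v # xs)"
    by (rule rtrancl_path_distinct)
  have "k \<le> length xs" using path_lipschitz[OF xs(1) assms(1)] u assms by (simp add: excess_def)
  with path_in_walks[OF xs(1) this assms(1) antisym_E] xs(2) show ?thesis
    by (intro bexI[of _ "take k xs"]) (auto dest: in_set_takeD)
qed

lemma finite_neighbours: "finite {b. linked E a b}"
proof (rule finite_subset)
  show "{b. linked E a b} \<subseteq> snd ` E \<union> fst ` E" by (force simp: linked_def)
qed (use finite_E in auto)

lemma walks_finite_card: "finite (walks E v k) \<and> card (walks E v k) \<le> 4 ^ k"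
proof (induction k arbitrary: v)
  case (Suc k)
  have "card (walks E v (Suc k)) \<le> (\<Sum>u\<in>{u. linked E v u}. card ((#) u ` walks E u k))"
    unfolding walks.simps by (rule card_UN_le[OF finite_neighbours])
  also have "\<dots> \<le> (\<Sum>u\<in>{u. linked E v u}. 4 ^ k)"
    using Suc by (intro sum_mono) (metis card_image_le le_trans)
  also have "\<dots> \<le> 4 * 4 ^ k" using degree_le_4[of v] by simp
  finally show ?case using Suc finite_neighbours by auto
qed simp

text \<open>A Peierls-type count: there are at most \<open>4 ^ k\<close> self-avoiding walks of
  length k, and the k distinct edges of each are all bad with weight at most
  \<open>(1/8) ^ k\<close>.\<close>

lemma excess_tail:
  "(\<Sum>\<omega>\<in>Pow E. p \<omega> * of_bool (k \<le> excess \<omega> v)) \<le> (1/2) ^ k"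
proof -
  let ?B = "{xs\<in>walks E v k. distinct (v # xs)}"
  have fB: "finite ?B" using walks_finite_card[of v k] by auto
  have "(\<Sum>\<omega>\<in>Pow E. p \<omega> * of_bool (k \<le> excess \<omega> v))
      \<le> (\<Sum>xs\<in>?B. \<Sum>\<omega>\<in>Pow E. p \<omega> * of_bool (walk_edges E v xs \<subseteq> \<omega>))"
    using finite_E fB p_nonneg excess_imp_walk by (intro sum_le_double_sum_of_bool) auto
  also have "\<dots> \<le> (\<Sum>xs\<in>?B. (1/8) ^ k)"
  proof (rule sum_mono)
    fix xs assume xs: "xs \<in> ?B"
    then have "card (walk_edges E v xs) = k" using length_walks card_walk_edges by fastforce
    then show "(\<Sum>\<omega>\<in>Pow E. p \<omega> * of_bool (walk_edges E v xs \<subseteq> \<omega>)) \<le> (1/8) ^ k"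
      using p_superset[OF walk_edges_subset, of xs v k] xs by auto
  qed
  also have "\<dots> = real (card ?B) * (1/8) ^ k" by simp
  also have "\<dots> \<le> 4 ^ k * (1/8) ^ k"
  proof (rule mult_right_mono)
    have "card ?B \<le> card (walks E v k)" using walks_finite_card[of v k] by (intro card_mono) auto
    then have "card ?B \<le> 4 ^ k" using walks_finite_card[of v k] by linarith
    then show "real (card ?B) \<le> 4 ^ k" by (metis of_nat_le_iff of_nat_numeral of_nat_power)
  qed simp
  also have "\<dots> = (1/2) ^ k" by (simp add: power_mult_distrib[symmetric])
  finally show ?thesis .
qed

text \<open>Summation over the levels of the excess: level k contributes at most
  \<open>3 * k\<^sup>2\<close> times the tail \<open>(1/2) ^ k\<close>.\<close>

lemma excess_third_moment: "(\<Sum>\<omega>\<in>Pow E. p \<omega> * real (excess \<omega> v) ^ 3) \<le> 18"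
proof -
  define N where "N = Max ((\<lambda>\<omega>. excess \<omega> v) ` Pow E)"
  have N: "excess \<omega> v \<le> N" if "\<omega> \<in> Pow E" for \<omega>
    unfolding N_def using that finite_E by (intro Max_ge) auto
  have "(\<Sum>\<omega>\<in>Pow E. p \<omega> * real (excess \<omega> v) ^ 3)
      \<le> (\<Sum>\<omega>\<in>Pow E. p \<omega> * (\<Sum>k=1..N. 3 * (real k)\<^sup>2 * of_bool (k \<le> excess \<omega> v)))"
  proof (intro sum_mono mult_left_mono p_nonneg)
    fix \<omega> assume w: "\<omega> \<in> Pow E"
    have "(\<Sum>k=1..N. 3 * (real k)\<^sup>2 * of_bool (k \<le> excess \<omega> v)) = (\<Sum>k=1..excess \<omega> v. 3 * (real k)\<^sup>2)"
      using N[OF w] by (intro sum.mono_neutral_cong_right) auto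
    then show "real (excess \<omega> v) ^ 3 \<le> (\<Sum>k=1..N. 3 * (real k)\<^sup>2 * of_bool (k \<le> excess \<omega> v))"
      using cube_le_sum by simp
  qed
  also have "\<dots> = (\<Sum>\<omega>\<in>Pow E. \<Sum>k=1..N. 3 * (real k)\<^sup>2 * (p \<omega> * of_bool (k \<le> excess \<omega> v)))"
    unfolding sum_distrib_left by (intro sum.cong refl) simp
  also have "\<dots> = (\<Sum>k=1..N. 3 * (real k)\<^sup>2 * (\<Sum>\<omega>\<in>Pow E. p \<omega> * of_bool (k \<le> excess \<omega> v)))"
    unfolding sum_distrib_left by (rule sum.swap)
  also have "\<dots> \<le> (\<Sum>k=1..N. 3 * (real k)\<^sup>2 * (1/2) ^ k)"
    by (intro sum_mono mult_left_mono excess_tail) auto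
  also have "\<dots> \<le> 18" by (rule sum_square_div_power2)
  finally show ?thesis .
qed

lemma sum_p_le_1: "(\<Sum>\<omega>\<in>Pow E. p \<omega>) \<le> 1"
  using p_superset[of "{}"] by simp

text \<open>The constant is 333 = 9 * (18 + 18 + 1). The summand 1 keeps the base at least 1, so the
  cube covers all lower powers.\<close>

lemma excess_pair_moment:
  assumes "q \<le> 3"
  shows "(\<Sum>\<omega>\<in>Pow E. p \<omega> * (real (excess \<omega> a) + real (excess \<omega> b) + 1) ^ q) \<le> 333"
proof -
  have "(\<Sum>\<omega>\<in>Pow E. p \<omega> * (real (excess \<omega> a) + real (excess \<omega> b) + 1) ^ q)
     \<le> (\<Sum>\<omega>\<in>Pow E. p \<omega> * (9 * (real (excess \<omega> a) ^ 3 + real (excess \<omega> b) ^ 3 + 1)))"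
  proof (intro sum_mono mult_left_mono p_nonneg)
    fix \<omega>
    have "(real (excess \<omega> a) + real (excess \<omega> b) + 1) ^ q \<le> (real (excess \<omega> a) + real (excess \<omega> b) + 1) ^ 3"
      using assms by (intro power_increasing) auto
    also have "\<dots> \<le> 9 * (real (excess \<omega> a) ^ 3 + real (excess \<omega> b) ^ 3 + 1)"
      by (rule cube_sum3_le) auto
    finally show "(real (excess \<omega> a) + real (excess \<omega> b) + 1) ^ q
        \<le> 9 * (real (excess \<omega> a) ^ 3 + real (excess \<omega> b) ^ 3 + 1)" .
  qed
  also have "\<dots> = 9 * ((\<Sum>\<omega>\<in>Pow E. p \<omega> * real (excess \<omega> a) ^ 3)
     + (\<Sum>\<omega>\<in>Pow E. p \<omega> * real (excess \<omega> b) ^ 3) + (\<Sum>\<omega>\<in>Pow E. p \<omega>))"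
    by (simp add: sum_distrib_left sum_distrib_right sum.distrib algebra_simps)
  also have "\<dots> \<le> 333"
    using excess_third_moment[of a] excess_third_moment[of b] sum_p_le_1 by simp
  finally show ?thesis .
qed

end

section \<open>Expansion into good and bad edges, and the two-sided shift inequality\<close>

section \<open>Splitting the weight\<close>

definition edge_diff :: "('v \<Rightarrow> real) \<Rightarrow> 'v \<times> 'v \<Rightarrow> real" where
  "edge_diff \<phi> e = \<phi> (fst e) - \<phi> (snd e)"

text \<open>The unnormalised joint weight of a surface \<open>\<phi>\<close> and a set
  \<open>\<omega>\<close> of bad edges; summing over \<open>\<omega>\<close> returns the product of
  the edge weights.\<close>

definition split_weight :: "(real \<Rightarrow> real) \<Rightarrow> real \<Rightarrow> ('v \<times> 'v) set \<Rightarrow> ('v \<Rightarrow> real) \<Rightarrow> ('v \<times> 'v) set \<Rightarrow> real" where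
  "split_weight w \<epsilon> E \<phi> \<omega> =
     (\<Prod>e\<in>\<omega>. w (edge_diff \<phi> e) * (1 - cutoff \<epsilon> (edge_diff \<phi> e) ^ 3)) *
     (\<Prod>e\<in>E - \<omega>. w (edge_diff \<phi> e) * cutoff \<epsilon> (edge_diff \<phi> e) ^ 3)"

lemma cutoff_power_le_1: "cutoff \<epsilon> x ^ k \<le> 1"
  by (simp add: power_le_one cutoff_nonneg cutoff_le_1)

lemma split_weight_nonneg: "(\<And>x. 0 \<le> w x) \<Longrightarrow> 0 \<le> split_weight w \<epsilon> E \<phi> \<omega>"
  unfolding split_weight_def
  by (intro mult_nonneg_nonneg prod_nonneg ballI) (auto simp: cutoff_power_le_1 cutoff_nonneg)

text \<open>Setting the factor of a good edge to 0 on S forces S to consist of bad edges, and the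
  restricted sum still factorises over the edges.\<close>

lemma sum_split_weight_superset:
  assumes "finite E" "S \<subseteq> E"
  shows "(\<Sum>\<omega>\<in>Pow E. split_weight w \<epsilon> E \<phi> \<omega> * of_bool (S \<subseteq> \<omega>)) =
     (\<Prod>e\<in>E. w (edge_diff \<phi> e)) * (\<Prod>e\<in>S. 1 - cutoff \<epsilon> (edge_diff \<phi> e) ^ 3)"
proof -
  let ?a = "\<lambda>e. w (edge_diff \<phi> e) * (1 - cutoff \<epsilon> (edge_diff \<phi> e) ^ 3)"
  let ?b = "\<lambda>e. if e \<in> S then 0 else w (edge_diff \<phi> e) * cutoff \<epsilon> (edge_diff \<phi> e) ^ 3"
  have "(\<Sum>\<omega>\<in>Pow E. split_weight w \<epsilon> E \<phi> \<omega> * of_bool (S \<subseteq> \<omega>)) =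
        (\<Sum>\<omega>\<in>Pow E. prod ?a \<omega> * prod ?b (E - \<omega>))"
  proof (rule sum.cong[OF refl])
    fix \<omega> assume "\<omega> \<in> Pow E"
    show "split_weight w \<epsilon> E \<phi> \<omega> * of_bool (S \<subseteq> \<omega>) = prod ?a \<omega> * prod ?b (E - \<omega>)"
    proof (cases "S \<subseteq> \<omega>")
      case True
      then have "prod ?b (E - \<omega>) = (\<Prod>e\<in>E - \<omega>. w (edge_diff \<phi> e) * cutoff \<epsilon> (edge_diff \<phi> e) ^ 3)"
        by (intro prod.cong) auto
      then show ?thesis using True by (simp add: split_weight_def)
    next
      case False
      then have "prod ?b (E - \<omega>) = 0" using assms by (intro prod_zero) auto
      then show ?thesis using False by simp
    qed
  qed
  also have "\<dots> = (\<Prod>e\<in>E. ?a e + ?b e)"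
    using assms(1) by (simp add: prod_add)
  also have "\<dots> = (\<Prod>e\<in>E. w (edge_diff \<phi> e) * (if e \<in> S then 1 - cutoff \<epsilon> (edge_diff \<phi> e) ^ 3 else 1))"
    by (intro prod.cong) (auto simp: algebra_simps)
  also have "\<dots> = (\<Prod>e\<in>E. w (edge_diff \<phi> e)) * (\<Prod>e\<in>S. 1 - cutoff \<epsilon> (edge_diff \<phi> e) ^ 3)"
    using assms by (simp add: prod.distrib prod.If_cases Int_absorb1)
  finally show ?thesis .
qed

lemma sum_split_weight:
  assumes "finite E"
  shows "(\<Sum>\<omega>\<in>Pow E. split_weight w \<epsilon> E \<phi> \<omega>) = (\<Prod>e\<in>E. w (edge_diff \<phi> e))"
  using sum_split_weight_superset[OF assms, of "{}" w \<epsilon> \<phi>] by simp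

text \<open>Given \<open>\<phi>\<close>, the state of \<open>e\<close> is independent of the other edges, so forgetting it
  compensates the singular factor: \<open>cutoff ^ 3 / cutoff ^ q \<le> 1\<close>.\<close>
lemma sum_split_weight_resample:
  assumes fin: "finite E" and e: "e \<in> E" and w: "\<And>x. 0 \<le> w x" and q: "q \<le> 3"
    and G0: "\<And>\<omega>. 0 \<le> G \<omega>" and mono: "\<And>\<omega> \<omega>'. \<omega> \<subseteq> \<omega>' \<Longrightarrow> \<omega>' \<subseteq> E \<Longrightarrow> G \<omega> \<le> G \<omega>'"
  shows "(\<Sum>\<omega>\<in>Pow E. split_weight w \<epsilon> E \<phi> \<omega> * (of_bool (e \<notin> \<omega>) * (G \<omega> / cutoff \<epsilon> (edge_diff \<phi> e)) ^ q))
     \<le> (\<Sum>\<omega>\<in>Pow E. split_weight w \<epsilon> E \<phi> \<omega> * G \<omega> ^ q)"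
proof -
  define F where "F = E - {e}"
  have EF: "E = insert e F" "e \<notin> F" "finite F" using e fin by (auto simp: F_def)
  \<comment> \<open>Every set without e is paired with the same set enlarged by e.\<close>
  have split: "(\<Sum>\<omega>\<in>Pow E. f \<omega>) = (\<Sum>\<omega>\<in>Pow F. f \<omega> + f (insert e \<omega>))" for f :: "_ \<Rightarrow> real"
  proof -
    have "inj_on (insert e) (Pow F)" using EF(2) by (auto simp: inj_on_def)
    moreover have "Pow F \<inter> insert e ` Pow F = {}" using EF(2) by auto
    ultimately show ?thesis using EF(3)
      by (simp add: EF(1) Pow_insert sum.union_disjoint sum.reindex sum.distrib)
  qed
  let ?W = "split_weight w \<epsilon> E \<phi>" and ?g = "cutoff \<epsilon> (edge_diff \<phi> e)"
  have "(\<Sum>\<omega>\<in>Pow E. ?W \<omega> * (of_bool (e \<notin> \<omega>) * (G \<omega> / ?g) ^ q)) = (\<Sum>\<omega>\<in>Pow F. ?W \<omega> * (G \<omega> / ?g) ^ q)"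
    unfolding split using EF(2) by (intro sum.cong) auto
  also have "\<dots> \<le> (\<Sum>\<omega>\<in>Pow F. ?W \<omega> * G \<omega> ^ q + ?W (insert e \<omega>) * G (insert e \<omega>) ^ q)"
  proof (rule sum_mono)
    fix \<omega> assume "\<omega> \<in> Pow F"
    then have \<omega>: "\<omega> \<subseteq> F" "e \<notin> \<omega>" "finite \<omega>" using EF by (auto intro: finite_subset)
    define P where "P = w (edge_diff \<phi> e) * ((\<Prod>e\<in>\<omega>. w (edge_diff \<phi> e) * (1 - cutoff \<epsilon> (edge_diff \<phi> e) ^ 3)) *
     (\<Prod>e\<in>F - \<omega>. w (edge_diff \<phi> e) * cutoff \<epsilon> (edge_diff \<phi> e) ^ 3))"
    have P0: "0 \<le> P" unfolding P_def
      by (intro mult_nonneg_nonneg prod_nonneg ballI) (auto simp: cutoff_power_le_1 cutoff_nonneg w)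
    have "E - \<omega> = insert e (F - \<omega>)" using EF \<omega> by auto
    then have W1: "?W \<omega> = P * ?g ^ 3"
      using EF by (simp add: split_weight_def P_def mult_ac)
    have "E - insert e \<omega> = F - \<omega>" using EF \<omega> by auto
    then have W2: "?W (insert e \<omega>) = P * (1 - ?g ^ 3)"
      using EF \<omega> by (simp add: split_weight_def P_def mult_ac)
    \<comment> \<open>At a zero of the cutoff the numerator vanishes and the quotient is 0;
      elsewhere the cutoff lies in (0, 1] and \<open>q \<le> 3\<close> applies. The exponent 3 in
      the splitting is chosen for this bound.\<close>
    have gq: "?g ^ 3 / ?g ^ q \<le> 1"
    proof (cases "?g = 0")
      case False
      then have "?g ^ 3 \<le> ?g ^ q" using q cutoff_nonneg cutoff_le_1 by (intro power_decreasing) auto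
      then show ?thesis using False cutoff_nonneg[of \<epsilon> "edge_diff \<phi> e"] by (simp add: divide_le_eq)
    qed auto
    have "?W \<omega> * (G \<omega> / ?g) ^ q = P * G \<omega> ^ q * (?g ^ 3 / ?g ^ q)"
      by (simp add: W1 power_divide)
    also have "\<dots> \<le> P * G \<omega> ^ q * 1" using gq P0 G0 by (intro mult_left_mono) auto
    also have "\<dots> = P * ?g ^ 3 * G \<omega> ^ q + P * (1 - ?g ^ 3) * G \<omega> ^ q" by (simp add: algebra_simps)
    \<comment> \<open>Declaring e bad can only increase G. The two resulting terms are exactly those
      of the two states of e.\<close>
    also have "\<dots> \<le> P * ?g ^ 3 * G \<omega> ^ q + P * (1 - ?g ^ 3) * G (insert e \<omega>) ^ q"
      using P0 G0 mono[of \<omega> "insert e \<omega>"] \<omega> EF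
      by (intro add_left_mono mult_left_mono power_mono mult_nonneg_nonneg) (auto simp: cutoff_power_le_1)
    finally show "?W \<omega> * (G \<omega> / ?g) ^ q \<le> ?W \<omega> * G \<omega> ^ q + ?W (insert e \<omega>) * G (insert e \<omega>) ^ q"
      unfolding W1 W2 .
  qed
  also have "\<dots> = (\<Sum>\<omega>\<in>Pow E. ?W \<omega> * G \<omega> ^ q)" by (rule split[symmetric])
  finally show ?thesis .
qed

text \<open>F stands for the potential on [-1, 1]. Outside this interval the only information about
  w is that it is nonnegative.\<close>

locale smooth_weight =
  fixes w F F' F'' :: "real \<Rightarrow> real" and B \<epsilon> :: real
  assumes F: "\<And>x. x \<in> {-1..1} \<Longrightarrow> (F has_real_derivative F' x) (at x within {-1..1})"
    and F': "\<And>x. x \<in> {-1..1} \<Longrightarrow> (F' has_real_derivative F'' x) (at x within {-1..1})"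
    and F''_le: "\<And>x. x \<in> {-1..1} \<Longrightarrow> \<bar>F'' x\<bar> \<le> B"
    and w_eq: "\<And>x. x \<in> {-1..1} \<Longrightarrow> w x = exp (- F x)"
    and w_nonneg: "\<And>x. 0 \<le> w x"
    and eps: "0 < \<epsilon>" "\<epsilon> \<le> 1/2"
begin

lemma B_nonneg: "0 \<le> B"
  using F''_le[of 0] by simp

text \<open>Increments on bad edges are unchanged, and every good edge obeys the one-edge bound.
  Their product compares the square of the weight with the product of the two shifted weights;
  \<open>a * b \<le> (a + b)\<^sup>2\<close> and a square root then give a bound linear in the
  weights, which can be integrated.\<close>

lemma split_weight_shift:
  assumes fin: "finite E" "\<omega> \<subseteq> E"
    and zero: "\<And>e. e \<in> \<omega> \<Longrightarrow> edge_diff \<tau> e = 0"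
    and pos: "\<And>e. e \<in> E - \<omega> \<Longrightarrow> 0 < cutoff \<epsilon> (edge_diff \<phi> e)"
    and small: "\<And>e. e \<in> E - \<omega> \<Longrightarrow> \<bar>edge_diff \<tau> e\<bar> \<le> \<epsilon> * cutoff \<epsilon> (edge_diff \<phi> e) / 4"
    and K: "(\<Sum>e\<in>E-\<omega>. (edge_diff \<tau> e / (\<epsilon> * cutoff \<epsilon> (edge_diff \<phi> e)))\<^sup>2) \<le> K"
  shows "split_weight w \<epsilon> E \<phi> \<omega> \<le> exp ((B + 18) * K) *
     (split_weight w \<epsilon> E (\<lambda>v. \<phi> v + \<tau> v) \<omega> + split_weight w \<epsilon> E (\<lambda>v. \<phi> v - \<tau> v) \<omega>)"
proof -
  let ?W = "\<lambda>\<phi>. split_weight w \<epsilon> E \<phi> \<omega>"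
  let ?a = "\<lambda>x. w x * cutoff \<epsilon> x ^ 3" and ?b = "\<lambda>x. w x * (1 - cutoff \<epsilon> x ^ 3)"
  let ?x = "edge_diff \<phi>" and ?t = "edge_diff \<tau>"
  let ?r = "\<lambda>e. (?t e / (\<epsilon> * cutoff \<epsilon> (?x e)))\<^sup>2"
  have p: "edge_diff (\<lambda>v. \<phi> v + \<tau> v) e = ?x e + ?t e" "edge_diff (\<lambda>v. \<phi> v - \<tau> v) e = ?x e - ?t e" for e
    by (auto simp: edge_diff_def)
  have a0: "0 \<le> ?a x" for x by (simp add: w_nonneg cutoff_nonneg)
  have b0: "0 \<le> ?b x" for x by (simp add: w_nonneg cutoff_power_le_1)
  have Wn: "0 \<le> ?W \<phi>" for \<phi> by (simp add: split_weight_nonneg w_nonneg)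
  have "(\<Prod>e\<in>E-\<omega>. (?a (?x e))\<^sup>2) \<le> (\<Prod>e\<in>E-\<omega>. exp ((2 * B + 36) * ?r e) * (?a (?x e + ?t e) * ?a (?x e - ?t e)))"
    using cutoff_weight_shift_bound[OF F F' F''_le w_eq eps pos small]
    by (intro prod_mono) auto
  also have "\<dots> = exp ((2 * B + 36) * (\<Sum>e\<in>E-\<omega>. ?r e)) * ((\<Prod>e\<in>E-\<omega>. ?a (?x e + ?t e)) * (\<Prod>e\<in>E-\<omega>. ?a (?x e - ?t e)))"
    using fin by (simp add: prod.distrib exp_sum sum_distrib_left)
  also have "\<dots> \<le> exp ((2 * B + 36) * K) * ((\<Prod>e\<in>E-\<omega>. ?a (?x e + ?t e)) * (\<Prod>e\<in>E-\<omega>. ?a (?x e - ?t e)))"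
    using K B_nonneg by (intro mult_right_mono mult_nonneg_nonneg prod_nonneg ballI)
      (auto intro!: mult_left_mono simp: w_nonneg cutoff_nonneg)
  finally have A: "(\<Prod>e\<in>E-\<omega>. (?a (?x e))\<^sup>2) \<le>
     exp ((2 * B + 36) * K) * ((\<Prod>e\<in>E-\<omega>. ?a (?x e + ?t e)) * (\<Prod>e\<in>E-\<omega>. ?a (?x e - ?t e)))" .
  have bs: "(\<Prod>e\<in>\<omega>. ?b (?x e + ?t e)) = (\<Prod>e\<in>\<omega>. ?b (?x e))" "(\<Prod>e\<in>\<omega>. ?b (?x e - ?t e)) = (\<Prod>e\<in>\<omega>. ?b (?x e))"
    using zero by (auto intro!: prod.cong)
  have "(?W \<phi>)\<^sup>2 = (\<Prod>e\<in>\<omega>. ?b (?x e))\<^sup>2 * (\<Prod>e\<in>E-\<omega>. (?a (?x e))\<^sup>2)"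
    by (simp add: split_weight_def power_mult_distrib prod_power_distrib)
  also have "\<dots> \<le> (\<Prod>e\<in>\<omega>. ?b (?x e))\<^sup>2 * (exp ((2 * B + 36) * K) *
        ((\<Prod>e\<in>E-\<omega>. ?a (?x e + ?t e)) * (\<Prod>e\<in>E-\<omega>. ?a (?x e - ?t e))))"
    using A by (intro mult_left_mono) auto
  also have "\<dots> = exp ((2 * B + 36) * K) * (?W (\<lambda>v. \<phi> v + \<tau> v) * ?W (\<lambda>v. \<phi> v - \<tau> v))"
    by (simp only: split_weight_def p bs power2_eq_square mult_ac)
  also have "\<dots> \<le> exp ((2 * B + 36) * K) * (?W (\<lambda>v. \<phi> v + \<tau> v) + ?W (\<lambda>v. \<phi> v - \<tau> v))\<^sup>2"
    using Wn by (intro mult_left_mono) (auto simp: power2_eq_square algebra_simps)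
  also have "exp ((2 * B + 36) * K) = (exp ((B + 18) * K))\<^sup>2"
    by (simp add: power2_eq_square mult_exp_exp algebra_simps)
  also have "(exp ((B + 18) * K))\<^sup>2 * (?W (\<lambda>v. \<phi> v + \<tau> v) + ?W (\<lambda>v. \<phi> v - \<tau> v))\<^sup>2
     = (exp ((B + 18) * K) * (?W (\<lambda>v. \<phi> v + \<tau> v) + ?W (\<lambda>v. \<phi> v - \<tau> v)))\<^sup>2"
    by (simp add: power_mult_distrib)
  finally show ?thesis
    by (rule power2_le_imp_le) (use Wn in auto)
qed

text \<open>A pointwise Markov argument for each \<open>\<omega>\<close>: either the error factor is
  at least 1 and dominates the term, or it is below 1 and the shift bound applies, with the
  quadratic sum controlling the energy and the cubic sum each single increment. The cutoffs in the
  denominators are then removed by resampling, for which b may depend only on e and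
  \<open>\<omega>\<close> and has to be monotone in \<open>\<omega>\<close>.\<close>

lemma weight_le_shifted_plus_error:
  fixes \<tau> :: "('v \<times> 'v) set \<Rightarrow> 'v \<Rightarrow> real" and b :: "'v \<times> 'v \<Rightarrow> ('v \<times> 'v) set \<Rightarrow> real"
  assumes fin: "finite E"
    and zero: "\<And>\<omega> e. \<omega> \<subseteq> E \<Longrightarrow> e \<in> \<omega> \<Longrightarrow> edge_diff (\<tau> \<omega>) e = 0"
    and b: "\<And>\<omega> e. \<omega> \<subseteq> E \<Longrightarrow> e \<in> E \<Longrightarrow> \<bar>edge_diff (\<tau> \<omega>) e\<bar> \<le> b e \<omega>"
    and b0: "\<And>\<omega> e. 0 \<le> b e \<omega>"
    and mono: "\<And>\<omega> \<omega>' e. e \<in> E \<Longrightarrow> \<omega> \<subseteq> \<omega>' \<Longrightarrow> \<omega>' \<subseteq> E \<Longrightarrow> b e \<omega> \<le> b e \<omega>'"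
    and K: "0 < K"
  shows "(\<Prod>e\<in>E. w (edge_diff \<phi> e)) \<le>
      exp ((B + 18) * K) * (\<Sum>\<omega>\<in>Pow E. of_bool (Q \<omega>) *
        (split_weight w \<epsilon> E (\<lambda>v. \<phi> v + \<tau> \<omega> v) \<omega> + split_weight w \<epsilon> E (\<lambda>v. \<phi> v - \<tau> \<omega> v) \<omega>))
      + (\<Sum>\<omega>\<in>Pow E. split_weight w \<epsilon> E \<phi> \<omega> *
          ((\<Sum>e\<in>E. (b e \<omega> / \<epsilon>)\<^sup>2) / K + 64 * (\<Sum>e\<in>E. (b e \<omega> / \<epsilon>) ^ 3) + of_bool (\<not> Q \<omega>)))"
proof -
  let ?W = "split_weight w \<epsilon> E"
  let ?g = "\<lambda>e. cutoff \<epsilon> (edge_diff \<phi> e)"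
  let ?S = "\<lambda>\<omega> q. \<Sum>e\<in>E. of_bool (e \<notin> \<omega>) * (b e \<omega> / \<epsilon> / ?g e) ^ q"
  have Wn: "0 \<le> ?W \<phi> \<omega>" for \<phi> \<omega> by (simp add: split_weight_nonneg w_nonneg)
  have bg: "0 \<le> b e \<omega> / \<epsilon> / ?g e" for e \<omega> using b0 eps by (simp add: cutoff_nonneg)
  have Sn: "0 \<le> ?S \<omega> q" for \<omega> q using bg by (intro sum_nonneg mult_nonneg_nonneg zero_le_power) auto
  have term_le: "?W \<phi> \<omega> \<le> exp ((B + 18) * K) * (of_bool (Q \<omega>) * (?W (\<lambda>v. \<phi> v + \<tau> \<omega> v) \<omega> + ?W (\<lambda>v. \<phi> v - \<tau> \<omega> v) \<omega>))
        + ?W \<phi> \<omega> * (?S \<omega> 2 / K + 64 * ?S \<omega> 3 + of_bool (\<not> Q \<omega>))" (is "_ \<le> ?A + ?W \<phi> \<omega> * ?H")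
    if \<omega>: "\<omega> \<in> Pow E" for \<omega>
  proof (cases "?W \<phi> \<omega> = 0 \<or> 1 \<le> ?H")
    case True
    have "0 \<le> ?A" using Wn by (intro mult_nonneg_nonneg add_nonneg_nonneg) auto
    moreover have "?W \<phi> \<omega> \<le> ?W \<phi> \<omega> * ?H"
      using True Wn mult_left_mono[of 1 ?H "?W \<phi> \<omega>"] by auto
    ultimately show ?thesis by linarith
  next
    case False
    have pos: "0 < ?g e" if "e \<in> E - \<omega>" for e
    proof (rule ccontr)
      assume "\<not> 0 < ?g e"
      then have "?g e = 0" using cutoff_nonneg[of \<epsilon> "edge_diff \<phi> e"] by linarith
      then have "?W \<phi> \<omega> = 0" using that fin unfolding split_weight_def
        by (intro mult_zero_right[THEN trans[rotated]] arg_cong2[where f="(*)"] refl prod_zero) auto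
      then show False using False by simp
    qed
    have H: "?H < 1" using False by simp
    have S2: "0 \<le> ?S \<omega> 2 / K" using Sn[of \<omega> 2] K by simp
    have Q: "Q \<omega>"
    proof (rule ccontr)
      assume "\<not> Q \<omega>" then show False using H S2 Sn[of \<omega> 3] by simp
    qed
    have "?S \<omega> 2 / K < 1" using H Q Sn[of \<omega> 3] by simp
    then have S2K: "?S \<omega> 2 \<le> K" using K by (simp add: divide_less_eq)
    \<comment> \<open>A single ratio above 1/4 would push \<open>64 * ?S \<omega> 3\<close> to at
      least 1, since 64 is the reciprocal of \<open>(1/4) ^ 3\<close>.\<close>
    have small: "b e \<omega> / \<epsilon> / ?g e \<le> 1/4" if e: "e \<in> E - \<omega>" for e
    proof (rule ccontr)
      assume "\<not> ?thesis"
      then have "(1/4) ^ 3 \<le> (b e \<omega> / \<epsilon> / ?g e) ^ 3" by (intro power_mono) auto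
      also have "\<dots> = of_bool (e \<notin> \<omega>) * (b e \<omega> / \<epsilon> / ?g e) ^ 3" using e by simp
      also have "\<dots> \<le> ?S \<omega> 3"
        using e fin bg by (intro member_le_sum mult_nonneg_nonneg zero_le_power) auto
      finally have "(1/4) ^ 3 \<le> ?S \<omega> 3" .
      moreover have "(1/4) ^ 3 = (1/64 :: real)" by (simp add: power3_eq_cube)
      moreover have "of_bool (\<not> Q \<omega>) = (0 :: real)" using Q by simp
      ultimately show False using H S2 by linarith
    qed
    have "?W \<phi> \<omega> \<le> exp ((B + 18) * K) * (?W (\<lambda>v. \<phi> v + \<tau> \<omega> v) \<omega> + ?W (\<lambda>v. \<phi> v - \<tau> \<omega> v) \<omega>)"
    proof (rule split_weight_shift)
      show "finite E" "\<omega> \<subseteq> E" using fin \<omega> by auto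
      show "edge_diff (\<tau> \<omega>) e = 0" if "e \<in> \<omega>" for e using zero that \<omega> by auto
      show "0 < ?g e" if "e \<in> E - \<omega>" for e using pos that .
      show "\<bar>edge_diff (\<tau> \<omega>) e\<bar> \<le> \<epsilon> * ?g e / 4" if e: "e \<in> E - \<omega>" for e
      proof -
        have "b e \<omega> \<le> \<epsilon> * ?g e / 4" using small[OF e] pos[OF e] eps by (simp add: field_simps)
        then show ?thesis using b[of \<omega> e] e \<omega> by auto
      qed
      have "(\<Sum>e\<in>E-\<omega>. (edge_diff (\<tau> \<omega>) e / (\<epsilon> * ?g e))\<^sup>2) \<le> (\<Sum>e\<in>E-\<omega>. (b e \<omega> / \<epsilon> / ?g e)\<^sup>2)"
      proof (rule sum_mono)
        fix e assume e: "e \<in> E - \<omega>"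
        have "\<bar>edge_diff (\<tau> \<omega>) e / (\<epsilon> * ?g e)\<bar> \<le> b e \<omega> / \<epsilon> / ?g e"
          using b[of \<omega> e] e \<omega> pos[OF e] eps by (simp add: abs_mult divide_right_mono)
        then show "(edge_diff (\<tau> \<omega>) e / (\<epsilon> * ?g e))\<^sup>2 \<le> (b e \<omega> / \<epsilon> / ?g e)\<^sup>2"
          by (metis abs_ge_zero power2_abs power_mono)
      qed
      also have "\<dots> = ?S \<omega> 2"
        using fin by (intro sum.mono_neutral_cong_left) auto
      finally show "(\<Sum>e\<in>E-\<omega>. (edge_diff (\<tau> \<omega>) e / (\<epsilon> * ?g e))\<^sup>2) \<le> K" using S2K by simp
    qed
    moreover have "0 \<le> ?W \<phi> \<omega> * ?H" using Wn S2 Sn[of \<omega> 3] by (intro mult_nonneg_nonneg add_nonneg_nonneg) auto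
    ultimately show ?thesis using Q by simp
  qed
  \<comment> \<open>Edge by edge, the singular denominator is traded for dropping the condition that
    the edge is good.\<close>
  have resample: "(\<Sum>\<omega>\<in>Pow E. ?W \<phi> \<omega> * ?S \<omega> q) \<le> (\<Sum>\<omega>\<in>Pow E. ?W \<phi> \<omega> * (\<Sum>e\<in>E. (b e \<omega> / \<epsilon>) ^ q))"
    if "q \<le> 3" for q
  proof -
    have "(\<Sum>\<omega>\<in>Pow E. ?W \<phi> \<omega> * ?S \<omega> q) = (\<Sum>e\<in>E. \<Sum>\<omega>\<in>Pow E. ?W \<phi> \<omega> * (of_bool (e \<notin> \<omega>) * (b e \<omega> / \<epsilon> / ?g e) ^ q))"
      unfolding sum_distrib_left by (rule sum.swap)
    also have "\<dots> \<le> (\<Sum>e\<in>E. \<Sum>\<omega>\<in>Pow E. ?W \<phi> \<omega> * (b e \<omega> / \<epsilon>) ^ q)"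
      using that fin b0 eps mono w_nonneg
      by (intro sum_mono sum_split_weight_resample) (auto intro!: divide_right_mono)
    also have "\<dots> = (\<Sum>\<omega>\<in>Pow E. ?W \<phi> \<omega> * (\<Sum>e\<in>E. (b e \<omega> / \<epsilon>) ^ q))"
      unfolding sum_distrib_left by (rule sum.swap)
    finally show ?thesis .
  qed
  have lin: "(\<Sum>\<omega>\<in>Pow E. ?W \<phi> \<omega> * (f \<omega> / K + 64 * g \<omega> + h \<omega>)) =
     (\<Sum>\<omega>\<in>Pow E. ?W \<phi> \<omega> * f \<omega>) / K + 64 * (\<Sum>\<omega>\<in>Pow E. ?W \<phi> \<omega> * g \<omega>) + (\<Sum>\<omega>\<in>Pow E. ?W \<phi> \<omega> * h \<omega>)" for f g h
    by (simp add: algebra_simps sum.distrib sum_distrib_left sum_divide_distrib)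
  have "(\<Prod>e\<in>E. w (edge_diff \<phi> e)) = (\<Sum>\<omega>\<in>Pow E. ?W \<phi> \<omega>)" using fin by (simp add: sum_split_weight)
  also have "\<dots> \<le> (\<Sum>\<omega>\<in>Pow E. exp ((B + 18) * K) * (of_bool (Q \<omega>) * (?W (\<lambda>v. \<phi> v + \<tau> \<omega> v) \<omega> + ?W (\<lambda>v. \<phi> v - \<tau> \<omega> v) \<omega>))
        + ?W \<phi> \<omega> * (?S \<omega> 2 / K + 64 * ?S \<omega> 3 + of_bool (\<not> Q \<omega>)))"
    by (rule sum_mono[OF term_le])
  also have "\<dots> = exp ((B + 18) * K) * (\<Sum>\<omega>\<in>Pow E. of_bool (Q \<omega>) * (?W (\<lambda>v. \<phi> v + \<tau> \<omega> v) \<omega> + ?W (\<lambda>v. \<phi> v - \<tau> \<omega> v) \<omega>))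
       + ((\<Sum>\<omega>\<in>Pow E. ?W \<phi> \<omega> * ?S \<omega> 2) / K + 64 * (\<Sum>\<omega>\<in>Pow E. ?W \<phi> \<omega> * ?S \<omega> 3) + (\<Sum>\<omega>\<in>Pow E. ?W \<phi> \<omega> * of_bool (\<not> Q \<omega>)))"
    unfolding sum.distrib lin by (simp only: sum_distrib_left)
  also have "\<dots> \<le> exp ((B + 18) * K) * (\<Sum>\<omega>\<in>Pow E. of_bool (Q \<omega>) * (?W (\<lambda>v. \<phi> v + \<tau> \<omega> v) \<omega> + ?W (\<lambda>v. \<phi> v - \<tau> \<omega> v) \<omega>))
       + ((\<Sum>\<omega>\<in>Pow E. ?W \<phi> \<omega> * (\<Sum>e\<in>E. (b e \<omega> / \<epsilon>)\<^sup>2)) / K + 64 * (\<Sum>\<omega>\<in>Pow E. ?W \<phi> \<omega> * (\<Sum>e\<in>E. (b e \<omega> / \<epsilon>) ^ 3))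
         + (\<Sum>\<omega>\<in>Pow E. ?W \<phi> \<omega> * of_bool (\<not> Q \<omega>)))"
    using resample[of 2] resample[of 3] K
    by (intro add_left_mono add_mono divide_right_mono mult_left_mono order_refl) auto
  also have "\<dots> = exp ((B + 18) * K) * (\<Sum>\<omega>\<in>Pow E. of_bool (Q \<omega>) * (?W (\<lambda>v. \<phi> v + \<tau> \<omega> v) \<omega> + ?W (\<lambda>v. \<phi> v - \<tau> \<omega> v) \<omega>))
       + (\<Sum>\<omega>\<in>Pow E. ?W \<phi> \<omega> *
          ((\<Sum>e\<in>E. (b e \<omega> / \<epsilon>)\<^sup>2) / K + 64 * (\<Sum>e\<in>E. (b e \<omega> / \<epsilon>) ^ 3) + of_bool (\<not> Q \<omega>)))"
    unfolding lin ..
  finally show ?thesis .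
qed

end

section \<open>The pinned product measure: translations and integration along a tree\<close>

section \<open>The reference measure\<close>

definition site_measure :: "'v \<Rightarrow> 'v \<Rightarrow> real measure" where
  "site_measure z v = (if v = z then return lborel 0 else lborel)"

lemma sets_site_measure [measurable_cong, simp]: "sets (site_measure z v) = sets borel"
  by (simp add: site_measure_def)

lemma space_site_measure [simp]: "space (site_measure z v) = UNIV"
  by (simp add: site_measure_def)

lemma measurable_site:
  assumes "u \<in> S" shows "(\<lambda>\<phi>. \<phi> u) \<in> borel_measurable (PiM S (site_measure z))"
  using measurable_component_singleton[OF assms, of "site_measure z"]
    measurable_cong_sets[OF refl sets_site_measure, of "PiM S (site_measure z)" z u]
  by simp

lemma product_sigma_finite_site_measure: "product_sigma_finite (site_measure z)"
  unfolding product_sigma_finite_def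
proof
  fix v show "sigma_finite_measure (site_measure z v)"
    by (auto simp: site_measure_def lborel.sigma_finite_measure_axioms
        intro!: prob_space_imp_sigma_finite prob_space_return)
qed

lemma ref_measure_eq: "ref_measure n = PiM (torus_V n) (site_measure (0, 0))"
  by (simp add: ref_measure_def site_measure_def[abs_def])

lemma emeasure_site_measure_shift:
  assumes "A \<in> sets borel" "t z = 0"
  shows "emeasure (site_measure z v) ((\<lambda>x. x + t v) -` A) = emeasure (site_measure z v) A"
proof (cases "v = z")
  case False
  have "emeasure lborel A = emeasure (distr lborel borel ((+) (t v))) A" by (simp add: lborel_distr_plus)
  also have "\<dots> = emeasure lborel ((\<lambda>x. x + t v) -` A)"
    using assms by (simp add: emeasure_distr) (intro arg_cong2[where f=emeasure] arg_cong2[where f=vimage] refl ext add.commute)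
  finally show ?thesis using False by (simp add: site_measure_def)
qed (use assms in simp)

text \<open>Both sides agree on boxes: Lebesgue measure is translation invariant, and at the pinned
  site the shift is 0.\<close>

lemma distr_PiM_site_measure_shift:
  assumes "finite V" "t z = 0"
  shows "distr (PiM V (site_measure z)) (PiM V (site_measure z)) (\<lambda>\<phi>. \<lambda>v\<in>V. \<phi> v + t v) = PiM V (site_measure z)"
    (is "distr ?P ?P ?f = ?P")
proof (rule product_sigma_finite.PiM_eqI[OF product_sigma_finite_site_measure assms(1)])
  interpret product_sigma_finite "site_measure z" by (rule product_sigma_finite_site_measure)
  fix A assume A: "\<And>v. v \<in> V \<Longrightarrow> A v \<in> sets (site_measure z v)"
  have f: "?f \<in> measurable ?P ?P" by measurable
  have A': "Pi\<^sub>E V A \<in> sets ?P" using assms(1) A by (intro sets_PiM_I_finite) auto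
  have B: "(\<lambda>x. x + t v) -` A v \<in> sets (site_measure z v)" if "v \<in> V" for v
  proof -
    have "(\<lambda>x. x + t v) -` A v \<inter> space borel \<in> sets borel"
      using A[OF that] by (intro measurable_sets[of _ _ borel]) auto
    then show ?thesis by simp
  qed
  have "?f -` Pi\<^sub>E V A \<inter> space ?P = Pi\<^sub>E V (\<lambda>v. (\<lambda>x. x + t v) -` A v)"
    by (auto simp: space_PiM PiE_iff)
  then have "emeasure (distr ?P ?P ?f) (Pi\<^sub>E V A) = emeasure ?P (Pi\<^sub>E V (\<lambda>v. (\<lambda>x. x + t v) -` A v))"
    by (simp add: emeasure_distr[OF f A'])
  also have "\<dots> = (\<Prod>v\<in>V. emeasure (site_measure z v) ((\<lambda>x. x + t v) -` A v))"
    using assms(1) B by (intro emeasure_PiM) auto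
  also have "\<dots> = (\<Prod>v\<in>V. emeasure (site_measure z v) (A v))"
    using A assms(2) by (intro prod.cong refl emeasure_site_measure_shift) auto
  finally show "emeasure (distr ?P ?P ?f) (Pi\<^sub>E V A) = (\<Prod>v\<in>V. emeasure (site_measure z v) (A v))" .
qed simp

text \<open>A shifted configuration may leave the product space, whose points have a fixed value
  outside V. The hypothesis \<open>loc\<close> makes F insensitive to the restriction that repairs
  this.\<close>

lemma nn_integral_PiM_site_measure_shift:
  assumes "finite V" "t z = 0" and F: "F \<in> borel_measurable (PiM V (site_measure z))"
    and loc: "\<And>\<phi> \<psi>. (\<And>v. v \<in> V \<Longrightarrow> \<phi> v = \<psi> v) \<Longrightarrow> F \<phi> = F \<psi>"
  shows "(\<integral>\<^sup>+\<phi>. F (\<lambda>v. \<phi> v + t v) \<partial>PiM V (site_measure z)) = (\<integral>\<^sup>+\<phi>. F \<phi> \<partial>PiM V (site_measure z))"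
proof -
  let ?P = "PiM V (site_measure z)"
  have "(\<integral>\<^sup>+\<phi>. F \<phi> \<partial>?P) = (\<integral>\<^sup>+\<phi>. F \<phi> \<partial>distr ?P ?P (\<lambda>\<phi>. \<lambda>v\<in>V. \<phi> v + t v))"
    by (simp add: distr_PiM_site_measure_shift[of V t z] assms(1,2))
  also have "\<dots> = (\<integral>\<^sup>+\<phi>. F (\<lambda>v\<in>V. \<phi> v + t v) \<partial>?P)"
  proof (rule nn_integral_distr)
    show "(\<lambda>\<phi>. \<lambda>v\<in>V. \<phi> v + t v) \<in> measurable ?P ?P" by measurable
  qed (use F in simp)
  also have "\<dots> = (\<integral>\<^sup>+\<phi>. F (\<lambda>v. \<phi> v + t v) \<partial>?P)"
    by (intro nn_integral_cong loc) simp
  finally show ?thesis by simp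
qed

lemma nn_integral_lborel_shift:
  fixes f :: "real \<Rightarrow> ennreal"
  assumes [measurable]: "f \<in> borel_measurable borel"
  shows "(\<integral>\<^sup>+y. f (y - a) \<partial>lborel) = (\<integral>\<^sup>+y. f y \<partial>lborel)"
  using nn_integral_real_affine[of "\<lambda>y. f (y - a)" 1 a] by simp

text \<open>The map \<open>par\<close> describes a tree rooted at z. A vertex of maximal depth is
  nobody's parent, so its coordinate occurs in one factor only; integrating it out first gives one
  copy of the integral of f, and induction treats the smaller tree.\<close>

lemma nn_integral_tree_le:
  assumes "finite S" "z \<in> S"
    and par: "\<And>v. v \<in> S \<Longrightarrow> v \<noteq> z \<Longrightarrow> par v \<in> S \<and> depth (par v) < (depth v :: nat)"
    and f [measurable]: "f \<in> borel_measurable borel"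
  shows "(\<integral>\<^sup>+\<phi>. (\<Prod>v\<in>S-{z}. f (\<phi> v - \<phi> (par v))) \<partial>PiM S (site_measure z))
      \<le> (\<integral>\<^sup>+x. f x \<partial>lborel) ^ card (S - {z})"
  using assms(1-3)
proof (induction "card (S - {z})" arbitrary: S)
  case 0
  then have "S - {z} = {}" by (metis card_0_eq finite_Diff)
  then have "S = {z}" using 0 by auto
  then interpret prob_space "PiM S (site_measure z)"
    by (intro prob_space_PiM) (auto simp: site_measure_def intro!: prob_space_return)
  show ?case unfolding \<open>S - {z} = {}\<close> by (simp add: emeasure_space_1)
next
  case (Suc k)
  interpret product_sigma_finite "site_measure z" by (rule product_sigma_finite_site_measure)
  have fin: "finite (S - {z})" using Suc.prems by simp
  have ne: "S - {z} \<noteq> {}" using Suc.hyps(2) by (metis card.empty nat.simps(3))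
  define d where "d = Max (depth ` (S - {z}))"
  have "d \<in> depth ` (S - {z})" unfolding d_def using fin ne by (intro Max_in) auto
  then obtain v where v: "v \<in> S" "v \<noteq> z" and dv: "depth v = d" by auto
  have dmax: "depth u \<le> depth v" if "u \<in> S" "u \<noteq> z" for u
    unfolding dv d_def using that fin by (intro Max_ge) auto
  define T where "T = S - {v}"
  have S: "S = insert v T" "v \<notin> T" "finite T" "z \<in> T" using v Suc.prems by (auto simp: T_def)
  \<comment> \<open>A child of v would be strictly deeper than v.\<close>
  have par_ne: "par u \<noteq> v" if "u \<in> S" "u \<noteq> z" for u
    using Suc.prems(3)[OF that] dmax[OF that] by auto
  have parT: "par u \<in> T \<and> depth (par u) < depth u" if "u \<in> T" "u \<noteq> z" for u
    using that Suc.prems(3)[of u] par_ne[of u] by (auto simp: T_def)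
  have parv: "par v \<in> T" using Suc.prems(3)[OF v] par_ne[OF v] by (auto simp: T_def)
  have cT: "k = card (T - {z})"
  proof -
    have "S - {z} = insert v (T - {z})" using S v by auto
    then show ?thesis using Suc.hyps(2) S by simp
  qed
  have m: "(\<lambda>\<phi>. \<Prod>v\<in>S-{z}. f (\<phi> v - \<phi> (par v))) \<in> borel_measurable (PiM S (site_measure z))"
    using Suc.prems(3) by (intro borel_measurable_prod_ennreal measurable_compose[OF _ f] borel_measurable_diff measurable_site) auto
  have mT: "(\<lambda>\<phi>. \<Prod>v\<in>T-{z}. f (\<phi> v - \<phi> (par v))) \<in> borel_measurable (PiM T (site_measure z))"
    using parT by (intro borel_measurable_prod_ennreal measurable_compose[OF _ f] borel_measurable_diff measurable_site) auto
  have "(\<integral>\<^sup>+\<phi>. (\<Prod>v\<in>S-{z}. f (\<phi> v - \<phi> (par v))) \<partial>PiM S (site_measure z))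
     = (\<integral>\<^sup>+\<phi>. (\<integral>\<^sup>+y. (\<Prod>u\<in>S-{z}. f ((\<phi>(v := y)) u - (\<phi>(v := y)) (par u))) \<partial>site_measure z v) \<partial>PiM T (site_measure z))"
    by (rule product_nn_integral_insert[OF S(3,2), folded S(1), OF m])
  also have "\<dots> = (\<integral>\<^sup>+\<phi>. (\<integral>\<^sup>+y. (\<Prod>u\<in>T-{z}. f (\<phi> u - \<phi> (par u))) * f (y - \<phi> (par v)) \<partial>lborel) \<partial>PiM T (site_measure z))"
  proof (intro nn_integral_cong)
    fix \<phi> :: "'a \<Rightarrow> real"
    have "(\<Prod>u\<in>S-{z}. f ((\<phi>(v := y)) u - (\<phi>(v := y)) (par u))) = (\<Prod>u\<in>T-{z}. f (\<phi> u - \<phi> (par u))) * f (y - \<phi> (par v))" for y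
    proof -
      have "S - {z} = insert v (T - {z})" using S v by auto
      then have "(\<Prod>u\<in>S-{z}. f ((\<phi>(v := y)) u - (\<phi>(v := y)) (par u)))
         = f ((\<phi>(v := y)) v - (\<phi>(v := y)) (par v)) * (\<Prod>u\<in>T-{z}. f ((\<phi>(v := y)) u - (\<phi>(v := y)) (par u)))"
        using S by simp
      also have "(\<Prod>u\<in>T-{z}. f ((\<phi>(v := y)) u - (\<phi>(v := y)) (par u))) = (\<Prod>u\<in>T-{z}. f (\<phi> u - \<phi> (par u)))"
        using S par_ne by (intro prod.cong) auto
      finally show ?thesis using par_ne[OF v] by (simp add: mult.commute)
    qed
    then show "(\<integral>\<^sup>+y. (\<Prod>u\<in>S-{z}. f ((\<phi>(v := y)) u - (\<phi>(v := y)) (par u))) \<partial>site_measure z v) =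
      (\<integral>\<^sup>+y. (\<Prod>u\<in>T-{z}. f (\<phi> u - \<phi> (par u))) * f (y - \<phi> (par v)) \<partial>lborel)"
      using v by (simp add: site_measure_def)
  qed
  also have "\<dots> = (\<integral>\<^sup>+\<phi>. (\<Prod>u\<in>T-{z}. f (\<phi> u - \<phi> (par u))) * (\<integral>\<^sup>+y. f y \<partial>lborel) \<partial>PiM T (site_measure z))"
    by (simp add: nn_integral_cmult nn_integral_lborel_shift)
  also have "\<dots> = (\<integral>\<^sup>+\<phi>. (\<Prod>u\<in>T-{z}. f (\<phi> u - \<phi> (par u))) \<partial>PiM T (site_measure z)) * (\<integral>\<^sup>+y. f y \<partial>lborel)"
    using mT by (rule nn_integral_multc)
  also have "\<dots> \<le> (\<integral>\<^sup>+x. f x \<partial>lborel) ^ k * (\<integral>\<^sup>+y. f y \<partial>lborel)"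
    using Suc.hyps(1)[OF cT S(3) S(4) parT] cT by (intro mult_right_mono) auto
  finally show ?case unfolding Suc.hyps(2)[symmetric] by (simp add: mult.commute)
qed

section \<open>Geometry of the torus: degrees, distance shells and harmonic sums\<close>

section \<open>The torus\<close>

lemma finite_torus_V: "finite (torus_V n)"
  by (simp add: torus_V_def)

lemma finite_torus_E: "finite (torus_E n)"
  by (simp add: torus_E_def finite_torus_V)

lemma cyc_succ_mem: "1 \<le> n \<Longrightarrow> a \<in> {-int n + 1..int n} \<Longrightarrow> cyc_succ n a \<in> {-int n + 1..int n}"
  by (auto simp: cyc_succ_def)

lemma inj_on_cyc_succ: "inj_on (cyc_succ n) {-int n + 1..int n}"
  by (auto simp: inj_on_def cyc_succ_def split: if_splits)

lemma torus_E_cases: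
  assumes "(u, v) \<in> torus_E n"
  obtains a b where "u = (a, b)" "(a, b) \<in> torus_V n" "v = (cyc_succ n a, b)"
  | a b where "u = (a, b)" "(a, b) \<in> torus_V n" "v = (a, cyc_succ n b)"
  using assms by (auto simp: torus_E_def)

lemma torus_E_vertices:
  assumes "1 \<le> n" "e \<in> torus_E n" shows "fst e \<in> torus_V n" "snd e \<in> torus_V n"
  using assms cyc_succ_mem[OF assms(1)] by (auto simp: torus_E_def torus_V_def)

text \<open>On a cycle of length two the successor edges of the two points join the same pair in
  opposite directions; \<open>2 \<le> n\<close> excludes this.\<close>

lemma torus_E_antisym:
  assumes "2 \<le> n" "(u, v) \<in> torus_E n" shows "(v, u) \<notin> torus_E n"
proof
  assume "(v, u) \<in> torus_E n"
  with assms show False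
    by (auto simp: cyc_succ_def torus_V_def elim!: torus_E_cases split: if_splits)
qed

lemma torus_E_degree: "card {v. linked (torus_E n) u v} \<le> 4"
proof -
  obtain a b where u: "u = (a, b)" by force
  define pr where "pr x = (if x = - int n + 1 then int n else x - 1)" for x
  have pr: "pr (cyc_succ n x) = x" if "x \<in> {-int n + 1..int n}" for x
    using that by (auto simp: pr_def cyc_succ_def)
  let ?N = "{(cyc_succ n a, b), (a, cyc_succ n b), (pr a, b), (a, pr b)}"
  have "{v. linked (torus_E n) u v} \<subseteq> ?N"
    using pr by (auto simp: linked_def u torus_V_def elim!: torus_E_cases)
  then have "card {v. linked (torus_E n) u v} \<le> card ?N" by (intro card_mono) auto
  also have "\<dots> \<le> 4" by (simp add: card_insert_if)
  finally show ?thesis .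
qed

text \<open>A vertex starts at most two edges and, by injectivity of the cyclic successor, ends at
  most two.\<close>

lemma sum_torus_E_le:
  fixes f :: "int \<times> int \<Rightarrow> real"
  assumes n: "1 \<le> n" and f: "\<And>v. 0 \<le> f v"
  shows "(\<Sum>e\<in>torus_E n. f (fst e) + f (snd e)) \<le> 4 * (\<Sum>v\<in>torus_V n. f v)"
proof -
  let ?V = "torus_V n"
  let ?s1 = "\<lambda>(a, b). (cyc_succ n a, b)" and ?s2 = "\<lambda>(a, b). (a, cyc_succ n b)"
  let ?e1 = "\<lambda>(a, b). ((a, b), (cyc_succ n a, b))" and ?e2 = "\<lambda>(a, b). ((a, b), (a, cyc_succ n b))"
  let ?h = "\<lambda>e. f (fst e) + f (snd e)"
  have shift: "(\<Sum>v\<in>?V. f (s v)) \<le> (\<Sum>v\<in>?V. f v)" if "inj_on s ?V" "s ` ?V \<subseteq> ?V" for s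
  proof -
    have "(\<Sum>v\<in>?V. f (s v)) = (\<Sum>v\<in>s ` ?V. f v)" using that(1) by (simp add: sum.reindex)
    also have "\<dots> \<le> (\<Sum>v\<in>?V. f v)" using that(2) f finite_torus_V by (intro sum_mono2) auto
    finally show ?thesis .
  qed
  have s1: "(\<Sum>v\<in>?V. f (?s1 v)) \<le> (\<Sum>v\<in>?V. f v)"
  proof (rule shift)
    show "inj_on ?s1 ?V"
      by (auto intro!: inj_onI dest!: inj_onD[OF inj_on_cyc_succ] simp: torus_V_def)
    show "?s1 ` ?V \<subseteq> ?V" using n by (auto simp: torus_V_def cyc_succ_def)
  qed
  have s2: "(\<Sum>v\<in>?V. f (?s2 v)) \<le> (\<Sum>v\<in>?V. f v)"
  proof (rule shift)
    show "inj_on ?s2 ?V"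
      by (auto intro!: inj_onI dest!: inj_onD[OF inj_on_cyc_succ] simp: torus_V_def)
    show "?s2 ` ?V \<subseteq> ?V" using n by (auto simp: torus_V_def cyc_succ_def)
  qed
  have "(\<Sum>e\<in>torus_E n. ?h e) \<le> (\<Sum>e\<in>?e1 ` ?V. ?h e) + (\<Sum>e\<in>?e2 ` ?V. ?h e)"
    using sum.union_inter[of "?e1 ` ?V" "?e2 ` ?V" ?h] sum_nonneg[of "?e1 ` ?V \<inter> ?e2 ` ?V" ?h] f finite_torus_V
    unfolding torus_E_def by (simp add: add_nonneg_nonneg)
  also have "(\<Sum>e\<in>?e1 ` ?V. ?h e) = (\<Sum>v\<in>?V. f v) + (\<Sum>v\<in>?V. f (?s1 v))"
    by (subst sum.reindex) (auto simp: inj_on_def sum.distrib[symmetric] intro!: sum.cong)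
  also have "(\<Sum>e\<in>?e2 ` ?V. ?h e) = (\<Sum>v\<in>?V. f v) + (\<Sum>v\<in>?V. f (?s2 v))"
    by (subst sum.reindex) (auto simp: inj_on_def sum.distrib[symmetric] intro!: sum.cong)
  finally show ?thesis using s1 s2 by simp
qed

text \<open>The sup-norm distance to the point (c, 0), clipped to the range from 1 to r: the lower
  clip keeps logarithms and reciprocals harmless, the upper one lets a peak vanish outside a box.
  Coordinates are not reduced modulo 2n; the upper clip takes care of the seam.\<close>

definition peak_dist :: "nat \<Rightarrow> int \<Rightarrow> int \<times> int \<Rightarrow> nat" where
  "peak_dist r c v = max 1 (min r (nat (max \<bar>fst v - c\<bar> \<bar>snd v\<bar>)))"

lemma peak_dist_ge_1: "1 \<le> peak_dist r c v"
  by (simp add: peak_dist_def)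

lemma peak_dist_le: "1 \<le> r \<Longrightarrow> peak_dist r c v \<le> r"
  by (simp add: peak_dist_def)

lemma peak_dist_center: "peak_dist r c (c, 0) = 1"
  by (simp add: peak_dist_def)

lemma peak_dist_far: "1 \<le> r \<Longrightarrow> int r \<le> \<bar>x - c\<bar> \<Longrightarrow> peak_dist r c (x, 0) = r"
  by (auto simp: peak_dist_def)

text \<open>Coordinates jump across the seam, but by the position of c both endpoints of such an
  edge are at distance at least r, so the clip assigns r to both. On all other edges the distance
  changes by at most 1.\<close>

lemma peak_dist_lipschitz:
  assumes "int r \<le> c" "c + int r \<le> int n" "1 \<le> r" "(u, v) \<in> torus_E n"
  shows "peak_dist r c u \<le> peak_dist r c v + 1 \<and> peak_dist r c v \<le> peak_dist r c u + 1"
proof -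
  define d where "d v = max \<bar>fst v - c\<bar> \<bar>snd v\<bar>" for v :: "int \<times> int"
  have max_diff: "\<bar>max x z - max y z\<bar> \<le> 1" if "\<bar>x - y\<bar> \<le> 1" for x y z :: int
    using that by linarith
  have "\<bar>d u - d v\<bar> \<le> 1 \<or> (int r \<le> d u \<and> int r \<le> d v)"
    using assms(4)
  proof (cases rule: torus_E_cases)
    case (1 a b)
    show ?thesis
    proof (cases "a = int n")
      case True
      then have "int r \<le> \<bar>fst u - c\<bar>" "int r \<le> \<bar>fst v - c\<bar>" using 1 assms(1-3) by (auto simp: cyc_succ_def)
      then show ?thesis by (simp add: d_def le_max_iff_disj)
    next
      case False
      then have "\<bar>\<bar>fst u - c\<bar> - \<bar>fst v - c\<bar>\<bar> \<le> 1" "snd u = snd v" using 1 by (auto simp: cyc_succ_def)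
      then show ?thesis using max_diff unfolding d_def by simp
    qed
  next
    case (2 a b)
    show ?thesis
    proof (cases "b = int n")
      case True
      then have "int r \<le> \<bar>snd u\<bar>" "int r \<le> \<bar>snd v\<bar>" using 2 assms(1-3) by (auto simp: cyc_succ_def)
      then show ?thesis by (simp add: d_def le_max_iff_disj)
    next
      case False
      then have "\<bar>\<bar>snd u\<bar> - \<bar>snd v\<bar>\<bar> \<le> 1" "fst u = fst v" using 2 by (auto simp: cyc_succ_def)
      then show ?thesis using max_diff unfolding d_def by (simp add: max.commute)
    qed
  qed
  then have "nat (d u) \<le> nat (d v) + 1 \<and> nat (d v) \<le> nat (d u) + 1 \<or> r \<le> nat (d u) \<and> r \<le> nat (d v)"
    by linarith
  moreover have "peak_dist r c v = max 1 (min r (nat (d v)))" for v by (simp add: peak_dist_def d_def)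
  ultimately show ?thesis by (simp add: min_def max_def) linarith
qed

text \<open>A sphere of radius k is covered by four segments of \<open>2 * k + 1\<close> points, and
  \<open>4 * (2 * k + 1) \<le> 12 * k\<close>. For k = 1 the lower clip adds the centre, and the set
  fits into a 3 by 3 square.\<close>

lemma card_peak_dist_le:
  assumes "1 \<le> k" "k < r"
  shows "card {v \<in> torus_V n. peak_dist r c v = k} \<le> 12 * k"
proof (cases "k = 1")
  case True
  have "\<bar>fst v - c\<bar> \<le> 1 \<and> \<bar>snd v\<bar> \<le> 1" if "peak_dist r c v = k" for v
  proof -
    have "nat (max \<bar>fst v - c\<bar> \<bar>snd v\<bar>) \<le> 1" using that True assms unfolding peak_dist_def by linarith
    then show ?thesis by linarith
  qed
  then have "{v \<in> torus_V n. peak_dist r c v = k} \<subseteq> {c - 1..c + 1} \<times> {-1..1}"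
    by (fastforce simp: mem_Times_iff abs_le_iff)
  then have "card {v \<in> torus_V n. peak_dist r c v = k} \<le> card ({c - 1..c + 1} \<times> {-1..1::int})"
    by (intro card_mono) auto
  then show ?thesis using True by simp
next
  case False
  let ?k = "int k"
  let ?A = "{c - ?k, c + ?k} \<times> {-?k..?k}" and ?B = "{c - ?k..c + ?k} \<times> {-?k, ?k}"
  have "v \<in> ?A \<union> ?B" if "peak_dist r c v = k" for v
  proof -
    have "nat (max \<bar>fst v - c\<bar> \<bar>snd v\<bar>) = k" using that False assms unfolding peak_dist_def by linarith
    then have "\<bar>fst v - c\<bar> = ?k \<and> \<bar>snd v\<bar> \<le> ?k \<or> \<bar>fst v - c\<bar> \<le> ?k \<and> \<bar>snd v\<bar> = ?k" by linarith
    then show ?thesis by (cases v) (auto simp: abs_if split: if_splits)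
  qed
  then have "{v \<in> torus_V n. peak_dist r c v = k} \<subseteq> ?A \<union> ?B" by blast
  then have "card {v \<in> torus_V n. peak_dist r c v = k} \<le> card (?A \<union> ?B)" by (intro card_mono) auto
  also have "\<dots> \<le> card ?A + card ?B" by (rule card_Un_le)
  also have "\<dots> = (2 * k + 1) * 4"
    using assms by (simp add: card_cartesian_product card_insert_if nat_add_distrib)
  finally show ?thesis using assms by simp
qed

text \<open>Grouping by shells; the factor k is the size of a shell in two dimensions.\<close>

lemma sum_peak_dist_le:
  fixes f :: "nat \<Rightarrow> real"
  assumes "\<And>k. 0 \<le> f k"
  shows "(\<Sum>v\<in>torus_V n. of_bool (peak_dist r c v < r) * f (peak_dist r c v)) \<le> 12 * (\<Sum>k=1..<r. real k * f k)"
proof -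
  let ?S = "{v \<in> torus_V n. peak_dist r c v < r}"
  have "(\<Sum>v\<in>torus_V n. of_bool (peak_dist r c v < r) * f (peak_dist r c v)) = (\<Sum>v\<in>?S. f (peak_dist r c v))"
    by (intro sum.mono_neutral_cong_right) (auto simp: finite_torus_V)
  also have "\<dots> = (\<Sum>k=1..<r. \<Sum>v\<in>{v \<in> ?S. peak_dist r c v = k}. f (peak_dist r c v))"
    using peak_dist_ge_1[of r c] by (intro sum.group[symmetric]) (auto simp: finite_torus_V)
  also have "\<dots> \<le> (\<Sum>k=1..<r. 12 * (real k * f k))"
  proof (rule sum_mono)
    fix k assume k: "k \<in> {1..<r}"
    have "{v \<in> ?S. peak_dist r c v = k} = {v \<in> torus_V n. peak_dist r c v = k}" using k by auto
    then have "(\<Sum>v\<in>{v \<in> ?S. peak_dist r c v = k}. f (peak_dist r c v)) = real (card {v \<in> torus_V n. peak_dist r c v = k}) * f k"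
      by simp
    also have "\<dots> \<le> real (12 * k) * f k"
      using k assms card_peak_dist_le[of k r n c] by (intro mult_right_mono) (auto simp flip: of_nat_le_iff)
    finally show "(\<Sum>v\<in>{v \<in> ?S. peak_dist r c v = k}. f (peak_dist r c v)) \<le> 12 * (real k * f k)" by simp
  qed
  finally show ?thesis by (simp add: sum_distrib_left)
qed

text \<open>The additive 1 of the usual harmonic bound is absorbed because
  \<open>exp 1 \<le> r\<close> for r >= 3.\<close>

lemma sum_inverse_le_ln:
  assumes "3 \<le> r" shows "(\<Sum>k=1..<r. 1 / real k) \<le> 2 * ln (real r)"
proof -
  have *: "(\<Sum>k=1..<Suc m. 1 / real k) \<le> 1 + ln (real m)" if "1 \<le> m" for m
    using that
  proof (induction m rule: dec_induct)
    case (step m)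
    have "ln (real m / real (Suc m)) \<le> real m / real (Suc m) - 1" using step by (intro ln_le_minus_one) auto
    then have "1 / real (Suc m) \<le> ln (real (Suc m)) - ln (real m)"
      using step by (simp add: ln_div field_simps)
    then show ?case using step by simp
  qed simp
  have e: "1 \<le> ln (real r)"
  proof -
    have "exp 1 \<le> real r" using e_less_272 assms by simp
    then show ?thesis using assms by (subst ln_ge_iff) auto
  qed
  have "(\<Sum>k=1..<r. 1 / real k) \<le> 1 + ln (real (r - 1))"
    using *[of "r - 1"] assms by simp
  also have "\<dots> \<le> 2 * ln (real r)" using e assms ln_mono[of "real (r - 1)" "real r"] by linarith
  finally show ?thesis .
qed

text \<open>Comparison with a telescoping series: \<open>1 / (m + 1)\<^sup>2\<close> is at most
  \<open>1 / m - 1 / (m + 1)\<close>.\<close>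

lemma sum_inverse_square_le: "(\<Sum>k=1..<r. 1 / (real k)\<^sup>2) \<le> 2"
proof -
  have *: "(\<Sum>k=1..<Suc m. 1 / (real k)\<^sup>2) \<le> 2 - 1 / real m" if "1 \<le> m" for m
    using that
  proof (induction m rule: dec_induct)
    case (step m)
    have "1 / (real (Suc m))\<^sup>2 \<le> 1 / (real m * real (Suc m))"
      using step by (intro divide_left_mono) (auto simp: power2_eq_square)
    also have "\<dots> = 1 / real m - 1 / real (Suc m)"
      using step by (simp add: field_simps)
    finally have "1 / (real (Suc m))\<^sup>2 \<le> 1 / real m - 1 / real (Suc m)" .
    then show ?case using step by simp
  qed simp
  show ?thesis
  proof (cases "2 \<le> r")
    case True
    then have "(\<Sum>k=1..<r. 1 / (real k)\<^sup>2) \<le> 2 - 1 / real (r - 1)" using *[of "r - 1"] by simp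
    also have "\<dots> \<le> 2" by simp
    finally show ?thesis .
  qed auto
qed

section \<open>The Gibbs measure as a probability measure, and the law of the bad edges\<close>

section \<open>The Gibbs measure\<close>

text \<open>A real-valued copy of \<open>expneg\<close>; \<open>enn2real\<close> loses nothing here,
  since \<open>expneg\<close> is never infinite.\<close>

definition edge_weight :: "(real \<Rightarrow> ereal) \<Rightarrow> real \<Rightarrow> real" where
  "edge_weight U x = enn2real (expneg U x)"

lemma expneg_eq_edge_weight: "expneg U x = ennreal (edge_weight U x)"
  by (simp add: edge_weight_def expneg_def)

lemma edge_weight_nonneg: "0 \<le> edge_weight U x"
  by (simp add: edge_weight_def)

lemma edge_weight_eq_exp: "U x \<noteq> \<infinity> \<Longrightarrow> edge_weight U x = exp (- real_of_ereal (U x))"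
  by (simp add: edge_weight_def expneg_def)

lemma borel_measurable_expneg:
  assumes [measurable]: "U \<in> borel_measurable borel"
  shows "expneg U \<in> borel_measurable borel"
proof -
  have "{x \<in> space borel. U x = \<infinity>} \<in> sets borel"
    using measurable_sets[OF assms, of "{\<infinity>}"] by (simp add: vimage_def)
  then show ?thesis unfolding expneg_def[abs_def] by (intro measurable_If) measurable
qed

lemma edge_weight_le:
  assumes "ereal M \<le> U x" shows "edge_weight U x \<le> exp (- M)"
proof (cases "U x")
  case (real u)
  then show ?thesis using assms by (simp add: edge_weight_def expneg_def)
next
  case MInf
  then show ?thesis using assms by simp
qed (simp add: edge_weight_def expneg_def)

lemma pred_abs_ge:
  fixes f :: "'a \<Rightarrow> real"
  assumes "f \<in> borel_measurable N"
  shows "Measurable.pred N (\<lambda>x. a \<le> \<bar>f x\<bar>)"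
proof -
  have "closed {y::real. a \<le> \<bar>y\<bar>}" by (intro closed_Collect_le continuous_intros)
  then have "f -` {y. a \<le> \<bar>y\<bar>} \<inter> space N \<in> sets N"
    by (intro measurable_sets[OF assms] borel_closed)
  moreover have "f -` {y. a \<le> \<bar>y\<bar>} \<inter> space N = {x \<in> space N. a \<le> \<bar>f x\<bar>}" by auto
  ultimately show ?thesis by (simp add: pred_def)
qed

lemma edge_in_torus_E:
  assumes "(a, b) \<in> torus_V n"
  shows "a < int n \<Longrightarrow> ((a, b), (a + 1, b)) \<in> torus_E n"
    and "b < int n \<Longrightarrow> ((a, b), (a, b + 1)) \<in> torus_E n"
proof -
  have "((a, b), (cyc_succ n a, b)) \<in> torus_E n" "((a, b), (a, cyc_succ n b)) \<in> torus_E n"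
    unfolding torus_E_def using imageI[OF assms, of "\<lambda>(a, b). ((a, b), (cyc_succ n a, b))"]
      imageI[OF assms, of "\<lambda>(a, b). ((a, b), (a, cyc_succ n b))"] by simp_all
  then show "a < int n \<Longrightarrow> ((a, b), (a + 1, b)) \<in> torus_E n"
    and "b < int n \<Longrightarrow> ((a, b), (a, b + 1)) \<in> torus_E n"
    by (simp_all add: cyc_succ_def)
qed

locale torus_surface = smooth_weight "edge_weight U" F F' F'' B \<epsilon>
  for U :: "real \<Rightarrow> ereal" and F F' F'' :: "real \<Rightarrow> real" and B \<epsilon> :: real +
  fixes n :: nat and M :: real
  assumes n_ge_2: "2 \<le> n"
    and U_measurable: "U \<in> borel_measurable borel"
    and U_symm: "\<And>x. U (- x) = U x"
    and U_ge: "\<And>x. ereal M \<le> U x"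
    and U_integral: "(\<integral>\<^sup>+x. expneg U x \<partial>lborel) < \<infinity>"
begin

abbreviation "V \<equiv> torus_V n"
abbreviation "E \<equiv> torus_E n"
abbreviation "W \<equiv> split_weight (edge_weight U) \<epsilon> E"
abbreviation "weight \<phi> \<equiv> (\<Prod>e\<in>E. edge_weight U (edge_diff \<phi> e))"

lemma expneg_measurable [measurable]: "expneg U \<in> borel_measurable borel"
  using U_measurable by (rule borel_measurable_expneg)

lemma edge_weight_measurable [measurable]: "edge_weight U \<in> borel_measurable borel"
  unfolding edge_weight_def[abs_def] by measurable

lemma coord_measurable: "v \<in> V \<Longrightarrow> (\<lambda>\<phi>. \<phi> v) \<in> borel_measurable (ref_measure n)"
  unfolding ref_measure_eq by (rule measurable_site)

lemma edge_diff_measurable: "e \<in> E \<Longrightarrow> (\<lambda>\<phi>. edge_diff \<phi> e) \<in> borel_measurable (ref_measure n)"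
  unfolding edge_diff_def using torus_E_vertices[of n e] n_ge_2 by (intro borel_measurable_diff coord_measurable) auto

lemma weight_measurable [measurable]: "(\<lambda>\<phi>. weight \<phi>) \<in> borel_measurable (ref_measure n)"
  by (intro borel_measurable_prod measurable_compose[OF edge_diff_measurable edge_weight_measurable])

lemma W_measurable_compose:
  assumes G: "\<And>e. e \<in> E \<Longrightarrow> (\<lambda>\<phi>. edge_diff (G \<phi>) e) \<in> borel_measurable N" and "\<omega> \<subseteq> E"
  shows "(\<lambda>\<phi>. W (G \<phi>) \<omega>) \<in> borel_measurable N"
  unfolding split_weight_def using assms(2)
  by (intro borel_measurable_times borel_measurable_prod borel_measurable_diff borel_measurable_power
      borel_measurable_const measurable_compose[OF G edge_weight_measurable]
      measurable_compose[OF G borel_measurable_cutoff]) auto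

lemma W_measurable: "\<omega> \<subseteq> E \<Longrightarrow> (\<lambda>\<phi>. W \<phi> \<omega>) \<in> borel_measurable (ref_measure n)"
  by (rule W_measurable_compose[OF edge_diff_measurable])

lemma weight_nonneg: "0 \<le> weight \<phi>"
  by (intro prod_nonneg) (simp add: edge_weight_nonneg)

lemma W_nonneg: "0 \<le> W \<phi> \<omega>"
  by (rule split_weight_nonneg[OF w_nonneg])

lemma gibbs_weight_eq: "gibbs_weight n U \<phi> = ennreal (weight \<phi>)"
  unfolding gibbs_weight_def expneg_eq_edge_weight edge_diff_def
  by (rule prod_ennreal) (simp add: edge_weight_nonneg)

lemma gibbs_weight_measurable [measurable]: "gibbs_weight n U \<in> borel_measurable (ref_measure n)"
  by (subst gibbs_weight_eq[abs_def]) measurable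

text \<open>Only the factors along a spanning tree are kept; every other factor is at most
  \<open>exp (- M)\<close>. The tree integral is then bounded by a power of the integral of
  \<open>expneg U\<close>.\<close>

lemma partition_fn_finite: "partition_fn n U < \<infinity>"
proof -
  let ?V0 = "V - {(0, 0)}"
  \<comment> \<open>Tree paths run vertically to the axis and then horizontally to the origin,
    without crossing the seam.\<close>
  define par :: "int \<times> int \<Rightarrow> int \<times> int" where
    "par = (\<lambda>(a, b). if b > 0 then (a, b - 1) else if b < 0 then (a, b + 1) else if a > 0 then (a - 1, b) else (a + 1, b))"
  \<comment> \<open>The tree edge in the orientation in which \<open>torus_E\<close> lists it.
    Symmetry of U gives both orientations the same weight.\<close>
  define te where
    "te = (\<lambda>v. if snd v > 0 \<or> (snd v = 0 \<and> fst v > 0) then (par v, v) else (v, par v))"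
  define depth :: "int \<times> int \<Rightarrow> nat" where "depth = (\<lambda>(a, b). nat (\<bar>a\<bar> + \<bar>b\<bar>))"
  have par: "par v \<in> V \<and> depth (par v) < depth v" if "v \<in> V" "v \<noteq> (0, 0)" for v
    using that n_ge_2 by (cases v) (auto simp: par_def depth_def torus_V_def)
  have inj: "inj_on te ?V0"
    by (auto simp: inj_on_def te_def par_def split: if_splits)
  have te_E: "te v \<in> E" if "v \<in> ?V0" for v
  proof -
    obtain a b where v: "v = (a, b)" by force
    have ab: "(a, b) \<in> V" "(a, b) \<noteq> (0, 0)" using that v by auto
    have "par v \<in> V" using par that by auto
    then show ?thesis using ab edge_in_torus_E[of a b n] edge_in_torus_E[of "fst (par v)" "snd (par v)" n]
      by (auto simp: te_def par_def v torus_V_def split: if_splits)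
  qed
  have expneg_symm: "expneg U (- x) = expneg U x" for x by (simp add: expneg_def U_symm)
  have te_weight: "expneg U (\<phi> (fst (te v)) - \<phi> (snd (te v))) = expneg U (\<phi> v - \<phi> (par v))" for \<phi> v
    using expneg_symm[of "\<phi> v - \<phi> (par v)"] by (auto simp: te_def)
  let ?C = "ennreal (exp (- M)) ^ card (E - te ` ?V0)"
  have le: "gibbs_weight n U \<phi> \<le> ?C * (\<Prod>v\<in>?V0. expneg U (\<phi> v - \<phi> (par v)))" for \<phi>
  proof -
    have "gibbs_weight n U \<phi> = (\<Prod>e\<in>E - te ` ?V0. expneg U (\<phi> (fst e) - \<phi> (snd e))) *
        (\<Prod>e\<in>te ` ?V0. expneg U (\<phi> (fst e) - \<phi> (snd e)))"
      unfolding gibbs_weight_def by (intro prod.subset_diff finite_torus_E image_subsetI te_E)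
    also have "(\<Prod>e\<in>te ` ?V0. expneg U (\<phi> (fst e) - \<phi> (snd e))) = (\<Prod>v\<in>?V0. expneg U (\<phi> v - \<phi> (par v)))"
      using inj by (simp add: prod.reindex te_weight)
    also have "(\<Prod>e\<in>E - te ` ?V0. expneg U (\<phi> (fst e) - \<phi> (snd e))) \<le> (\<Prod>e\<in>E - te ` ?V0. ennreal (exp (- M)))"
      by (intro prod_mono_ennreal) (auto simp: expneg_eq_edge_weight intro!: ennreal_leI edge_weight_le U_ge)
    finally show ?thesis by (simp add: mult_right_mono)
  qed
  have m: "(\<lambda>\<phi>. \<Prod>v\<in>?V0. expneg U (\<phi> v - \<phi> (par v))) \<in> borel_measurable (ref_measure n)"
    using par by (intro borel_measurable_prod_ennreal measurable_compose[OF _ expneg_measurable]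
        borel_measurable_diff coord_measurable) auto
  have "partition_fn n U \<le> (\<integral>\<^sup>+\<phi>. ?C * (\<Prod>v\<in>?V0. expneg U (\<phi> v - \<phi> (par v))) \<partial>ref_measure n)"
    unfolding partition_fn_def by (intro nn_integral_mono le)
  also have "\<dots> = ?C * (\<integral>\<^sup>+\<phi>. (\<Prod>v\<in>?V0. expneg U (\<phi> v - \<phi> (par v))) \<partial>ref_measure n)"
    using m by (rule nn_integral_cmult)
  also have "\<dots> \<le> ?C * (\<integral>\<^sup>+x. expneg U x \<partial>lborel) ^ card ?V0"
    unfolding ref_measure_eq using par finite_torus_V n_ge_2
    by (intro mult_left_mono nn_integral_tree_le[where depth=depth]) (auto simp: torus_V_def)
  also have "\<dots> < \<infinity>"
    using U_integral by (auto simp: ennreal_mult_less_top power_less_top_ennreal)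
  finally show ?thesis .
qed

text \<open>On the box with sides [-1/2, 1/2] all increments lie in [-1, 1], where the edge weight
  is an exponential. The box has reference measure 1, since each side has length 1 and contains the
  pinned value 0.\<close>

lemma partition_fn_pos: "0 < partition_fn n U"
proof (rule ccontr)
  assume "\<not> ?thesis"
  then have "(\<integral>\<^sup>+\<phi>. gibbs_weight n U \<phi> \<partial>ref_measure n) = 0" by (simp add: partition_fn_def)
  then have null: "emeasure (ref_measure n) {\<phi>\<in>space (ref_measure n). gibbs_weight n U \<phi> \<noteq> 0} = 0"
    by (subst (asm) nn_integral_0_iff) auto
  interpret product_sigma_finite "site_measure (0::int, 0::int)" by (rule product_sigma_finite_site_measure)
  let ?box = "Pi\<^sub>E V (\<lambda>_. {-1/2..1/2::real})"
  have "?box \<subseteq> {\<phi>\<in>space (ref_measure n). gibbs_weight n U \<phi> \<noteq> 0}"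
  proof safe
    fix \<phi> assume \<phi>: "\<phi> \<in> ?box"
    then show "\<phi> \<in> space (ref_measure n)" by (auto simp: ref_measure_eq space_PiM)
    assume "gibbs_weight n U \<phi> = 0"
    then have "weight \<phi> \<le> 0" by (simp add: gibbs_weight_eq ennreal_eq_0_iff)
    moreover have "0 < weight \<phi>"
    proof (intro prod_pos)
      fix e assume "e \<in> E"
      then have "fst e \<in> V" "snd e \<in> V" using torus_E_vertices n_ge_2 by auto
      then have "\<phi> (fst e) \<in> {-1/2..1/2}" "\<phi> (snd e) \<in> {-1/2..1/2}" using \<phi> by (auto simp: PiE_iff)
      then have "edge_diff \<phi> e \<in> {-1..1}" by (auto simp: edge_diff_def)
      then show "0 < edge_weight U (edge_diff \<phi> e)" by (simp add: w_eq)
    qed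
    ultimately show False by simp
  qed
  moreover have "{\<phi>\<in>space (ref_measure n). gibbs_weight n U \<phi> \<noteq> 0} \<in> sets (ref_measure n)"
    by measurable
  ultimately have "emeasure (ref_measure n) ?box \<le> emeasure (ref_measure n) {\<phi>\<in>space (ref_measure n). gibbs_weight n U \<phi> \<noteq> 0}"
    by (rule emeasure_mono)
  then have "emeasure (ref_measure n) ?box \<le> 0" unfolding null .
  moreover have "emeasure (ref_measure n) ?box = (\<Prod>v\<in>V. emeasure (site_measure (0, 0) v) {-1/2..1/2})"
    unfolding ref_measure_eq by (intro emeasure_PiM finite_torus_V) auto
  moreover have "emeasure (site_measure (0, 0) v) {-1/2..1/2} = 1" for v :: "int \<times> int"
    by (simp add: site_measure_def)
  ultimately show False by simp
qed

definition Z :: real where "Z = enn2real (partition_fn n U)"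

lemma partition_fn_eq: "partition_fn n U = ennreal Z"
  using partition_fn_finite by (simp add: Z_def)

lemma Z_pos: "0 < Z"
  using partition_fn_pos by (simp add: partition_fn_eq)

lemma sets_gibbs [simp, measurable_cong]: "sets (gibbs_measure n U) = sets (ref_measure n)"
  and space_gibbs [simp]: "space (gibbs_measure n U) = space (ref_measure n)"
  by (simp_all add: gibbs_measure_def)

lemma emeasure_gibbs:
  assumes P: "Measurable.pred (ref_measure n) P"
  shows "emeasure (gibbs_measure n U) {\<phi>\<in>space (ref_measure n). P \<phi>} =
    (\<integral>\<^sup>+\<phi>. ennreal (weight \<phi> * of_bool (P \<phi>)) \<partial>ref_measure n) / ennreal Z"
proof -
  let ?A = "{\<phi>\<in>space (ref_measure n). P \<phi>}"
  have A[measurable]: "?A \<in> sets (ref_measure n)" using P by measurable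
  have "emeasure (gibbs_measure n U) ?A = (\<integral>\<^sup>+\<phi>. (ennreal (weight \<phi>) / ennreal Z) * indicator ?A \<phi> \<partial>ref_measure n)"
    unfolding gibbs_measure_def gibbs_weight_eq partition_fn_eq
    by (intro emeasure_density) measurable
  also have "\<dots> = (\<integral>\<^sup>+\<phi>. ennreal (weight \<phi> * of_bool (P \<phi>)) / ennreal Z \<partial>ref_measure n)"
    by (intro nn_integral_cong) (auto split: split_indicator)
  also have "\<dots> = (\<integral>\<^sup>+\<phi>. ennreal (weight \<phi> * of_bool (P \<phi>)) \<partial>ref_measure n) / ennreal Z"
    using P by (intro nn_integral_divide) measurable
  finally show ?thesis .
qed

lemma nn_integral_weight: "(\<integral>\<^sup>+\<phi>. ennreal (weight \<phi>) \<partial>ref_measure n) = ennreal Z"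
  using partition_fn_eq by (simp add: partition_fn_def gibbs_weight_eq)

lemma prob_space_gibbs: "prob_space (gibbs_measure n U)"
proof
  show "emeasure (gibbs_measure n U) (space (gibbs_measure n U)) = 1"
    using emeasure_gibbs[of "\<lambda>_. True"] Z_pos by (simp add: nn_integral_weight ennreal_divide_self)
qed

lemma nn_integral_weight_of_bool:
  assumes P: "Measurable.pred (ref_measure n) P"
  shows "(\<integral>\<^sup>+\<phi>. ennreal (weight \<phi> * of_bool (P \<phi>)) \<partial>ref_measure n) =
    ennreal (Z * measure (gibbs_measure n U) {\<phi>\<in>space (gibbs_measure n U). P \<phi>})"
proof -
  interpret prob_space "gibbs_measure n U" by (rule prob_space_gibbs)
  have "ennreal Z * emeasure (gibbs_measure n U) {\<phi>\<in>space (ref_measure n). P \<phi>} =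
     (\<integral>\<^sup>+\<phi>. ennreal (weight \<phi> * of_bool (P \<phi>)) \<partial>ref_measure n)"
    unfolding emeasure_gibbs[OF P] using Z_pos
    by (simp add: ennreal_times_divide mult_divide_eq_ennreal mult.commute[of "ennreal Z"])
  then show ?thesis using Z_pos by (simp add: emeasure_eq_measure ennreal_mult)
qed

text \<open>The marginal law of the set of bad edges under the normalised joint weight.\<close>

definition bad_prob :: "((int \<times> int) \<times> (int \<times> int)) set \<Rightarrow> real" where
  "bad_prob \<omega> = enn2real (\<integral>\<^sup>+\<phi>. ennreal (W \<phi> \<omega>) \<partial>ref_measure n) / Z"

lemma bad_prob_nonneg: "0 \<le> bad_prob \<omega>"
  using Z_pos by (simp add: bad_prob_def)

lemma nn_integral_W:
  assumes "\<omega> \<subseteq> E"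
  shows "(\<integral>\<^sup>+\<phi>. ennreal (W \<phi> \<omega>) \<partial>ref_measure n) = ennreal (Z * bad_prob \<omega>)"
proof -
  have "(\<integral>\<^sup>+\<phi>. ennreal (W \<phi> \<omega>) \<partial>ref_measure n) \<le> (\<integral>\<^sup>+\<phi>. ennreal (weight \<phi>) \<partial>ref_measure n)"
  proof (intro nn_integral_mono ennreal_leI)
    fix \<phi>
    have "W \<phi> \<omega> \<le> (\<Sum>\<omega>\<in>Pow E. W \<phi> \<omega>)"
      using assms finite_torus_E W_nonneg by (intro member_le_sum) auto
    then show "W \<phi> \<omega> \<le> weight \<phi>" by (simp add: sum_split_weight finite_torus_E)
  qed
  then have "(\<integral>\<^sup>+\<phi>. ennreal (W \<phi> \<omega>) \<partial>ref_measure n) < \<top>"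
    unfolding nn_integral_weight by (rule order_le_less_trans) simp
  then show ?thesis using Z_pos by (simp add: bad_prob_def)
qed

text \<open>A bad edge carries the factor \<open>1 - cutoff ^ 3\<close>, which is 0 unless its
  gradient exceeds \<open>1 - \<epsilon>\<close> in modulus; so the product over S is at most the
  indicator that all these gradients are large. The empty S is treated apart, as
  \<open>controlled_gradients\<close> speaks of nonempty sets.\<close>

lemma sum_bad_prob_superset:
  assumes ctrl: "controlled_gradients (1/8) (1 - \<epsilon>) n U" and S: "S \<subseteq> E"
  shows "(\<Sum>\<omega>\<in>Pow E. bad_prob \<omega> * of_bool (S \<subseteq> \<omega>)) \<le> (1/8) ^ card S"
proof -
  interpret prob_space "gibbs_measure n U" by (rule prob_space_gibbs)
  let ?P = "\<lambda>\<phi>. \<forall>e\<in>S. \<bar>\<phi> (fst e) - \<phi> (snd e)\<bar> \<ge> 1 - \<epsilon>"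
  have finS: "finite S" using S finite_torus_E by (rule finite_subset)
  have P: "Measurable.pred (ref_measure n) ?P"
  proof (rule pred_intros_finite(3)[OF finS])
    fix e assume "e \<in> S"
    then have "(\<lambda>\<phi>. edge_diff \<phi> e) \<in> borel_measurable (ref_measure n)"
      using S by (intro edge_diff_measurable) auto
    then have "Measurable.pred (ref_measure n) (\<lambda>\<phi>. \<bar>edge_diff \<phi> e\<bar> \<ge> 1 - \<epsilon>)" by (rule pred_abs_ge)
    then show "Measurable.pred (ref_measure n) (\<lambda>\<phi>. \<bar>\<phi> (fst e) - \<phi> (snd e)\<bar> \<ge> 1 - \<epsilon>)"
      by (simp add: edge_diff_def)
  qed
  have le: "(\<Sum>\<omega>\<in>Pow E. W \<phi> \<omega> * of_bool (S \<subseteq> \<omega>)) \<le> weight \<phi> * of_bool (?P \<phi>)" for \<phi>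
  proof -
    have "(\<Prod>e\<in>S. 1 - cutoff \<epsilon> (edge_diff \<phi> e) ^ 3) \<le> of_bool (?P \<phi>)"
    proof (cases "?P \<phi>")
      case True
      then show ?thesis using cutoff_power_le_1 cutoff_nonneg by (auto intro!: prod_le_1)
    next
      case False
      then obtain e where "e \<in> S" "\<bar>edge_diff \<phi> e\<bar> \<le> 1 - \<epsilon>" by (force simp: edge_diff_def)
      then have "(\<Prod>e\<in>S. 1 - cutoff \<epsilon> (edge_diff \<phi> e) ^ 3) = 0"
        using finS eps by (intro prod_zero) (auto intro!: bexI[of _ e] simp: cutoff_eq_1)
      then show ?thesis by simp
    qed
    then show ?thesis
      unfolding sum_split_weight_superset[OF finite_torus_E S] by (intro mult_left_mono weight_nonneg)
  qed
  have "ennreal (Z * (\<Sum>\<omega>\<in>Pow E. bad_prob \<omega> * of_bool (S \<subseteq> \<omega>))) =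
      (\<Sum>\<omega>\<in>Pow E. ennreal (Z * (bad_prob \<omega> * of_bool (S \<subseteq> \<omega>))))"
    unfolding sum_distrib_left using Z_pos bad_prob_nonneg by (intro sum_ennreal[symmetric]) simp
  also have "\<dots> = (\<Sum>\<omega>\<in>Pow E. \<integral>\<^sup>+\<phi>. ennreal (W \<phi> \<omega> * of_bool (S \<subseteq> \<omega>)) \<partial>ref_measure n)"
    by (intro sum.cong refl) (auto simp: nn_integral_W)
  also have "\<dots> = (\<integral>\<^sup>+\<phi>. (\<Sum>\<omega>\<in>Pow E. ennreal (W \<phi> \<omega> * of_bool (S \<subseteq> \<omega>))) \<partial>ref_measure n)"
    using W_measurable by (intro nn_integral_sum[symmetric]) auto
  also have "\<dots> \<le> (\<integral>\<^sup>+\<phi>. ennreal (weight \<phi> * of_bool (?P \<phi>)) \<partial>ref_measure n)"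
    using le W_nonneg by (intro nn_integral_mono) (simp add: sum_ennreal ennreal_leI)
  also have "\<dots> = ennreal (Z * prob {\<phi>\<in>space (gibbs_measure n U). ?P \<phi>})"
    by (rule nn_integral_weight_of_bool[OF P])
  finally have "(\<Sum>\<omega>\<in>Pow E. bad_prob \<omega> * of_bool (S \<subseteq> \<omega>)) \<le> prob {\<phi>\<in>space (gibbs_measure n U). ?P \<phi>}"
    using Z_pos by (simp add: ennreal_le_iff)
  also have "\<dots> \<le> (1/8) ^ card S"
    using ctrl S by (cases "S = {}") (auto simp: controlled_gradients_def)
  finally show ?thesis .
qed

end

section \<open>Logarithmic peaks that are constant on clusters\<close>

section \<open>Logarithmic peaks\<close>

context bond_percolation
begin

text \<open>The logarithmic profile of a two-dimensional Green function, with \<open>reach\<close>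
  in place of the distance so that it has no increment on bad edges.\<close>

definition height :: "real \<Rightarrow> nat \<Rightarrow> ('v \<times> 'v) set \<Rightarrow> 'v \<Rightarrow> real" where
  "height c r \<omega> v = c * (ln (real r) - ln (real (reach \<omega> v)))"

text \<open>A bound for the increment that is monotone in \<open>\<omega>\<close>, as resampling
  requires: the excess occurs in the numerator only, and the denominator uses \<open>\<rho>\<close>
  instead of \<open>reach\<close>.\<close>

definition height_step :: "real \<Rightarrow> nat \<Rightarrow> 'v \<times> 'v \<Rightarrow> ('v \<times> 'v) set \<Rightarrow> real" where
  "height_step c r e \<omega> = (if \<rho> (fst e) = r \<and> \<rho> (snd e) = r then 0 else
     c * (real (excess \<omega> (fst e)) + real (excess \<omega> (snd e)) + 1) / real (min (\<rho> (fst e)) (\<rho> (snd e))))"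

lemma height_eq_0:
  assumes "\<omega> \<subseteq> E" "\<And>v. \<rho> v \<le> r" "\<rho> v = r" shows "height c r \<omega> v = 0"
proof -
  have "reach \<omega> v = r" using reach_ge[OF assms(1), of v] reach_le[OF assms(1,2), of v] assms(3) by simp
  then show ?thesis by (simp add: height_def)
qed

lemma edge_diff_height_bad: "e \<in> \<omega> \<Longrightarrow> edge_diff (height c r \<omega>) e = 0"
  using reach_cong[of "fst e" "snd e" \<omega>] by (simp add: edge_diff_def height_def)

lemma height_step_nonneg: "0 \<le> c \<Longrightarrow> 0 \<le> height_step c r e \<omega>"
  by (simp add: height_step_def)

lemma height_step_mono:
  "0 \<le> c \<Longrightarrow> \<omega> \<subseteq> \<omega>' \<Longrightarrow> \<omega>' \<subseteq> E \<Longrightarrow> height_step c r e \<omega> \<le> height_step c r e \<omega>'"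
  using excess_mono[of \<omega> \<omega>']
  by (auto simp: height_step_def intro!: divide_right_mono mult_left_mono add_mono)

text \<open>Apply \<open>ln x \<le> x - 1\<close> to the quotient of the two reaches. They differ by
  at most the two excesses plus 1, and each is at least the smaller \<open>\<rho>\<close>.\<close>

lemma edge_diff_height_le:
  assumes \<omega>: "\<omega> \<subseteq> E" and e: "e \<in> E" and c: "0 \<le> c" and r: "\<And>v. \<rho> v \<le> r" and ge1: "\<And>v. 1 \<le> \<rho> v"
  shows "\<bar>edge_diff (height c r \<omega>) e\<bar> \<le> height_step c r e \<omega>"
proof (cases "\<rho> (fst e) = r \<and> \<rho> (snd e) = r")
  case True
  then show ?thesis using height_eq_0[OF \<omega> r] by (simp add: edge_diff_def height_step_def)
next
  case False
  let ?k = "min (\<rho> (fst e)) (\<rho> (snd e))"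
  let ?X = "real (excess \<omega> (fst e)) + real (excess \<omega> (snd e)) + 1"
  have k1: "1 \<le> ?k" using ge1 by simp
  have lip: "\<rho> (fst e) \<le> \<rho> (snd e) + 1" "\<rho> (snd e) \<le> \<rho> (fst e) + 1" using lipschitz[of "fst e" "snd e"] e by auto
  have *: "ln (real (reach \<omega> a)) - ln (real (reach \<omega> b)) \<le> ?X / real ?k"
    if ab: "{a, b} = {fst e, snd e}" for a b
  proof -
    have Rb: "?k \<le> \<rho> b" using ab by (auto simp: doubleton_eq_iff)
    have pos: "0 < real (reach \<omega> b)" "0 < real (reach \<omega> a)"
      using reach_ge[OF \<omega>, of b] reach_ge[OF \<omega>, of a] ge1[of a] ge1[of b] by auto
    have num: "real (reach \<omega> a) - real (reach \<omega> b) \<le> ?X"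
      using ab lip reach_eq_excess[OF \<omega>, of a] reach_eq_excess[OF \<omega>, of b]
      by (auto simp: doubleton_eq_iff)
    have "ln (real (reach \<omega> a)) - ln (real (reach \<omega> b)) = ln (real (reach \<omega> a) / real (reach \<omega> b))"
      using pos by (simp add: ln_div)
    also have "\<dots> \<le> real (reach \<omega> a) / real (reach \<omega> b) - 1" using pos by (intro ln_le_minus_one) simp
    also have "\<dots> = (real (reach \<omega> a) - real (reach \<omega> b)) / real (reach \<omega> b)" using pos by (simp add: field_simps)
    also have "\<dots> \<le> ?X / real (reach \<omega> b)" using num pos by (intro divide_right_mono) auto
    also have "\<dots> \<le> ?X / real ?k"
      using Rb k1 reach_ge[OF \<omega>, of b] by (intro divide_left_mono) auto
    finally show ?thesis .
  qed
  have "edge_diff (height c r \<omega>) e = - (c * (ln (real (reach \<omega> (fst e))) - ln (real (reach \<omega> (snd e)))))"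
    by (simp add: edge_diff_def height_def algebra_simps)
  then have "\<bar>edge_diff (height c r \<omega>) e\<bar> = c * \<bar>ln (real (reach \<omega> (fst e))) - ln (real (reach \<omega> (snd e)))\<bar>"
    using c by (simp add: abs_mult)
  also have "\<dots> \<le> c * (?X / real ?k)"
    using *[of "fst e" "snd e"] *[of "snd e" "fst e"] c by (intro mult_left_mono) (auto simp: abs_le_iff insert_commute)
  finally show ?thesis using False by (auto simp: height_step_def)
qed

text \<open>Unless both endpoints have \<open>\<rho> = r\<close>, the smaller value is below r, and
  the power of its reciprocal is charged to that endpoint. The random factor separates and is
  averaged by \<open>excess_pair_moment\<close>.\<close>

lemma height_step_moment:
  assumes q: "1 \<le> q" "q \<le> 3" and c: "0 \<le> c" and r: "\<And>v. \<rho> v \<le> r" and ge1: "\<And>v. 1 \<le> \<rho> v"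
  shows "(\<Sum>\<omega>\<in>Pow E. p \<omega> * (\<Sum>e\<in>E. height_step c r e \<omega> ^ q))
    \<le> 333 * c ^ q * (\<Sum>e\<in>E. of_bool (\<rho> (fst e) < r) * (1 / real (\<rho> (fst e)) ^ q)
                        + of_bool (\<rho> (snd e) < r) * (1 / real (\<rho> (snd e)) ^ q))"
proof -
  let ?f = "\<lambda>v. of_bool (\<rho> v < r) * (1 / real (\<rho> v) ^ q)"
  let ?X = "\<lambda>e \<omega>. real (excess \<omega> (fst e)) + real (excess \<omega> (snd e)) + 1"
  have step: "height_step c r e \<omega> ^ q \<le> c ^ q * (?f (fst e) + ?f (snd e)) * ?X e \<omega> ^ q" for e \<omega>
  proof (cases "\<rho> (fst e) = r \<and> \<rho> (snd e) = r")
    case True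
    then show ?thesis using q by (simp add: height_step_def power_0_left)
  next
    case False
    let ?k = "min (\<rho> (fst e)) (\<rho> (snd e))"
    have f0: "0 \<le> ?f v" for v by simp
    have "1 / real ?k ^ q \<le> ?f (fst e) + ?f (snd e)"
    proof (cases "\<rho> (fst e) \<le> \<rho> (snd e)")
      case True
      then have "\<rho> (fst e) < r" using False r[of "snd e"] r[of "fst e"] by linarith
      then show ?thesis using True f0[of "snd e"] by simp
    next
      case F: False
      then have "\<rho> (snd e) < r" using r[of "snd e"] r[of "fst e"] by linarith
      then show ?thesis using F f0[of "fst e"] by simp
    qed
    then have "c ^ q * (1 / real ?k ^ q) * ?X e \<omega> ^ q \<le> c ^ q * (?f (fst e) + ?f (snd e)) * ?X e \<omega> ^ q"
      using c by (intro mult_right_mono mult_left_mono) auto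
    moreover have "height_step c r e \<omega> ^ q = c ^ q * (1 / real ?k ^ q) * ?X e \<omega> ^ q"
      unfolding height_step_def if_not_P[OF False] by (simp add: power_divide power_mult_distrib del: of_nat_min)
    ultimately show ?thesis by simp
  qed
  have "(\<Sum>\<omega>\<in>Pow E. p \<omega> * (\<Sum>e\<in>E. height_step c r e \<omega> ^ q))
     \<le> (\<Sum>\<omega>\<in>Pow E. p \<omega> * (\<Sum>e\<in>E. c ^ q * (?f (fst e) + ?f (snd e)) * ?X e \<omega> ^ q))"
    by (intro sum_mono mult_left_mono step p_nonneg)
  also have "\<dots> = (\<Sum>\<omega>\<in>Pow E. \<Sum>e\<in>E. c ^ q * (?f (fst e) + ?f (snd e)) * (p \<omega> * ?X e \<omega> ^ q))"
    unfolding sum_distrib_left by (intro sum.cong refl) (simp only: mult_ac)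
  also have "\<dots> = (\<Sum>e\<in>E. c ^ q * (?f (fst e) + ?f (snd e)) * (\<Sum>\<omega>\<in>Pow E. p \<omega> * ?X e \<omega> ^ q))"
    unfolding sum_distrib_left by (rule sum.swap)
  also have "\<dots> \<le> (\<Sum>e\<in>E. c ^ q * (?f (fst e) + ?f (snd e)) * 333)"
    using c by (intro sum_mono mult_left_mono excess_pair_moment[OF q(2)]) auto
  also have "\<dots> = 333 * c ^ q * (\<Sum>e\<in>E. ?f (fst e) + ?f (snd e))"
    unfolding sum_distrib_left by (intro sum.cong refl) (simp only: mult_ac)
  finally show ?thesis .
qed

end

section \<open>From peaks to the probability of a flat surface\<close>

section \<open>Shifting the surface\<close>

lemma sum_of_bool_le_1:
  assumes "finite I" "\<And>i j. i \<in> I \<Longrightarrow> j \<in> I \<Longrightarrow> P i \<Longrightarrow> P j \<Longrightarrow> i = j"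
  shows "(\<Sum>i\<in>I. of_bool (P i) :: real) \<le> 1"
proof (cases "\<exists>i\<in>I. P i")
  case True
  then obtain i where i: "i \<in> I" "P i" by blast
  have "(\<Sum>j\<in>I. of_bool (P j) :: real) = (\<Sum>j\<in>{i}. of_bool (P j))"
    using assms i by (intro sum.mono_neutral_right) auto
  then show ?thesis by (simp del: sum_of_bool_eq)
next
  case False
  then have "(\<Sum>i\<in>I. of_bool (P i) :: real) = 0" by (intro sum.neutral) auto
  then show ?thesis by simp
qed

context torus_surface
begin

definition flat :: "real \<Rightarrow> (int \<times> int \<Rightarrow> real) \<Rightarrow> bool" where
  "flat h \<phi> \<longleftrightarrow> (\<forall>v\<in>V. \<bar>\<phi> v\<bar> < h)"

lemma flat_measurable:
  assumes "\<And>v. v \<in> V \<Longrightarrow> (\<lambda>\<phi>. G \<phi> v) \<in> borel_measurable N"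
  shows "Measurable.pred N (\<lambda>\<phi>. flat h (G \<phi>))"
  unfolding flat_def
proof (rule pred_intros_finite(3)[OF finite_torus_V])
  fix v assume "v \<in> V"
  then have "Measurable.pred N (\<lambda>\<phi>. \<not> h \<le> \<bar>G \<phi> v\<bar>)"
    by (intro pred_intros_logic pred_abs_ge assms)
  then show "Measurable.pred N (\<lambda>\<phi>. \<bar>G \<phi> v\<bar> < h)" by (simp add: not_le)
qed

lemma W_local: "(\<And>v. v \<in> V \<Longrightarrow> \<phi> v = \<psi> v) \<Longrightarrow> \<omega> \<subseteq> E \<Longrightarrow> W \<phi> \<omega> = W \<psi> \<omega>"
proof -
  assume eq: "\<And>v. v \<in> V \<Longrightarrow> \<phi> v = \<psi> v" and \<omega>: "\<omega> \<subseteq> E"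
  have "edge_diff \<phi> e = edge_diff \<psi> e" if "e \<in> E" for e
    using torus_E_vertices[OF _ that] n_ge_2 by (simp add: edge_diff_def eq)
  then show ?thesis using \<omega> unfolding split_weight_def
    by (intro arg_cong2[where f="(*)"] prod.cong) auto
qed

lemma flat_shift_measurable: "Measurable.pred (ref_measure n) (\<lambda>\<phi>. flat h (\<lambda>v. \<phi> v + t v))"
  by (intro flat_measurable borel_measurable_add borel_measurable_const coord_measurable)

lemma W_shift_measurable:
  assumes "\<omega> \<subseteq> E" shows "(\<lambda>\<phi>. W (\<lambda>v. \<phi> v + t v) \<omega>) \<in> borel_measurable (ref_measure n)"
proof (rule W_measurable_compose[OF _ assms])
  fix e assume "e \<in> E"
  then have "(\<lambda>\<phi>. edge_diff \<phi> e + edge_diff t e) \<in> borel_measurable (ref_measure n)"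
    by (intro borel_measurable_add edge_diff_measurable borel_measurable_const)
  then show "(\<lambda>\<phi>. edge_diff (\<lambda>v. \<phi> v + t v) e) \<in> borel_measurable (ref_measure n)"
    by (simp add: edge_diff_def algebra_simps)
qed

lemma of_bool_measurable:
  "Measurable.pred N P \<Longrightarrow> (\<lambda>\<phi>. of_bool (P \<phi>) :: real) \<in> borel_measurable N"
  unfolding of_bool_def by measurable

text \<open>With \<open>\<omega>\<close> fixed, t is a deterministic translation, and
  \<open>t (0, 0) = 0\<close> makes it compatible with the pinned site.\<close>

lemma nn_integral_W_shift:
  assumes \<omega>: "\<omega> \<subseteq> E" and t: "t (0, 0) = 0"
  shows "(\<integral>\<^sup>+\<phi>. ennreal (W (\<lambda>v. \<phi> v + t v) \<omega> * of_bool (flat h \<phi>)) \<partial>ref_measure n) =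
     (\<integral>\<^sup>+\<phi>. ennreal (W \<phi> \<omega> * of_bool (flat h (\<lambda>v. \<phi> v - t v))) \<partial>ref_measure n)"
proof -
  let ?F = "\<lambda>\<phi>. ennreal (W \<phi> \<omega> * of_bool (flat h (\<lambda>v. \<phi> v - t v)))"
  have "(\<integral>\<^sup>+\<phi>. ?F (\<lambda>v. \<phi> v + t v) \<partial>ref_measure n) = (\<integral>\<^sup>+\<phi>. ?F \<phi> \<partial>ref_measure n)"
    unfolding ref_measure_eq
  proof (rule nn_integral_PiM_site_measure_shift[OF finite_torus_V, of t "(0, 0)"])
    have "Measurable.pred (ref_measure n) (\<lambda>\<phi>. flat h (\<lambda>v. \<phi> v - t v))"
      using flat_shift_measurable[of h "\<lambda>v. - t v"] by simp
    then show "?F \<in> borel_measurable (PiM V (site_measure (0, 0)))"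
      unfolding ref_measure_eq[symmetric] using W_measurable[OF \<omega>]
      by (intro measurable_compose[OF _ measurable_ennreal] borel_measurable_times of_bool_measurable)
    fix \<phi> \<psi> :: "int \<times> int \<Rightarrow> real" assume eq: "\<And>v. v \<in> V \<Longrightarrow> \<phi> v = \<psi> v"
    then have "flat h (\<lambda>v. \<phi> v - t v) = flat h (\<lambda>v. \<psi> v - t v)" by (auto simp: flat_def)
    then show "?F \<phi> = ?F \<psi>" using W_local[OF eq \<omega>] by simp
  qed (fact t)
  then show ?thesis by simp
qed

text \<open>Integrates the pointwise inequality over the flat event. After translating back, the
  main terms measure surfaces that become flat once \<open>\<tau> \<omega>\<close> is subtracted or
  added; \<open>\<eta>\<close> bounds the mean error under the law of
  \<open>\<omega>\<close>.\<close>

lemma flat_weight_integral_le: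
  assumes zero: "\<And>\<omega> e. \<omega> \<subseteq> E \<Longrightarrow> e \<in> \<omega> \<Longrightarrow> edge_diff (\<tau> \<omega>) e = 0"
    and b: "\<And>\<omega> e. \<omega> \<subseteq> E \<Longrightarrow> e \<in> E \<Longrightarrow> \<bar>edge_diff (\<tau> \<omega>) e\<bar> \<le> b e \<omega>"
    and b0: "\<And>\<omega> e. 0 \<le> b e \<omega>"
    and mono: "\<And>\<omega> \<omega>' e. e \<in> E \<Longrightarrow> \<omega> \<subseteq> \<omega>' \<Longrightarrow> \<omega>' \<subseteq> E \<Longrightarrow> b e \<omega> \<le> b e \<omega>'"
    and K: "0 < K"
    and root: "\<And>\<omega>. \<omega> \<subseteq> E \<Longrightarrow> \<tau> \<omega> (0, 0) = 0"
    and error: "(\<Sum>\<omega>\<in>Pow E. bad_prob \<omega> * ((\<Sum>e\<in>E. (b e \<omega> / \<epsilon>)\<^sup>2) / K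
        + 64 * (\<Sum>e\<in>E. (b e \<omega> / \<epsilon>) ^ 3) + of_bool (\<not> Q \<omega>))) \<le> \<eta>"
  shows "(\<integral>\<^sup>+\<phi>. ennreal (weight \<phi> * of_bool (flat h \<phi>)) \<partial>ref_measure n) \<le>
     ennreal (exp ((B + 18) * K)) * (\<Sum>\<omega>\<in>Pow E.
         (\<integral>\<^sup>+\<phi>. ennreal (W \<phi> \<omega> * of_bool (Q \<omega> \<and> flat h (\<lambda>v. \<phi> v - \<tau> \<omega> v))) \<partial>ref_measure n) +
         (\<integral>\<^sup>+\<phi>. ennreal (W \<phi> \<omega> * of_bool (Q \<omega> \<and> flat h (\<lambda>v. \<phi> v + \<tau> \<omega> v))) \<partial>ref_measure n)) +
     ennreal (Z * \<eta>)"
proof -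
  let ?R = "ref_measure n" and ?X = "exp ((B + 18) * K)"
  define H where "H \<omega> = (\<Sum>e\<in>E. (b e \<omega> / \<epsilon>)\<^sup>2) / K + 64 * (\<Sum>e\<in>E. (b e \<omega> / \<epsilon>) ^ 3) + of_bool (\<not> Q \<omega>)" for \<omega>
  have H0: "0 \<le> H \<omega>" for \<omega>
    unfolding H_def using K eps b0 by (intro add_nonneg_nonneg divide_nonneg_nonneg mult_nonneg_nonneg sum_nonneg) auto
  let ?P = "\<lambda>\<phi> \<omega>. W (\<lambda>v. \<phi> v + \<tau> \<omega> v) \<omega> * of_bool (flat h \<phi>)"
  let ?N = "\<lambda>\<phi> \<omega>. W (\<lambda>v. \<phi> v + - \<tau> \<omega> v) \<omega> * of_bool (flat h \<phi>)"
  have flat0: "Measurable.pred ?R (\<lambda>\<phi>. flat h \<phi>)" using flat_shift_measurable[of h "\<lambda>_. 0"] by simp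
  have mP: "(\<lambda>\<phi>. ennreal (?P \<phi> \<omega>)) \<in> borel_measurable ?R" if "\<omega> \<subseteq> E" for \<omega>
    by (intro measurable_compose[OF _ measurable_ennreal] borel_measurable_times of_bool_measurable
        W_shift_measurable that flat0)
  have mN: "(\<lambda>\<phi>. ennreal (?N \<phi> \<omega>)) \<in> borel_measurable ?R" if "\<omega> \<subseteq> E" for \<omega>
    using W_shift_measurable[OF that, of "\<lambda>v. - \<tau> \<omega> v"]
    by (intro measurable_compose[OF _ measurable_ennreal] borel_measurable_times of_bool_measurable flat0)
  have mW: "(\<lambda>\<phi>. ennreal (W \<phi> \<omega>)) \<in> borel_measurable ?R" if "\<omega> \<subseteq> E" for \<omega>
    by (intro measurable_compose[OF _ measurable_ennreal] W_measurable that)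
  have pt: "ennreal (weight \<phi> * of_bool (flat h \<phi>)) \<le>
      ennreal ?X * (\<Sum>\<omega>\<in>Pow E. of_bool (Q \<omega>) * (ennreal (?P \<phi> \<omega>) + ennreal (?N \<phi> \<omega>)))
      + (\<Sum>\<omega>\<in>Pow E. ennreal (H \<omega>) * ennreal (W \<phi> \<omega>))" for \<phi>
  proof -
    have le: "weight \<phi> \<le> ?X * (\<Sum>\<omega>\<in>Pow E. of_bool (Q \<omega>) * (W (\<lambda>v. \<phi> v + \<tau> \<omega> v) \<omega> + W (\<lambda>v. \<phi> v - \<tau> \<omega> v) \<omega>))
        + (\<Sum>\<omega>\<in>Pow E. W \<phi> \<omega> * H \<omega>)"
      unfolding H_def by (rule weight_le_shifted_plus_error[OF finite_torus_E zero b b0 mono K])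
    have "weight \<phi> * of_bool (flat h \<phi>) \<le> ?X * (\<Sum>\<omega>\<in>Pow E. of_bool (Q \<omega>) * (?P \<phi> \<omega> + ?N \<phi> \<omega>))
        + (\<Sum>\<omega>\<in>Pow E. H \<omega> * W \<phi> \<omega>)"
    proof (cases "flat h \<phi>")
      case True
      then show ?thesis using le by (simp add: mult.commute[of "H _"])
    next
      case False
      then show ?thesis using H0 W_nonneg by (simp add: sum_nonneg)
    qed
    then have "ennreal (weight \<phi> * of_bool (flat h \<phi>)) \<le> ennreal (?X * (\<Sum>\<omega>\<in>Pow E. of_bool (Q \<omega>) * (?P \<phi> \<omega> + ?N \<phi> \<omega>))
        + (\<Sum>\<omega>\<in>Pow E. H \<omega> * W \<phi> \<omega>))" by (rule ennreal_leI)
    also have "\<dots> = ennreal (?X * (\<Sum>\<omega>\<in>Pow E. of_bool (Q \<omega>) * (?P \<phi> \<omega> + ?N \<phi> \<omega>)))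
        + ennreal (\<Sum>\<omega>\<in>Pow E. H \<omega> * W \<phi> \<omega>)"
      using H0 W_nonneg by (intro ennreal_plus mult_nonneg_nonneg sum_nonneg add_nonneg_nonneg) auto
    also have "ennreal (\<Sum>\<omega>\<in>Pow E. H \<omega> * W \<phi> \<omega>) = (\<Sum>\<omega>\<in>Pow E. ennreal (H \<omega>) * ennreal (W \<phi> \<omega>))"
      using H0 W_nonneg by (subst sum_ennreal[symmetric]) (auto simp: ennreal_mult)
    also have "ennreal (?X * (\<Sum>\<omega>\<in>Pow E. of_bool (Q \<omega>) * (?P \<phi> \<omega> + ?N \<phi> \<omega>)))
       = ennreal ?X * (\<Sum>\<omega>\<in>Pow E. ennreal (of_bool (Q \<omega>) * (?P \<phi> \<omega> + ?N \<phi> \<omega>)))"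
      using W_nonneg by (subst sum_ennreal) (auto intro!: ennreal_mult sum_nonneg mult_nonneg_nonneg add_nonneg_nonneg)
    also have "(\<Sum>\<omega>\<in>Pow E. ennreal (of_bool (Q \<omega>) * (?P \<phi> \<omega> + ?N \<phi> \<omega>))) =
        (\<Sum>\<omega>\<in>Pow E. of_bool (Q \<omega>) * (ennreal (?P \<phi> \<omega>) + ennreal (?N \<phi> \<omega>)))"
      using W_nonneg by (intro sum.cong refl) (simp add: of_bool_def ennreal_plus)
    finally show ?thesis .
  qed
  have "(\<integral>\<^sup>+\<phi>. ennreal (weight \<phi> * of_bool (flat h \<phi>)) \<partial>?R) \<le>
     (\<integral>\<^sup>+\<phi>. ennreal ?X * (\<Sum>\<omega>\<in>Pow E. of_bool (Q \<omega>) * (ennreal (?P \<phi> \<omega>) + ennreal (?N \<phi> \<omega>)))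
      + (\<Sum>\<omega>\<in>Pow E. ennreal (H \<omega>) * ennreal (W \<phi> \<omega>)) \<partial>?R)"
    by (intro nn_integral_mono pt)
  also have "\<dots> = ennreal ?X * (\<Sum>\<omega>\<in>Pow E. of_bool (Q \<omega>) * ((\<integral>\<^sup>+\<phi>. ennreal (?P \<phi> \<omega>) \<partial>?R) + (\<integral>\<^sup>+\<phi>. ennreal (?N \<phi> \<omega>) \<partial>?R)))
      + (\<Sum>\<omega>\<in>Pow E. ennreal (H \<omega>) * (\<integral>\<^sup>+\<phi>. ennreal (W \<phi> \<omega>) \<partial>?R))"
  proof -
    have s1: "(\<lambda>\<phi>. \<Sum>\<omega>\<in>Pow E. of_bool (Q \<omega>) * (ennreal (?P \<phi> \<omega>) + ennreal (?N \<phi> \<omega>))) \<in> borel_measurable ?R"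
      using mP mN by (intro borel_measurable_sum borel_measurable_times borel_measurable_add borel_measurable_const) auto
    have s2: "(\<lambda>\<phi>. \<Sum>\<omega>\<in>Pow E. ennreal (H \<omega>) * ennreal (W \<phi> \<omega>)) \<in> borel_measurable ?R"
      using mW by (intro borel_measurable_sum borel_measurable_times borel_measurable_const) auto
    have "(\<integral>\<^sup>+\<phi>. (\<Sum>\<omega>\<in>Pow E. of_bool (Q \<omega>) * (ennreal (?P \<phi> \<omega>) + ennreal (?N \<phi> \<omega>))) \<partial>?R)
       = (\<Sum>\<omega>\<in>Pow E. \<integral>\<^sup>+\<phi>. of_bool (Q \<omega>) * (ennreal (?P \<phi> \<omega>) + ennreal (?N \<phi> \<omega>)) \<partial>?R)"
      using mP mN by (intro nn_integral_sum borel_measurable_times borel_measurable_add borel_measurable_const) auto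
    also have "\<dots> = (\<Sum>\<omega>\<in>Pow E. of_bool (Q \<omega>) * ((\<integral>\<^sup>+\<phi>. ennreal (?P \<phi> \<omega>) \<partial>?R) + (\<integral>\<^sup>+\<phi>. ennreal (?N \<phi> \<omega>) \<partial>?R)))"
    proof (intro sum.cong refl)
      fix \<omega> assume "\<omega> \<in> Pow E"
      then have \<omega>: "\<omega> \<subseteq> E" by simp
      show "(\<integral>\<^sup>+\<phi>. of_bool (Q \<omega>) * (ennreal (?P \<phi> \<omega>) + ennreal (?N \<phi> \<omega>)) \<partial>?R) =
          of_bool (Q \<omega>) * ((\<integral>\<^sup>+\<phi>. ennreal (?P \<phi> \<omega>) \<partial>?R) + (\<integral>\<^sup>+\<phi>. ennreal (?N \<phi> \<omega>) \<partial>?R))"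
        using nn_integral_add[OF mP[OF \<omega>] mN[OF \<omega>]] by (cases "Q \<omega>") simp_all
    qed
    finally have i1: "(\<integral>\<^sup>+\<phi>. (\<Sum>\<omega>\<in>Pow E. of_bool (Q \<omega>) * (ennreal (?P \<phi> \<omega>) + ennreal (?N \<phi> \<omega>))) \<partial>?R) =
      (\<Sum>\<omega>\<in>Pow E. of_bool (Q \<omega>) * ((\<integral>\<^sup>+\<phi>. ennreal (?P \<phi> \<omega>) \<partial>?R) + (\<integral>\<^sup>+\<phi>. ennreal (?N \<phi> \<omega>) \<partial>?R)))" .
    have "(\<integral>\<^sup>+\<phi>. (\<Sum>\<omega>\<in>Pow E. ennreal (H \<omega>) * ennreal (W \<phi> \<omega>)) \<partial>?R)
       = (\<Sum>\<omega>\<in>Pow E. \<integral>\<^sup>+\<phi>. ennreal (H \<omega>) * ennreal (W \<phi> \<omega>) \<partial>?R)"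
      using mW by (intro nn_integral_sum borel_measurable_times borel_measurable_const) auto
    also have "\<dots> = (\<Sum>\<omega>\<in>Pow E. ennreal (H \<omega>) * (\<integral>\<^sup>+\<phi>. ennreal (W \<phi> \<omega>) \<partial>?R))"
      using mW by (intro sum.cong refl nn_integral_cmult) auto
    finally have i2: "(\<integral>\<^sup>+\<phi>. (\<Sum>\<omega>\<in>Pow E. ennreal (H \<omega>) * ennreal (W \<phi> \<omega>)) \<partial>?R) =
      (\<Sum>\<omega>\<in>Pow E. ennreal (H \<omega>) * (\<integral>\<^sup>+\<phi>. ennreal (W \<phi> \<omega>) \<partial>?R))" .
    show ?thesis
      unfolding i1[symmetric] i2[symmetric] nn_integral_cmult[OF s1, symmetric]
      using s1 s2 by (intro nn_integral_add borel_measurable_times_ennreal borel_measurable_const)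
  qed
  also have "(\<Sum>\<omega>\<in>Pow E. of_bool (Q \<omega>) * ((\<integral>\<^sup>+\<phi>. ennreal (?P \<phi> \<omega>) \<partial>?R) + (\<integral>\<^sup>+\<phi>. ennreal (?N \<phi> \<omega>) \<partial>?R))) =
     (\<Sum>\<omega>\<in>Pow E.
         (\<integral>\<^sup>+\<phi>. ennreal (W \<phi> \<omega> * of_bool (Q \<omega> \<and> flat h (\<lambda>v. \<phi> v - \<tau> \<omega> v))) \<partial>?R) +
         (\<integral>\<^sup>+\<phi>. ennreal (W \<phi> \<omega> * of_bool (Q \<omega> \<and> flat h (\<lambda>v. \<phi> v + \<tau> \<omega> v))) \<partial>?R))"
  proof (intro sum.cong refl)
    fix \<omega> assume "\<omega> \<in> Pow E"
    then have \<omega>: "\<omega> \<subseteq> E" by simp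
    show "of_bool (Q \<omega>) * ((\<integral>\<^sup>+\<phi>. ennreal (?P \<phi> \<omega>) \<partial>?R) + (\<integral>\<^sup>+\<phi>. ennreal (?N \<phi> \<omega>) \<partial>?R)) =
         (\<integral>\<^sup>+\<phi>. ennreal (W \<phi> \<omega> * of_bool (Q \<omega> \<and> flat h (\<lambda>v. \<phi> v - \<tau> \<omega> v))) \<partial>?R) +
         (\<integral>\<^sup>+\<phi>. ennreal (W \<phi> \<omega> * of_bool (Q \<omega> \<and> flat h (\<lambda>v. \<phi> v + \<tau> \<omega> v))) \<partial>?R)"
    proof (cases "Q \<omega>")
      case True
      then show ?thesis
        using nn_integral_W_shift[of \<omega> "\<tau> \<omega>" h] nn_integral_W_shift[of \<omega> "\<lambda>v. - \<tau> \<omega> v" h] \<omega> root[OF \<omega>]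
        by simp
    qed simp
  qed
  also have "(\<Sum>\<omega>\<in>Pow E. ennreal (H \<omega>) * (\<integral>\<^sup>+\<phi>. ennreal (W \<phi> \<omega>) \<partial>?R)) = ennreal (Z * (\<Sum>\<omega>\<in>Pow E. bad_prob \<omega> * H \<omega>))"
  proof -
    have "(\<Sum>\<omega>\<in>Pow E. ennreal (H \<omega>) * (\<integral>\<^sup>+\<phi>. ennreal (W \<phi> \<omega>) \<partial>?R)) = (\<Sum>\<omega>\<in>Pow E. ennreal (Z * (bad_prob \<omega> * H \<omega>)))"
      using H0 Z_pos bad_prob_nonneg
      by (intro sum.cong refl) (simp add: nn_integral_W ennreal_mult[symmetric] mult_ac)
    also have "\<dots> = ennreal (\<Sum>\<omega>\<in>Pow E. Z * (bad_prob \<omega> * H \<omega>))"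
      using H0 Z_pos bad_prob_nonneg by (intro sum_ennreal) simp
    finally show ?thesis by (simp add: sum_distrib_left)
  qed
  also have "\<dots> \<le> ennreal (Z * \<eta>)"
    using error Z_pos unfolding H_def by (intro ennreal_leI mult_left_mono) auto
  finally show ?thesis by (simp add: add_left_mono)
qed

lemma bond_percolation_torus:
  assumes "controlled_gradients (1/8) (1 - \<epsilon>) n U" "int r \<le> c" "c + int r \<le> int n" "1 \<le> r"
  shows "bond_percolation E bad_prob (peak_dist r c)"
proof
  show "finite E" by (rule finite_torus_E)
  show "(b, a) \<notin> E" if "(a, b) \<in> E" for a b using torus_E_antisym[OF n_ge_2 that] .
  show "card {b. linked E a b} \<le> 4" for a by (rule torus_E_degree)
  show "0 \<le> bad_prob \<omega>" for \<omega> by (rule bad_prob_nonneg)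
  show "(\<Sum>\<omega>\<in>Pow E. bad_prob \<omega> * of_bool (S \<subseteq> \<omega>)) \<le> (1/8) ^ card S" if "S \<subseteq> E" for S
    using sum_bad_prob_superset[OF assms(1) that] .
  show "peak_dist r c a \<le> peak_dist r c b + 1 \<and> peak_dist r c b \<le> peak_dist r c a + 1" if "(a, b) \<in> E" for a b
    using peak_dist_lipschitz[OF assms(2-4) that] .
qed

text \<open>The shift is \<open>height\<close> with amplitude \<open>\<gamma> * \<epsilon>\<close>.
  Three sources of error cost at most 1/16 each: too much energy, a single large increment, and a
  peak that is too low at its centre. K is 16 times a bound for the mean energy, with 31968 = 2 *
  15984.\<close>

lemma peak_exists:
  assumes ctrl: "controlled_gradients (1/8) (1 - \<epsilon>) n U"
    and c: "int r \<le> c" "c + int r \<le> int n" and r: "64 \<le> r" and nr: "n < r ^ 3"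
    and \<gamma>: "0 < \<gamma>" "\<gamma> \<le> 1/320"
  defines "K \<equiv> 16 * (31968 * \<gamma>\<^sup>2 * ln (real r))" and "h \<equiv> \<gamma> * \<epsilon> / 9 * ln (real n)"
  shows "\<exists>\<tau>. (\<forall>\<omega> v. \<omega> \<subseteq> E \<longrightarrow> peak_dist r c v = r \<longrightarrow> \<tau> \<omega> v = 0) \<and>
     (\<integral>\<^sup>+\<phi>. ennreal (weight \<phi> * of_bool (flat h \<phi>)) \<partial>ref_measure n) \<le>
     ennreal (exp ((B + 18) * K)) * (\<Sum>\<omega>\<in>Pow E.
         (\<integral>\<^sup>+\<phi>. ennreal (W \<phi> \<omega> * of_bool (2 * h \<le> \<tau> \<omega> (c, 0) \<and> flat h (\<lambda>v. \<phi> v - \<tau> \<omega> v))) \<partial>ref_measure n) +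
         (\<integral>\<^sup>+\<phi>. ennreal (W \<phi> \<omega> * of_bool (2 * h \<le> \<tau> \<omega> (c, 0) \<and> flat h (\<lambda>v. \<phi> v + \<tau> \<omega> v))) \<partial>ref_measure n)) +
     ennreal (Z * (3/16))"
proof -
  have r1: "1 \<le> r" using r by simp
  interpret bond_percolation E bad_prob "peak_dist r c"
    by (rule bond_percolation_torus[OF ctrl c r1])
  let ?\<rho> = "peak_dist r c"
  define C where "C = \<gamma> * \<epsilon>"
  have C: "0 < C" "C / \<epsilon> = \<gamma>" using \<gamma> eps by (auto simp: C_def)
  have \<rho>: "?\<rho> v \<le> r" "1 \<le> ?\<rho> v" for v using peak_dist_le[OF r1] peak_dist_ge_1 by auto
  let ?\<tau> = "height C r" and ?b = "height_step C r"
  have lnr: "0 < ln (real r)" using r by simp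
  have K0: "0 < K" using \<gamma> lnr by (simp add: K_def)
  \<comment> \<open>15984 = 333 * 4 * 12 combines the moments of the excess, the edges per vertex
    and the size of the shells.\<close>
  have moment: "(\<Sum>\<omega>\<in>Pow E. bad_prob \<omega> * (\<Sum>e\<in>E. (?b e \<omega> / \<epsilon>) ^ q)) \<le> 15984 * \<gamma> ^ q * (\<Sum>k=1..<r. real k * (1 / real k ^ q))"
    if q: "1 \<le> q" "q \<le> 3" for q
  proof -
    let ?f = "\<lambda>v. of_bool (?\<rho> v < r) * (1 / real (?\<rho> v) ^ q)"
    have "(\<Sum>e\<in>E. (?b e \<omega> / \<epsilon>) ^ q) = (\<Sum>e\<in>E. ?b e \<omega> ^ q) / \<epsilon> ^ q" for \<omega>
      unfolding power_divide by (rule sum_divide_distrib[symmetric])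
    then have "(\<Sum>\<omega>\<in>Pow E. bad_prob \<omega> * (\<Sum>e\<in>E. (?b e \<omega> / \<epsilon>) ^ q)) = (\<Sum>\<omega>\<in>Pow E. bad_prob \<omega> * (\<Sum>e\<in>E. ?b e \<omega> ^ q)) / \<epsilon> ^ q"
      by (simp only: times_divide_eq_right sum_divide_distrib[symmetric])
    also have "\<dots> \<le> (333 * C ^ q * (\<Sum>e\<in>E. ?f (fst e) + ?f (snd e))) / \<epsilon> ^ q"
      using C eps by (intro divide_right_mono height_step_moment q \<rho>) auto
    also have "\<dots> = 333 * \<gamma> ^ q * (\<Sum>e\<in>E. ?f (fst e) + ?f (snd e))"
      unfolding C(2)[symmetric] by (simp add: power_divide)
    also have "\<dots> \<le> 333 * \<gamma> ^ q * (4 * (12 * (\<Sum>k=1..<r. real k * (1 / real k ^ q))))"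
    proof (intro mult_left_mono)
      have "(\<Sum>e\<in>E. ?f (fst e) + ?f (snd e)) \<le> 4 * (\<Sum>v\<in>V. ?f v)"
        using n_ge_2 by (intro sum_torus_E_le) auto
      also have "\<dots> \<le> 4 * (12 * (\<Sum>k=1..<r. real k * (1 / real k ^ q)))"
        by (intro mult_left_mono sum_peak_dist_le) auto
      finally show "(\<Sum>e\<in>E. ?f (fst e) + ?f (snd e)) \<le> 4 * (12 * (\<Sum>k=1..<r. real k * (1 / real k ^ q)))" .
    qed (use \<gamma> in auto)
    finally show ?thesis by simp
  qed
  have m2: "(\<Sum>\<omega>\<in>Pow E. bad_prob \<omega> * (\<Sum>e\<in>E. (?b e \<omega> / \<epsilon>)\<^sup>2)) \<le> K / 16"
  proof -
    have "(\<Sum>k=1..<r. real k * (1 / (real k)\<^sup>2)) = (\<Sum>k=1..<r. 1 / real k)"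
      by (intro sum.cong) (auto simp: power2_eq_square)
    also have "\<dots> \<le> 2 * ln (real r)" using r by (intro sum_inverse_le_ln) simp
    finally have "15984 * \<gamma>\<^sup>2 * (\<Sum>k=1..<r. real k * (1 / (real k)\<^sup>2)) \<le> 15984 * \<gamma>\<^sup>2 * (2 * ln (real r))"
      by (intro mult_left_mono) auto
    then show ?thesis using moment[of 2] by (simp add: K_def)
  qed
  \<comment> \<open>This fixes the value 1/320: 31968 times its cube is at most 1/1024, and the
    later factor 64 turns 1/1024 into 1/16.\<close>
  have m3: "(\<Sum>\<omega>\<in>Pow E. bad_prob \<omega> * (\<Sum>e\<in>E. (?b e \<omega> / \<epsilon>) ^ 3)) \<le> 1 / 1024"
  proof -
    have "(\<Sum>k=1..<r. real k * (1 / (real k) ^ 3)) = (\<Sum>k=1..<r. 1 / (real k)\<^sup>2)"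
      by (intro sum.cong) (auto simp: power2_eq_square power3_eq_cube)
    also have "\<dots> \<le> 2" by (rule sum_inverse_square_le)
    finally have "15984 * \<gamma> ^ 3 * (\<Sum>k=1..<r. real k * (1 / (real k) ^ 3)) \<le> 15984 * \<gamma> ^ 3 * 2"
      using \<gamma> by (intro mult_left_mono) auto
    moreover have "\<gamma> ^ 3 \<le> (1/320) ^ 3" using \<gamma> by (intro power_mono) auto
    ultimately show ?thesis using moment[of 3] by (simp add: power3_eq_cube)
  qed
  \<comment> \<open>If the excess at the centre is at most 3, the reach there is at most 4, whose
    logarithm is a third of \<open>ln 64\<close> and so at most a third of \<open>ln r\<close>. The
    peak keeps two thirds of its height, which is compared with \<open>2 * h\<close> through
    \<open>n < r ^ 3\<close>.\<close>
  have m0: "(\<Sum>\<omega>\<in>Pow E. bad_prob \<omega> * of_bool (\<not> 2 * h \<le> ?\<tau> \<omega> (c, 0))) \<le> 1 / 16"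
  proof -
    have "of_bool (\<not> 2 * h \<le> ?\<tau> \<omega> (c, 0)) \<le> (of_bool (4 \<le> excess \<omega> (c, 0)) :: real)" if \<omega>: "\<omega> \<in> Pow E" for \<omega>
    proof (cases "4 \<le> excess \<omega> (c, 0)")
      case False
      have "reach \<omega> (c, 0) = 1 + excess \<omega> (c, 0)"
        using reach_eq_excess[of \<omega> "(c, 0)"] \<omega> by (simp add: peak_dist_center)
      then have R: "1 \<le> reach \<omega> (c, 0)" "reach \<omega> (c, 0) \<le> 4" using False by auto
      have "3 * ln (4::real) = ln 64" using ln_realpow[of 4 3] by simp
      moreover have "ln 64 \<le> ln (real r)" using r by (subst ln_le_cancel_iff) auto
      moreover have "ln (real (reach \<omega> (c, 0))) \<le> ln 4" using R by (intro ln_mono) auto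
      ultimately have "ln (real (reach \<omega> (c, 0))) \<le> ln (real r) / 3" by linarith
      then have "C * (2/3 * ln (real r)) \<le> ?\<tau> \<omega> (c, 0)"
        unfolding height_def using C by (intro mult_left_mono) auto
      moreover have "2 * h \<le> C * (2/3 * ln (real r))"
      proof -
        have "ln (real n) \<le> ln (real r ^ 3)" using nr n_ge_2 r
          by (intro ln_mono) (auto simp flip: of_nat_power)
        also have "\<dots> = 3 * ln (real r)" using r by (subst ln_realpow) auto
        finally have "C * (2/9) * ln (real n) \<le> C * (2/9) * (3 * ln (real r))"
          using C by (intro mult_left_mono) auto
        then show ?thesis by (simp add: h_def C_def)
      qed
      ultimately show ?thesis by simp
    qed simp
    then have "(\<Sum>\<omega>\<in>Pow E. bad_prob \<omega> * of_bool (\<not> 2 * h \<le> ?\<tau> \<omega> (c, 0)))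
       \<le> (\<Sum>\<omega>\<in>Pow E. bad_prob \<omega> * of_bool (4 \<le> excess \<omega> (c, 0)))"
      by (intro sum_mono mult_left_mono bad_prob_nonneg) auto
    also have "\<dots> \<le> (1/2) ^ 4" by (rule excess_tail)
    finally show ?thesis by (simp add: power_divide)
  qed
  have error: "(\<Sum>\<omega>\<in>Pow E. bad_prob \<omega> * ((\<Sum>e\<in>E. (?b e \<omega> / \<epsilon>)\<^sup>2) / K
        + 64 * (\<Sum>e\<in>E. (?b e \<omega> / \<epsilon>) ^ 3) + of_bool (\<not> 2 * h \<le> ?\<tau> \<omega> (c, 0)))) \<le> 3/16"
  proof -
    have lin: "(\<Sum>\<omega>\<in>Pow E. bad_prob \<omega> * (f \<omega> / K + 64 * g \<omega> + k \<omega>)) =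
       (\<Sum>\<omega>\<in>Pow E. bad_prob \<omega> * f \<omega>) / K + 64 * (\<Sum>\<omega>\<in>Pow E. bad_prob \<omega> * g \<omega>) + (\<Sum>\<omega>\<in>Pow E. bad_prob \<omega> * k \<omega>)" for f g k
      by (simp add: algebra_simps sum.distrib sum_distrib_left sum_divide_distrib)
    have "(\<Sum>\<omega>\<in>Pow E. bad_prob \<omega> * (\<Sum>e\<in>E. (?b e \<omega> / \<epsilon>)\<^sup>2)) / K \<le> (K / 16) / K"
      using m2 K0 by (intro divide_right_mono) auto
    also have "\<dots> = 1/16" using K0 by simp
    finally show ?thesis unfolding lin using m3 m0 by linarith
  qed
  show ?thesis
  proof (intro exI[of _ ?\<tau>] conjI allI impI)
    show "?\<tau> \<omega> v = 0" if "\<omega> \<subseteq> E" "?\<rho> v = r" for \<omega> v using height_eq_0[OF that(1) \<rho>(1) that(2)] .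
    have "?\<rho> (0, 0) = r" using c by (intro peak_dist_far r1) auto
    then have root: "?\<tau> \<omega> (0, 0) = 0" if "\<omega> \<subseteq> E" for \<omega> using height_eq_0[OF that \<rho>(1)] by simp
    show "(\<integral>\<^sup>+\<phi>. ennreal (weight \<phi> * of_bool (flat h \<phi>)) \<partial>ref_measure n) \<le>
     ennreal (exp ((B + 18) * K)) * (\<Sum>\<omega>\<in>Pow E.
         (\<integral>\<^sup>+\<phi>. ennreal (W \<phi> \<omega> * of_bool (2 * h \<le> ?\<tau> \<omega> (c, 0) \<and> flat h (\<lambda>v. \<phi> v - ?\<tau> \<omega> v))) \<partial>ref_measure n) +
         (\<integral>\<^sup>+\<phi>. ennreal (W \<phi> \<omega> * of_bool (2 * h \<le> ?\<tau> \<omega> (c, 0) \<and> flat h (\<lambda>v. \<phi> v + ?\<tau> \<omega> v))) \<partial>ref_measure n)) +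
     ennreal (Z * (3/16))"
    proof (rule flat_weight_integral_le[where b="?b" and \<tau>="?\<tau>" and Q="\<lambda>\<omega>. 2 * h \<le> ?\<tau> \<omega> (c, 0)",
          OF _ _ _ _ K0 root error])
      show "edge_diff (?\<tau> \<omega>) e = 0" if "e \<in> \<omega>" for \<omega> e using edge_diff_height_bad[OF that] .
      show "\<bar>edge_diff (?\<tau> \<omega>) e\<bar> \<le> ?b e \<omega>" if "\<omega> \<subseteq> E" "e \<in> E" for \<omega> e
        using edge_diff_height_le[OF that _ \<rho>] C by simp
      show "0 \<le> ?b e \<omega>" for \<omega> e using height_step_nonneg C by simp
      show "?b e \<omega> \<le> ?b e \<omega>'" if "\<omega> \<subseteq> \<omega>'" "\<omega>' \<subseteq> E" for \<omega> \<omega>' e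
        using height_step_mono[OF _ that] C by simp
    qed
  qed
qed

text \<open>Peaks are placed at r - 1 points of the axis with spacing r. For each sign the shifted
  flat events are disjoint, so their masses sum to at most Z, and summing over all peaks bounds the
  probability by \<open>2 * X / (r - 1) + 3/16\<close>.\<close>

lemma flat_prob_large:
  assumes ctrl: "controlled_gradients (1/8) (1 - \<epsilon>) n U"
    and r: "64 \<le> r" "r * r \<le> n" "n < r ^ 3"
    and \<gamma>: "0 < \<gamma>" "\<gamma> \<le> 1/320" "32 * 31968 * (B + 18) * \<gamma>\<^sup>2 \<le> 1"
  shows "measure (gibbs_measure n U) {\<phi> \<in> space (gibbs_measure n U). flat (\<gamma> * \<epsilon> / 9 * ln (real n)) \<phi>} \<le> 1/2"
proof -
  interpret prob_space "gibbs_measure n U" by (rule prob_space_gibbs)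
  define h where "h = \<gamma> * \<epsilon> / 9 * ln (real n)"
  define X where "X = exp ((B + 18) * (16 * (31968 * \<gamma>\<^sup>2 * ln (real r))))"
  define c where "c i = int (i * r)" for i
  let ?I = "{1..r - 1}" and ?R = "ref_measure n"
  let ?p = "prob {\<phi> \<in> space (gibbs_measure n U). flat h \<phi>}"
  let ?a = "\<integral>\<^sup>+\<phi>. ennreal (weight \<phi> * of_bool (flat h \<phi>)) \<partial>?R"
  have cI: "int r \<le> c i" "c i + int r \<le> int n" if "i \<in> ?I" for i
  proof -
    have "Suc i \<le> r" using that r by auto
    then have "Suc i * r \<le> r * r" by (rule mult_le_mono1)
    then have "r \<le> i * r" "i * r + r \<le> r * r" using that by auto
    then have "r \<le> i * r" "i * r + r \<le> n" using r(2) by auto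
    then show "int r \<le> c i" "c i + int r \<le> int n"
      unfolding c_def of_nat_add[symmetric] of_nat_le_iff .
  qed
  have far: "peak_dist r (c i) (c j, 0) = r" if "i \<noteq> j" for i j
  proof (rule peak_dist_far)
    have "c j - c i = (int j - int i) * int r" by (simp add: c_def left_diff_distrib)
    then have "\<bar>c j - c i\<bar> = \<bar>int j - int i\<bar> * int r" by (simp add: abs_mult)
    moreover have "1 * int r \<le> \<bar>int j - int i\<bar> * int r" using that by (intro mult_right_mono) auto
    ultimately show "int r \<le> \<bar>c j - c i\<bar>" by simp
  qed (use r in simp)
  have cV: "(c i, 0) \<in> V" if "i \<in> ?I" for i
    using cI[OF that] n_ge_2 by (auto simp: torus_V_def)
  define good where "good i \<tau> \<longleftrightarrow> (\<forall>\<omega> v. \<omega> \<subseteq> E \<longrightarrow> peak_dist r (c i) v = r \<longrightarrow> \<tau> \<omega> v = 0) \<and>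
     ?a \<le> ennreal X * (\<Sum>\<omega>\<in>Pow E.
         (\<integral>\<^sup>+\<phi>. ennreal (W \<phi> \<omega> * of_bool (2 * h \<le> \<tau> \<omega> (c i, 0) \<and> flat h (\<lambda>v. \<phi> v - \<tau> \<omega> v))) \<partial>?R) +
         (\<integral>\<^sup>+\<phi>. ennreal (W \<phi> \<omega> * of_bool (2 * h \<le> \<tau> \<omega> (c i, 0) \<and> flat h (\<lambda>v. \<phi> v + \<tau> \<omega> v))) \<partial>?R)) +
     ennreal (Z * (3/16))" for i \<tau>
  have "\<exists>\<tau>. good i \<tau>" if "i \<in> ?I" for i
    unfolding good_def X_def h_def by (rule peak_exists[OF ctrl cI[OF that] r(1,3) \<gamma>(1,2)])
  then obtain \<tau> where \<tau>: "\<And>i. i \<in> ?I \<Longrightarrow> good i (\<tau> i)" by metis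
  have \<tau>0: "\<tau> i \<omega> v = 0" if "i \<in> ?I" "\<omega> \<subseteq> E" "peak_dist r (c i) v = r" for i \<omega> v
    using \<tau>[OF that(1)] that(2,3) unfolding good_def by blast
  note le = \<tau>[unfolded good_def, THEN conjunct2]
  \<comment> \<open>The total over all peaks is bounded by the mass of a single
    \<open>\<omega>\<close>; treating the two signs separately costs a factor 2 in the end.\<close>
  have sign: "(\<Sum>i\<in>?I. \<integral>\<^sup>+\<phi>. ennreal (W \<phi> \<omega> * of_bool (2 * h \<le> \<tau> i \<omega> (c i, 0) \<and> flat h (\<lambda>v. \<phi> v + s * \<tau> i \<omega> v))) \<partial>?R)
      \<le> ennreal (Z * bad_prob \<omega>)" if \<omega>: "\<omega> \<subseteq> E" and s: "s = 1 \<or> s = - 1" for \<omega> and s :: real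
  proof -
    let ?Q = "\<lambda>\<phi> i. 2 * h \<le> \<tau> i \<omega> (c i, 0) \<and> flat h (\<lambda>v. \<phi> v + s * \<tau> i \<omega> v)"
    \<comment> \<open>At the centre of peak j the shift of peak i is 0, so event i forces a value
      below h in modulus, whereas event j forces a value within h of a number of modulus at least
      \<open>2 * h\<close>.\<close>
    have unique: "i = j" if ij: "i \<in> ?I" "j \<in> ?I" "?Q \<phi> i" "?Q \<phi> j" for i j \<phi>
    proof (rule ccontr)
      assume "i \<noteq> j"
      then have "\<tau> i \<omega> (c j, 0) = 0" using \<tau>0[OF ij(1) \<omega>] far by simp
      then have "\<bar>\<phi> (c j, 0)\<bar> < h" using ij(3) cV[OF ij(2)] by (force simp: flat_def)
      moreover have "\<bar>\<phi> (c j, 0) + s * \<tau> j \<omega> (c j, 0)\<bar> < h" using ij(4) cV[OF ij(2)] by (simp add: flat_def)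
      ultimately show False using ij(4) s by auto
    qed
    have m: "(\<lambda>\<phi>. ennreal (W \<phi> \<omega> * of_bool (?Q \<phi> i))) \<in> borel_measurable ?R" for i
      using flat_shift_measurable[of h "\<lambda>v. s * \<tau> i \<omega> v"]
      by (intro measurable_compose[OF _ measurable_ennreal] borel_measurable_times of_bool_measurable W_measurable \<omega>
          pred_intros_logic) auto
    have "(\<Sum>i\<in>?I. \<integral>\<^sup>+\<phi>. ennreal (W \<phi> \<omega> * of_bool (?Q \<phi> i)) \<partial>?R) = (\<integral>\<^sup>+\<phi>. (\<Sum>i\<in>?I. ennreal (W \<phi> \<omega> * of_bool (?Q \<phi> i))) \<partial>?R)"
      using m by (intro nn_integral_sum[symmetric])
    also have "\<dots> \<le> (\<integral>\<^sup>+\<phi>. ennreal (W \<phi> \<omega>) \<partial>?R)"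
    proof (rule nn_integral_mono)
      fix \<phi>
      have "(\<Sum>i\<in>?I. W \<phi> \<omega> * of_bool (?Q \<phi> i)) \<le> W \<phi> \<omega> * 1"
        unfolding sum_distrib_left[symmetric] using unique
        by (intro mult_left_mono W_nonneg sum_of_bool_le_1) blast+
      then show "(\<Sum>i\<in>?I. ennreal (W \<phi> \<omega> * of_bool (?Q \<phi> i))) \<le> ennreal (W \<phi> \<omega>)"
        using W_nonneg by (subst sum_ennreal) (auto intro!: ennreal_leI)
    qed
    also have "\<dots> = ennreal (Z * bad_prob \<omega>)" by (rule nn_integral_W[OF \<omega>])
    finally show ?thesis .
  qed
  let ?P = "\<lambda>i \<omega>. \<integral>\<^sup>+\<phi>. ennreal (W \<phi> \<omega> * of_bool (2 * h \<le> \<tau> i \<omega> (c i, 0) \<and> flat h (\<lambda>v. \<phi> v - \<tau> i \<omega> v))) \<partial>?R"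
  let ?N = "\<lambda>i \<omega>. \<integral>\<^sup>+\<phi>. ennreal (W \<phi> \<omega> * of_bool (2 * h \<le> \<tau> i \<omega> (c i, 0) \<and> flat h (\<lambda>v. \<phi> v + \<tau> i \<omega> v))) \<partial>?R"
  have "(\<Sum>i\<in>?I. ?a) \<le> (\<Sum>i\<in>?I. ennreal X * (\<Sum>\<omega>\<in>Pow E. ?P i \<omega> + ?N i \<omega>) + ennreal (Z * (3/16)))"
    by (intro sum_mono le)
  also have "\<dots> = ennreal X * (\<Sum>i\<in>?I. \<Sum>\<omega>\<in>Pow E. ?P i \<omega> + ?N i \<omega>) + (\<Sum>i\<in>?I. ennreal (Z * (3/16)))"
    by (simp only: sum.distrib sum_distrib_left[symmetric])
  also have "(\<Sum>i\<in>?I. \<Sum>\<omega>\<in>Pow E. ?P i \<omega> + ?N i \<omega>) = (\<Sum>\<omega>\<in>Pow E. (\<Sum>i\<in>?I. ?P i \<omega>) + (\<Sum>i\<in>?I. ?N i \<omega>))"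
    unfolding sum.distrib[symmetric] by (rule sum.swap)
  also have "\<dots> \<le> (\<Sum>\<omega>\<in>Pow E. ennreal (Z * bad_prob \<omega>) + ennreal (Z * bad_prob \<omega>))"
    using sign[of _ "-1"] sign[of _ 1] by (intro sum_mono add_mono) auto
  also have "\<dots> = ennreal (\<Sum>\<omega>\<in>Pow E. 2 * Z * bad_prob \<omega>)"
    using Z_pos bad_prob_nonneg by (subst sum_ennreal[symmetric]) (auto simp: mult.assoc simp flip: ennreal_plus)
  also have "\<dots> \<le> ennreal (2 * Z)"
  proof (intro ennreal_leI)
    have "2 * Z * (\<Sum>\<omega>\<in>Pow E. bad_prob \<omega>) \<le> 2 * Z * 1"
      using sum_bad_prob_superset[OF ctrl, of "{}"] Z_pos by (intro mult_left_mono) auto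
    then show "(\<Sum>\<omega>\<in>Pow E. 2 * Z * bad_prob \<omega>) \<le> 2 * Z" by (simp add: sum_distrib_left)
  qed
  finally have main: "(\<Sum>i\<in>?I. ?a) \<le> ennreal X * ennreal (2 * Z) + (\<Sum>i\<in>?I. ennreal (Z * (3/16)))"
    by (simp add: add_right_mono mult_left_mono)
  have a: "?a = ennreal (Z * ?p)"
    using flat_shift_measurable[of h "\<lambda>_. 0"] by (intro nn_integral_weight_of_bool) simp
  have m: "real (card ?I) = real r - 1" using r by simp
  have "ennreal ((real r - 1) * (Z * ?p)) = (\<Sum>i\<in>?I. ?a)"
    unfolding a m[symmetric] using Z_pos by (subst sum_ennreal) auto
  also have "\<dots> \<le> ennreal (X * (2 * Z) + (real r - 1) * (Z * (3/16)))"
  proof -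
    have "(\<Sum>i\<in>?I. ennreal (Z * (3/16))) = ennreal ((real r - 1) * (Z * (3/16)))"
      unfolding m[symmetric] using Z_pos by (subst sum_ennreal) auto
    then show ?thesis using main Z_pos r by (simp add: X_def ennreal_plus ennreal_mult)
  qed
  finally have "(real r - 1) * (Z * ?p) \<le> X * (2 * Z) + (real r - 1) * (Z * (3/16))"
    using Z_pos r by (subst (asm) ennreal_le_iff) (auto simp: X_def)
  then have "Z * ((real r - 1) * ?p) \<le> Z * (2 * X + (real r - 1) * (3/16))" by (simp add: algebra_simps)
  then have p: "(real r - 1) * ?p \<le> 2 * X + (real r - 1) * (3/16)" using Z_pos by simp
  \<comment> \<open>The smallness of \<open>\<gamma>\<close> relative to B makes the exponent at
    most half of \<open>ln r\<close>.\<close>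
  have X: "X \<le> sqrt (real r)"
  proof -
    have "(B + 18) * (16 * (31968 * \<gamma>\<^sup>2 * ln (real r))) = (32 * 31968 * (B + 18) * \<gamma>\<^sup>2) * (ln (real r) / 2)" by simp
    also have "\<dots> \<le> 1 * (ln (real r) / 2)" using \<gamma>(3) r by (intro mult_right_mono) auto
    also have "\<dots> = ln (sqrt (real r))" using r by (simp add: ln_sqrt)
    finally have "X \<le> exp (ln (sqrt (real r)))" unfolding X_def by simp
    then show ?thesis using r by simp
  qed
  \<comment> \<open>From r >= 64 the main term takes at most 5/16, and 5/16 + 3/16 = 1/2.\<close>
  have "2 * sqrt (real r) \<le> (real r - 1) * (5/16)"
  proof -
    define s where "s = sqrt (real r)"
    have s8: "8 \<le> s" unfolding s_def using r by (intro real_le_rsqrt) auto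
    have rs: "real r = s * s" by (simp add: s_def)
    have "8 * s \<le> s * s" using s8 by (intro mult_right_mono) auto
    then have "32 * s \<le> 5 * (s * s) - 5" using s8 by linarith
    then have "2 * s \<le> (5 * (s * s) - 5) / 16" by simp
    also have "\<dots> = (s * s - 1) * (5/16)" by (simp add: field_simps)
    finally have "2 * s \<le> (s * s - 1) * (5/16)" .
    then show ?thesis unfolding rs[symmetric] by (simp only: s_def)
  qed
  then have "(real r - 1) * ?p \<le> (real r - 1) * (5/16) + (real r - 1) * (3/16)" using p X by linarith
  also have "\<dots> = (real r - 1) * (1/2)" unfolding distrib_left[symmetric] by simp
  finally show ?thesis using r unfolding h_def by simp
qed

text \<open>As h decreases to 0, the flat events shrink into the set where
  \<open>\<phi> (1, 0) = 0\<close>. This is a null set, because the site (1, 0) is not pinned and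
  the Gibbs measure has a density; continuity from above concludes.\<close>

lemma flat_prob_small: "\<exists>h>0. measure (gibbs_measure n U) {\<phi> \<in> space (gibbs_measure n U). flat h \<phi>} \<le> 1/2"
proof -
  interpret prob_space "gibbs_measure n U" by (rule prob_space_gibbs)
  interpret site: product_sigma_finite "site_measure (0::int, 0::int)" by (rule product_sigma_finite_site_measure)
  define A where "A k = {\<phi> \<in> space (gibbs_measure n U). flat (1 / real (Suc k)) \<phi>}" for k
  have A: "A k \<in> events" for k
    unfolding A_def using flat_shift_measurable[of _ "\<lambda>_. 0"] by (simp add: pred_def)
  have dec: "decseq A"
  proof (rule decseq_SucI)
    fix k
    have "1 / real (Suc (Suc k)) \<le> 1 / real (Suc k)" by (intro divide_left_mono) auto
    then show "A (Suc k) \<subseteq> A k" by (force simp: A_def flat_def)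
  qed
  let ?N = "Pi\<^sub>E V (\<lambda>v. if v = (1, 0) then {0} else UNIV)"
  have v: "(1, 0) \<in> V" using n_ge_2 by (simp add: torus_V_def)
  have "(\<Inter>k. A k) \<subseteq> ?N"
  proof
    fix \<phi> assume \<phi>: "\<phi> \<in> (\<Inter>k. A k)"
    have small: "\<bar>\<phi> (1, 0)\<bar> < 1 / real (Suc k)" for k using \<phi> v by (auto simp: A_def flat_def)
    have "\<phi> (1, 0) = 0"
    proof (rule ccontr)
      assume "\<phi> (1, 0) \<noteq> 0"
      then obtain k where "1 / real (Suc k) < \<bar>\<phi> (1, 0)\<bar>" using nat_approx_posE[of "\<bar>\<phi> (1, 0)\<bar>"] by auto
      then show False using small[of k] by simp
    qed
    then show "\<phi> \<in> ?N" using \<phi> by (auto simp: A_def ref_measure_eq space_PiM PiE_iff)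
  qed
  moreover have "?N \<in> null_sets (gibbs_measure n U)"
  proof -
    have N: "?N \<in> sets (ref_measure n)"
      unfolding ref_measure_eq by (intro sets_PiM_I_finite finite_torus_V) auto
    have "emeasure (ref_measure n) ?N = (\<Prod>v\<in>V. emeasure (site_measure (0, 0) v) (if v = (1, 0) then {0} else UNIV))"
      unfolding ref_measure_eq by (intro site.emeasure_PiM finite_torus_V) auto
    also have "\<dots> = 0"
      using v finite_torus_V by (intro prod_zero bexI[of _ "(1, 0)"]) (auto simp: site_measure_def)
    finally have "?N \<in> null_sets (ref_measure n)" using N by auto
    then show ?thesis unfolding gibbs_measure_def
      using absolutely_continuousI_density[of "\<lambda>\<phi>. gibbs_weight n U \<phi> / partition_fn n U" "ref_measure n"]
      by (auto simp: absolutely_continuous_def)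
  qed
  moreover have "(\<Inter>k. A k) \<in> events" using A by auto
  ultimately have "(\<Inter>k. A k) \<in> null_sets (gibbs_measure n U)" by (metis null_sets_subset)
  then have "prob (\<Inter>k. A k) = 0" by (rule measure_eq_0_null_sets)
  moreover have "(\<lambda>k. prob (A k)) \<longlonglongrightarrow> prob (\<Inter>k. A k)"
    using A dec by (intro finite_Lim_measure_decseq) auto
  ultimately have "eventually (\<lambda>k. prob (A k) < 1/2) sequentially"
    by (intro order_tendstoD) auto
  then obtain k where "prob (A k) < 1/2" by (auto simp: eventually_sequentially)
  then show ?thesis unfolding A_def by (intro exI[of _ "1 / real (Suc k)"]) auto
qed

lemma exceed_prob:
  assumes "measure (gibbs_measure n U) {\<phi> \<in> space (gibbs_measure n U). flat h \<phi>} \<le> 1/2" "h' \<le> h"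
  shows "1/2 \<le> measure (gibbs_measure n U) {\<phi> \<in> space (gibbs_measure n U). \<exists>v\<in>V. h' \<le> \<bar>\<phi> v\<bar>}"
proof -
  interpret prob_space "gibbs_measure n U" by (rule prob_space_gibbs)
  let ?S = "space (gibbs_measure n U)"
  have ev: "{\<phi> \<in> ?S. flat h \<phi>} \<in> events" for h
    using flat_shift_measurable[of h "\<lambda>_. 0"] by (simp add: pred_def)
  have "{\<phi> \<in> ?S. \<exists>v\<in>V. h' \<le> \<bar>\<phi> v\<bar>} = ?S - {\<phi> \<in> ?S. flat h' \<phi>}" by (auto simp: flat_def not_less)
  then have "prob {\<phi> \<in> ?S. \<exists>v\<in>V. h' \<le> \<bar>\<phi> v\<bar>} = 1 - prob {\<phi> \<in> ?S. flat h' \<phi>}"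
    using prob_compl[OF ev] by simp
  moreover have "prob {\<phi> \<in> ?S. flat h' \<phi>} \<le> prob {\<phi> \<in> ?S. flat h \<phi>}"
    using assms(2) ev by (intro finite_measure_mono) (force simp: flat_def)+
  ultimately show ?thesis using assms(1) by simp
qed

end

section \<open>Choice of one constant for all n\<close>

theorem theorem4p2:
  fixes U :: "real \<Rightarrow> ereal" and \<epsilon> :: real
  assumes meas: "U \<in> borel_measurable borel"
    and symm: "\<And>x. U (- x) = U x"
    and bdd_below: "\<exists>M::real. \<forall>x. ereal M \<le> U x"
    and int_pos: "0 < (\<integral>\<^sup>+ x. expneg U x \<partial>lborel)"
    and int_fin: "(\<integral>\<^sup>+ x. expneg U x \<partial>lborel) < \<infinity>"
    and C2: "(\<forall>x\<in>{-1..1}. U x \<noteq> \<infinity>) \<and>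
             (\<exists>U' U''. (\<forall>x\<in>{-1..1}.
                 ((\<lambda>y. real_of_ereal (U y)) has_real_derivative U' x) (at x within {-1..1}) \<and>
                 (U' has_real_derivative U'' x) (at x within {-1..1})) \<and>
               continuous_on {-1..1} U'')"
    and eps: "0 < \<epsilon>" "\<epsilon> \<le> 1/2"
  shows "\<exists>c>0. \<forall>n::nat. n \<ge> 2 \<longrightarrow> controlled_gradients (1/8) (1 - \<epsilon>) n U \<longrightarrow>
           measure (gibbs_measure n U)
             {\<phi> \<in> space (gibbs_measure n U). \<exists>v\<in>torus_V n. \<bar>\<phi> v\<bar> \<ge> c * ln (real n)} \<ge> 1/2"
proof -
  obtain M where M: "\<And>x. ereal M \<le> U x" using bdd_below by blast
  obtain U' U'' where
    U': "\<And>x. x \<in> {-1..1} \<Longrightarrow> ((\<lambda>y. real_of_ereal (U y)) has_real_derivative U' x) (at x within {-1..1})"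
    and U'': "\<And>x. x \<in> {-1..1} \<Longrightarrow> (U' has_real_derivative U'' x) (at x within {-1..1})"
    and cont: "continuous_on {-1..1} U''"
    using C2 by blast
  have "compact (U'' ` {-1..1})" by (intro compact_continuous_image cont compact_Icc)
  then obtain B where "\<forall>y\<in>U'' ` {-1..1}. norm y \<le> B"
    using compact_imp_bounded bounded_iff by metis
  then have B: "\<bar>U'' x\<bar> \<le> B" if "x \<in> {-1..1}" for x using that by auto
  have surf: "torus_surface U (\<lambda>y. real_of_ereal (U y)) U' U'' B \<epsilon> n M" if "2 \<le> n" for n
  proof
    show "edge_weight U x = exp (- real_of_ereal (U x))" if "x \<in> {-1..1}" for x
      using C2 that by (intro edge_weight_eq_exp) auto
  qed (use U' U'' B eps that meas symm M int_fin edge_weight_nonneg in auto)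
  have B0: "0 \<le> B" using B[of 0] by simp
  \<comment> \<open>The first entry serves the cubic error bound, the second keeps the exponential
    cost of a peak below \<open>sqrt r\<close>.\<close>
  define \<gamma> where "\<gamma> = min (1/320) (1 / sqrt (32 * 31968 * (B + 18)))"
  have \<gamma>: "0 < \<gamma>" "\<gamma> \<le> 1/320" using B0 by (auto simp: \<gamma>_def)
  have \<gamma>2: "32 * 31968 * (B + 18) * \<gamma>\<^sup>2 \<le> 1"
  proof -
    have "\<gamma>\<^sup>2 \<le> (1 / sqrt (32 * 31968 * (B + 18)))\<^sup>2" using \<gamma> by (intro power_mono) (auto simp: \<gamma>_def)
    also have "\<dots> = 1 / (32 * 31968 * (B + 18))" using B0 by (simp add: power_divide)
    finally show ?thesis using B0 by (simp add: field_simps)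
  qed
  \<comment> \<open>Quantifying over all smaller \<open>h'\<close> allows the individual threshold
    to be lowered to a common one.\<close>
  define D where "D n h \<longleftrightarrow> 0 < h \<and> (\<forall>h'\<le>h. 1/2 \<le> measure (gibbs_measure n U)
       {\<phi> \<in> space (gibbs_measure n U). \<exists>v\<in>torus_V n. \<bar>\<phi> v\<bar> \<ge> h'})" for n h
  have "\<exists>h. D n h" if "2 \<le> n" for n
  proof -
    interpret torus_surface U "\<lambda>y. real_of_ereal (U y)" U' U'' B \<epsilon> n M by (rule surf[OF that])
    show ?thesis using flat_prob_small exceed_prob unfolding D_def by blast
  qed
  then obtain H where H: "\<And>n. 2 \<le> n \<Longrightarrow> D n (H n)" by metis
  \<comment> \<open>4096 = 64 * 64 is where the integer square root reaches 64. Each smaller n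
    contributes its own ratio, and c is the minimum of finitely many positive numbers.\<close>
  define S where "S = (\<lambda>n. H n / ln (real n)) ` {2..<4096}"
  define c where "c = Min (insert (\<gamma> * \<epsilon> / 9) S)"
  have S: "finite S" by (simp add: S_def)
  have "0 < c"
    unfolding c_def using S \<gamma> eps H by (subst Min_gr_iff) (auto simp: S_def D_def)
  moreover have "1/2 \<le> measure (gibbs_measure n U)
       {\<phi> \<in> space (gibbs_measure n U). \<exists>v\<in>torus_V n. \<bar>\<phi> v\<bar> \<ge> c * ln (real n)}"
    if n: "2 \<le> n" and ctrl: "controlled_gradients (1/8) (1 - \<epsilon>) n U" for n
  proof (cases "n < 4096")
    case True
    then have "c \<le> H n / ln (real n)" unfolding c_def using S n by (intro Min_le) (auto simp: S_def)
    then have "c * ln (real n) \<le> H n" using n by (simp add: field_simps)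
    then show ?thesis using H[OF n] by (auto simp: D_def)
  next
    case False
    interpret torus_surface U "\<lambda>y. real_of_ereal (U y)" U' U'' B \<epsilon> n M by (rule surf[OF n])
    \<comment> \<open>With \<open>r * r \<le> n\<close> the r - 1 peaks of spacing r fit on the
      positive half of the axis, and \<open>n < r ^ 3\<close> keeps \<open>ln r\<close> comparable
      to \<open>ln n\<close>.\<close>
    define r where "r = floor_sqrt n"
    have r2: "r * r \<le> n" using floor_sqrt_power2_le[of n] by (simp add: r_def power2_eq_square)
    have r64: "64 \<le> r" unfolding r_def using False by (intro le_floor_sqrtI) auto
    have "n < (Suc r)\<^sup>2" unfolding r_def by (rule Suc_floor_sqrt_power2_gt)
    also have "(Suc r)\<^sup>2 \<le> r ^ 3"
    proof -
      have "Suc r * Suc r = r * r + 2 * r + 1" by simp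
      also have "\<dots> \<le> r * r + 2 * (r * r) + r * r" using r64 by (intro add_mono mult_le_mono2) auto
      also have "\<dots> = 4 * (r * r)" by simp
      also have "\<dots> \<le> r * (r * r)" using r64 by (intro mult_le_mono1) auto
      finally show ?thesis by (simp add: power2_eq_square power3_eq_cube)
    qed
    finally have r3: "n < r ^ 3" .
    have "c \<le> \<gamma> * \<epsilon> / 9" unfolding c_def using S by (intro Min_le) auto
    then have "c * ln (real n) \<le> \<gamma> * \<epsilon> / 9 * ln (real n)" using n by (intro mult_right_mono) auto
    with exceed_prob[OF flat_prob_large[OF ctrl r64 r2 r3 \<gamma> \<gamma>2]] show ?thesis .
  qed
  ultimately show ?thesis by blast
qed

end
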